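(* There is an algorithm that, given an $\mathsf{LCL}$ problem $\Pi$, decides in time polynomial in the size of the description of $\Pi$ whether $\Pi$ has round complexity $O(\log n)$ or $n^{\Omega(1)}$ on $n$-node full $\delta$-ary rooted trees (one of the two always holds).
   Context: An $\mathsf{LCL}$ problem is a triple $\Pi=(\delta,\Sigma,\mathcal C)$ where $\delta\ge 1$ is an integer, $\Sigma$ is a finite set of labels, and $\mathcal C\subseteq\Sigma^{\delta+1}$ is a set of allowed configurations, written $(a:b_1,\dots,b_\delta)$; the order of $b_1,\dots,b_\delta$ is irrelevant. The description of $\Pi$ lists $\delta$, $\Sigma$ and all configurations in $\mathcal C$ explicitly. Inputs to $\Pi$ are unlabeled full $\delta$-ary rooted trees (every node has exactly $\delta$ or $0$ children). A solution on a tree $T$ is a labeling $\lambda:V(T)\to\Sigma$ such that for every node $v$ with $\delta$ children $v_1,\dots,v_\delta$ there is a permutation $\rho$ of $\{1,\dots,\delta\}$ with $(\lambda(v):\lambda(v_{\rho(1)}),\dots,\lambda(v_{\rho(\delta)}))\in\mathcal C$; leaves are unconstrained. Models. In $\mathsf{LOCAL}$ on an $n$-node graph each node has a unique identifier from $\{1,\dots,\mathrm{poly}(n)\}$ and initially knows its identifier, its degree, $n$, the maximum degree, and which incident edge leads to its parent. In synchronous rounds nodes exchange unbounded messages with neighbors and do unbounded local computation; each node eventually outputs its label. The running time is the number of rounds until all nodes have output. $\mathsf{CONGEST}$ is the same with $O(\log n)$-bit messages. In the randomized versions each node has its own random bits and the global output must be correct with probability at least $1-1/n$. The round complexity of $\Pi$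 is the best worst-case running time, as a function of $n$, of an algorithm solving $\Pi$; it may be read in any of the four models (deterministic or randomized, $\mathsf{LOCAL}$ or $\mathsf{CONGEST}$), the answer being the same in all of them. If $\Pi$ has no solution on some trees, any lower bound holds trivially. *)

theory Defs
  imports
    "HOL-Library.Extended_Real"
    "HOL-Combinatorics.Permutations"
    "HOL-Computational_Algebra.Polynomial"
begin

section \<open>Rooted trees and LCL problems\<close>

text \<open>
  A full rooted tree is given by its set of vertices, a vertex being the sequence of child indices
  on the path from the root. The root is the empty list, and the children of \<open>v\<close> are the
  lists \<open>v @ [i]\<close> in the set. The indices only serve as port numbers towards the children;
  as all such sets are considered, the port numbering is adversarial.
\<close>

type_synonym vertex = "nat list"

definition full_tree :: "nat \<Rightarrow> vertex set \<Rightarrow> bool" where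
  "full_tree \<delta> T \<longleftrightarrow>
     finite T \<and> [] \<in> T \<and> (\<forall>v i. v @ [i] \<in> T \<longrightarrow> v \<in> T) \<and>
     (\<forall>v\<in>T. {i. v @ [i] \<in> T} = {} \<or> {i. v @ [i] \<in> T} = {..<\<delta>})"

definition num_children :: "vertex set \<Rightarrow> vertex \<Rightarrow> nat" where
  "num_children T v = card {i. v @ [i] \<in> T}"

text \<open>Labels are natural numbers. A pair \<open>(a, bs)\<close> is the configuration \<open>(a : b\<^sub>1, \<dots>, b\<^sub>\<delta>)\<close>.\<close>

record lcl =
  arity :: nat
  labels :: "nat set"
  configs :: "(nat \<times> nat list) set"

definition is_lcl :: "lcl \<Rightarrow> bool" where
  "is_lcl \<P> \<longleftrightarrow>
     arity \<P> \<ge> 1 \<and> finite (labels \<P>) \<and>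
     (\<forall>(a, bs) \<in> configs \<P>. a \<in> labels \<P> \<and> set bs \<subseteq> labels \<P> \<and> length bs = arity \<P>)"

definition is_solution :: "lcl \<Rightarrow> vertex set \<Rightarrow> (vertex \<Rightarrow> nat) \<Rightarrow> bool" where
  "is_solution \<P> T lab \<longleftrightarrow>
     (\<forall>v\<in>T. lab v \<in> labels \<P>) \<and>
     (\<forall>v\<in>T. num_children T v = arity \<P> \<longrightarrow>
        (\<exists>\<rho>. \<rho> permutes {..<arity \<P>} \<and>
             (lab v, map (\<lambda>i. lab (v @ [\<rho> i])) [0..<arity \<P>]) \<in> configs \<P>))"


section \<open>The deterministic LOCAL model\<close>

text \<open>
  What a vertex knows initially. The edge to the parent is a distinguished port, so that only its
  existence has to be recorded; \<open>own_degree\<close> is the degree in the undirected tree.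
\<close>

record knowledge =
  ident :: nat
  own_degree :: nat
  has_parent :: bool
  num_nodes :: nat
  max_degree :: nat

definition vertex_degree :: "vertex set \<Rightarrow> vertex \<Rightarrow> nat" where
  "vertex_degree T v = num_children T v + (if v = [] then 0 else 1)"

definition initial_knowledge :: "vertex set \<Rightarrow> (vertex \<Rightarrow> nat) \<Rightarrow> vertex \<Rightarrow> knowledge" where
  "initial_knowledge T ids v =
     \<lparr>ident = ids v, own_degree = vertex_degree T v, has_parent = (v \<noteq> []),
      num_nodes = card T, max_degree = Max (vertex_degree T ` T)\<rparr>"

text \<open>
  Messages are bit strings of arbitrary length. What a vertex receives in one round is the message
  of its parent (if any) and the list of the messages of its children. Since local computation and
  memory are unbounded, the state of a vertex is, without loss of generality, its initial
  knowledge together with everything it has received so far.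
\<close>

type_synonym message = "bool list"
type_synonym inbox = "message option \<times> message list"

record algorithm =
  to_parent :: "knowledge \<Rightarrow> inbox list \<Rightarrow> message"
  to_child :: "knowledge \<Rightarrow> inbox list \<Rightarrow> nat \<Rightarrow> message"
  decision :: "knowledge \<Rightarrow> inbox list \<Rightarrow> nat option"

primrec history ::
  "algorithm \<Rightarrow> vertex set \<Rightarrow> (vertex \<Rightarrow> nat) \<Rightarrow> nat \<Rightarrow> vertex \<Rightarrow> inbox list" where
  "history A T ids 0 = (\<lambda>v. [])"
| "history A T ids (Suc r) = (\<lambda>v. history A T ids r v @
     [(if v = [] then None
       else Some (to_child A (initial_knowledge T ids (butlast v))
                    (history A T ids r (butlast v)) (last v)),
       map (\<lambda>i. to_parent A (initial_knowledge T ids (v @ [i])) (history A T ids r (v @ [i])))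
         [0..<num_children T v])])"

definition decision_at ::
  "algorithm \<Rightarrow> vertex set \<Rightarrow> (vertex \<Rightarrow> nat) \<Rightarrow> vertex \<Rightarrow> nat \<Rightarrow> nat option" where
  "decision_at A T ids v r = decision A (initial_knowledge T ids v) (history A T ids r v)"

text \<open>The first label a vertex decides on is final; later values of \<open>decision\<close> are ignored.\<close>

definition output_label :: "algorithm \<Rightarrow> vertex set \<Rightarrow> (vertex \<Rightarrow> nat) \<Rightarrow> vertex \<Rightarrow> nat" where
  "output_label A T ids v =
     the (decision_at A T ids v (LEAST r. decision_at A T ids v r \<noteq> None))"

definition output_time :: "algorithm \<Rightarrow> vertex set \<Rightarrow> (vertex \<Rightarrow> nat) \<Rightarrow> vertex \<Rightarrow> enat" where
  "output_time A T ids v = (INF r \<in> {r. decision_at A T ids v r \<noteq> None}. enat r)"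

definition running_time :: "algorithm \<Rightarrow> vertex set \<Rightarrow> (vertex \<Rightarrow> nat) \<Rightarrow> enat" where
  "running_time A T ids = (SUP v \<in> T. output_time A T ids v)"

text \<open>Identifiers come from \<open>{1..n ^ c}\<close>, where the exponent \<open>c\<close> is a parameter of the model.\<close>

definition instances :: "nat \<Rightarrow> nat \<Rightarrow> nat \<Rightarrow> (vertex set \<times> (vertex \<Rightarrow> nat)) set" where
  "instances c \<delta> n =
     {(T, ids). full_tree \<delta> T \<and> card T = n \<and> inj_on ids T \<and> ids ` T \<subseteq> {1..n ^ c}}"

definition solves :: "nat \<Rightarrow> algorithm \<Rightarrow> lcl \<Rightarrow> bool" where
  "solves c A \<P> \<longleftrightarrow>
     (\<forall>n. \<forall>(T, ids) \<in> instances c (arity \<P>) n.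
        (\<forall>v\<in>T. \<exists>r. decision_at A T ids v r \<noteq> None) \<and>
        is_solution \<P> T (output_label A T ids))"

text \<open>This is \<open>\<infinity>\<close> if no algorithm solves the problem.\<close>

definition round_complexity :: "nat \<Rightarrow> lcl \<Rightarrow> nat \<Rightarrow> enat" where
  "round_complexity c \<P> n =
     (INF A \<in> {A. solves c A \<P>}. SUP (T, ids) \<in> instances c (arity \<P>) n. running_time A T ids)"

definition complexity_O_log :: "nat \<Rightarrow> lcl \<Rightarrow> bool" where
  "complexity_O_log c \<P> \<longleftrightarrow>
     (\<exists>K::real. \<exists>N. \<forall>n\<ge>N. ereal_of_enat (round_complexity c \<P> n) \<le> ereal (K * ln (real n)))"

text \<open>
  A lower bound is only meaningful for those \<open>n\<close> for which an \<open>n\<close>-node full tree of the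
  given arity exists, that is, for \<open>n \<equiv> 1\<close> modulo the arity.
\<close>

definition complexity_poly_lower :: "nat \<Rightarrow> lcl \<Rightarrow> bool" where
  "complexity_poly_lower c \<P> \<longleftrightarrow>
     (\<exists>\<epsilon>::real. \<epsilon> > 0 \<and>
       (\<exists>N. \<forall>n\<ge>N. (\<exists>T. full_tree (arity \<P>) T \<and> card T = n) \<longrightarrow>
          ereal (real n powr \<epsilon>) \<le> ereal_of_enat (round_complexity c \<P> n)))"


section \<open>Sequential algorithms and their running time\<close>

text \<open>
  Polynomial time is defined through the language WHILE over binary trees of Jones
  (Computability and Complexity from a Programming Perspective, MIT Press 1997). Every executed
  assignment or test costs one step. With shared subtrees such a step amounts to boundedly many
  pointer operations (the number depending only on the program), and equality of trees is not a
  primitive; the problems decided in polynomial time are therefore the same as for Turing machines.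
\<close>

datatype data = Atom | Pair data data

datatype expr = Var nat | Const_Atom | Mk_Pair expr expr | Left expr | Right expr

datatype com = Assign nat expr | Seq com com | Cond expr com com | While expr com

type_synonym store = "nat \<Rightarrow> data"

fun left :: "data \<Rightarrow> data" where
  "left Atom = Atom"
| "left (Pair a b) = a"

fun right :: "data \<Rightarrow> data" where
  "right Atom = Atom"
| "right (Pair a b) = b"

primrec val :: "expr \<Rightarrow> store \<Rightarrow> data" where
  "val (Var x) s = s x"
| "val Const_Atom s = Atom"
| "val (Mk_Pair e f) s = Pair (val e s) (val f s)"
| "val (Left e) s = left (val e s)"
| "val (Right e) s = right (val e s)"

text \<open>\<open>exec c s t s'\<close>: started in store \<open>s\<close>, \<open>c\<close> halts after \<open>t\<close> steps in store \<open>s'\<close>.\<close>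

inductive exec :: "com \<Rightarrow> store \<Rightarrow> nat \<Rightarrow> store \<Rightarrow> bool" where
  Assign: "exec (Assign x e) s 1 (s(x := val e s))"
| Seq: "exec c1 s t1 s' \<Longrightarrow> exec c2 s' t2 s'' \<Longrightarrow> exec (Seq c1 c2) s (t1 + t2) s''"
| Cond_True: "val e s \<noteq> Atom \<Longrightarrow> exec c1 s t s' \<Longrightarrow> exec (Cond e c1 c2) s (1 + t) s'"
| Cond_False: "val e s = Atom \<Longrightarrow> exec c2 s t s' \<Longrightarrow> exec (Cond e c1 c2) s (1 + t) s'"
| While_False: "val e s = Atom \<Longrightarrow> exec (While e c) s 1 s"
| While_True: "val e s \<noteq> Atom \<Longrightarrow> exec c s t1 s' \<Longrightarrow> exec (While e c) s' t2 s'' \<Longrightarrow>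
    exec (While e c) s (1 + t1 + t2) s''"

text \<open>Variable 0 holds the input and, at the end, the answer.\<close>

definition answers :: "com \<Rightarrow> data \<Rightarrow> nat \<Rightarrow> bool \<Rightarrow> bool" where
  "answers P d t b \<longleftrightarrow> (\<exists>s. exec P ((\<lambda>_. Atom)(0 := d)) t s \<and> (b \<longleftrightarrow> s 0 \<noteq> Atom))"


section \<open>Descriptions of LCL problems\<close>

primrec list_data :: "data list \<Rightarrow> data" where
  "list_data [] = Atom"
| "list_data (x # xs) = Pair x (list_data xs)"

text \<open>Numbers are written in binary, least significant bit first.\<close>

fun nat_data :: "nat \<Rightarrow> data" where
  "nat_data n =
     (if n = 0 then Atom
      else Pair (if odd n then Pair Atom Atom else Atom) (nat_data (n div 2)))"

declare nat_data.simps [simp del]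

definition config_data :: "nat \<times> nat list \<Rightarrow> data" where
  "config_data = (\<lambda>(a, bs). list_data (map nat_data (a # bs)))"

text \<open>
  The elements of the label set and of the configuration set may be listed in any order. The size
  of a description is the number of \<open>Pair\<close> cells in it, that is, \<open>size d\<close>.
\<close>

definition describes :: "data \<Rightarrow> lcl \<Rightarrow> bool" where
  "describes d \<P> \<longleftrightarrow>
     (\<exists>ls cs. distinct ls \<and> set ls = labels \<P> \<and> distinct cs \<and> set cs = configs \<P> \<and>
        d = Pair (nat_data (arity \<P>))
              (Pair (list_data (map nat_data ls)) (list_data (map config_data cs))))"

end

theory Submission
  imports
    Defs
    "HOL-Library.Countable"
    "HOL-Library.Log_Nat"
    "HOL-Library.Sublist"
    "HOL-Real_Asymp.Real_Asymp"
begin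

text \<open>
  In the graph with an edge from \<open>a\<close> to every \<open>b\<^sub>i\<close> for each configuration
  \<open>(a : b\<^sub>1, \<dots>, b\<^sub>\<delta>)\<close>, a label is flexible if it lies on closed walks of two consecutive
  lengths, hence of all large lengths. A set of configurations all of whose labels are flexible
  within the set is robust; repeated pruning of the configurations with an inflexible label finds
  the largest robust set in polynomial time. The complexity is \<open>O(log n)\<close> if this set is nonempty
  and \<open>n\<close> to a positive power otherwise.

  If a robust set exists, then in a sink component of its graph every label reaches a fixed label
  \<open>a0\<close> by a walk of one and the same length \<open>K\<close>. Rake and compress together with a ruling set on long
  chains yields splitter vertices such that every vertical path of logarithmic length contains one,
  and no two of them interfere within distance \<open>K\<close>. Splitters are labelled \<open>a0\<close>, and the labels are
  propagated downwards, aiming at the unique close splitter below, if any.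

  Conversely, let an algorithm run for \<open>t\<close> rounds, where \<open>n\<close> exceeds a certain polynomial in \<open>t\<close>.
  Consider nested caterpillars whose spines are longer than \<open>2 * t\<close>. By the pigeonhole principle
  some label \<open>x\<close> is produced in the middle of two windows with disjoint sets of identifiers. A window
  with the label \<open>a\<close> in the middle can be put between these two, at a distance from the upper one that
  may be changed by one. So \<open>a\<close> lies on closed walks of two consecutive lengths through \<open>x\<close>, and all
  labels on these walks belong to the spines of one level less. Hence pruning never removes the labels
  in the middle of spines of high level.
\<close>

section \<open>WHILE programs with time bounds\<close>

text \<open>A vertex knows the exact number of vertices and the maximum degree, so runs can be
  compared only on trees that agree in both. Hence every tree of the lower bound is filled up to
  exactly \<open>n\<close> vertices by a comb at its far end, and the identifiers outside the copied
  windows are whatever remains of \<open>{1..n}\<close>. A window from an arbitrary instance may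
  carry huge subtrees; they are cut at a depth that its middle cannot see, which keeps all sizes
  polynomial in \<open>t\<close>. An edge counts on a level only if the whole configuration uses
  labels of that level. The children off the path therefore need such labels too, and this is what
  forces the nesting of trees. Identifiers up to \<open>n\<close> are legal for every exponent
  \<open>c\<close>, so one lower bound serves all \<open>c\<close>; in the upper bound
  \<open>c\<close> enters only through the number of identifier bits. As logarithmic time is
  affordable there, the ruling set can spend a constant number of rounds on every single
  bit.\<close>

definition run :: "com \<Rightarrow> store \<Rightarrow> nat \<Rightarrow> (store \<Rightarrow> bool) \<Rightarrow> bool" where
  "run c s t R \<longleftrightarrow> (\<exists>s' t'. exec c s t' s' \<and> t' \<le> t \<and> R s')"

inductive_cases exec_AssignE: "exec (Assign x e) s t s'"
inductive_cases exec_SeqE: "exec (Seq c1 c2) s t s'"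

lemmas exec_intros = exec.intros[simplified]

lemma run_mono: "run c s t R \<Longrightarrow> t \<le> t' \<Longrightarrow> (\<And>s'. R s' \<Longrightarrow> R' s') \<Longrightarrow> run c s t' R'"
  unfolding run_def by (meson le_trans)

lemma run_Assign [simp]: "run (Assign x e) s t R \<longleftrightarrow> 1 \<le> t \<and> R (s(x := val e s))"
  unfolding run_def by (auto elim!: exec_AssignE intro: exec_intros)

lemma run_Seq: "run (Seq c1 c2) s t R \<longleftrightarrow> (\<exists>t1\<le>t. run c1 s t1 (\<lambda>s'. run c2 s' (t - t1) R))"
proof
  assume "run (Seq c1 c2) s t R"
  then obtain s1 s2 t1 t2 where "exec c1 s t1 s1" "exec c2 s1 t2 s2" "t1 + t2 \<le> t" "R s2"
    unfolding run_def by (auto elim!: exec_SeqE)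
  then show "\<exists>t1\<le>t. run c1 s t1 (\<lambda>s'. run c2 s' (t - t1) R)"
    unfolding run_def by (intro exI[of _ t1] conjI exI[of _ s1] exI[of _ t2] exI[of _ s2]) auto
next
  assume "\<exists>t1\<le>t. run c1 s t1 (\<lambda>s'. run c2 s' (t - t1) R)"
  then obtain t1 t1' s1 t2 s2 where *: "t1 \<le> t" "exec c1 s t1' s1" "t1' \<le> t1" "exec c2 s1 t2 s2"
    "t2 \<le> t - t1" "R s2" unfolding run_def by auto
  then have "exec (Seq c1 c2) s (t1' + t2) s2" by (auto intro: exec.Seq)
  then show "run (Seq c1 c2) s t R"
    unfolding run_def using * by (intro exI[of _ s2] exI[of _ "t1' + t2"]) auto
qed

text \<open>The rule for loops and subprograms: a proved bound is paid from the budget, and the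
  postcondition is all that is known afterwards. Assignments and tests at the head of a sequence are
  executed symbolically by the simp rules instead.\<close>

lemma run_Seq_call:
  "run c1 s t1 Q \<Longrightarrow> t1 \<le> t \<Longrightarrow> (\<And>s'. Q s' \<Longrightarrow> run c2 s' (t - t1) R) \<Longrightarrow> run (Seq c1 c2) s t R"
  unfolding run_Seq by (intro exI[of _ t1] conjI) (auto elim!: run_mono)

lemma run_Seq_Assign [simp]:
  "run (Seq (Assign x e) c) s t R \<longleftrightarrow> 1 \<le> t \<and> run c (s(x := val e s)) (t - 1) R"
proof -
  have "run c s' (t - t1) R \<Longrightarrow> 1 \<le> t1 \<Longrightarrow> run c s' (t - 1) R" for t1 s'
    by (erule run_mono) auto
  then show ?thesis unfolding run_Seq by auto
qed

lemma run_Cond [simp]: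
  "run (Cond e c1 c2) s t R \<longleftrightarrow> 1 \<le> t \<and> run (if val e s \<noteq> Atom then c1 else c2) s (t - 1) R"
proof
  assume "run (Cond e c1 c2) s t R"
  then obtain s' t' where "exec (Cond e c1 c2) s t' s'" "t' \<le> t" "R s'" unfolding run_def by auto
  then show "1 \<le> t \<and> run (if val e s \<noteq> Atom then c1 else c2) s (t - 1) R"
    unfolding run_def by (cases rule: exec.cases) force+
next
  assume "1 \<le> t \<and> run (if val e s \<noteq> Atom then c1 else c2) s (t - 1) R"
  then obtain s' t' where *: "1 \<le> t" "exec (if val e s \<noteq> Atom then c1 else c2) s t' s'"
    "t' \<le> t - 1" "R s'" unfolding run_def by auto
  then have "exec (Cond e c1 c2) s (1 + t') s'"
    by (auto intro: exec_intros split: if_splits)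
  then show "run (Cond e c1 c2) s t R" unfolding run_def using * by (intro exI[of _ s'] exI[of _ "Suc t'"]) auto
qed

lemma run_Seq_Seq [simp]: "run (Seq (Seq a b) c) s t R \<longleftrightarrow> run (Seq a (Seq b c)) s t R"
proof
  assume "run (Seq (Seq a b) c) s t R"
  then obtain s1 s2 s3 t1 t2 t3 where *: "exec a s t1 s1" "exec b s1 t2 s2" "exec c s2 t3 s3"
    "t1 + t2 + t3 \<le> t" "R s3"
    unfolding run_def by (auto elim!: exec_SeqE)
  then have "exec (Seq a (Seq b c)) s (t1 + (t2 + t3)) s3" by (auto intro!: exec.Seq)
  then show "run (Seq a (Seq b c)) s t R"
    unfolding run_def using * by (intro exI[of _ s3] exI[of _ "t1 + (t2 + t3)"]) auto
next
  assume "run (Seq a (Seq b c)) s t R"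
  then obtain s1 s2 s3 t1 t2 t3 where *: "exec a s t1 s1" "exec b s1 t2 s2" "exec c s2 t3 s3"
    "t1 + (t2 + t3) \<le> t" "R s3"
    unfolding run_def by (auto elim!: exec_SeqE)
  then have "exec (Seq (Seq a b) c) s (t1 + t2 + t3) s3" by (auto intro!: exec.Seq)
  then show "run (Seq (Seq a b) c) s t R"
    unfolding run_def using * by (intro exI[of _ s3] exI[of _ "t1 + t2 + t3"]) auto
qed

lemma run_Seq_Cond [simp]:
  "run (Seq (Cond e c1 c2) c) s t R \<longleftrightarrow>
     1 \<le> t \<and> run (Seq (if val e s \<noteq> Atom then c1 else c2) c) s (t - 1) R"
proof
  assume "run (Seq (Cond e c1 c2) c) s t R"
  then obtain t1 where t1: "t1 \<le> t" "1 \<le> t1"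
    "run (if val e s \<noteq> Atom then c1 else c2) s (t1 - 1) (\<lambda>s'. run c s' (t - t1) R)"
    unfolding run_Seq by auto
  then show "1 \<le> t \<and> run (Seq (if val e s \<noteq> Atom then c1 else c2) c) s (t - 1) R"
    unfolding run_Seq[of "if _ then _ else _"]
    by (intro conjI exI[of _ "t1 - 1"]) auto
next
  assume "1 \<le> t \<and> run (Seq (if val e s \<noteq> Atom then c1 else c2) c) s (t - 1) R"
  then obtain t1 where "t1 \<le> t - 1" "1 \<le> t"
    "run (if val e s \<noteq> Atom then c1 else c2) s t1 (\<lambda>s'. run c s' (t - 1 - t1) R)"
    unfolding run_Seq[of "if _ then _ else _"] by auto
  then show "run (Seq (Cond e c1 c2) c) s t R"
    unfolding run_Seq[of "Cond _ _ _"] by (intro exI[of _ "Suc t1"]) auto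
qed

lemma run_While_False: "val e s = Atom \<Longrightarrow> 1 \<le> t \<Longrightarrow> R s \<Longrightarrow> run (While e c) s t R"
  unfolding run_def by (intro exI[of _ s] exI[of _ 1]) (auto intro: exec_intros)

lemma run_While_True:
  assumes "val e s \<noteq> Atom" "1 \<le> t" "run (Seq c (While e c)) s (t - 1) R"
  shows "run (While e c) s t R"
proof -
  obtain s1 t1 s2 t2 where *: "exec c s t1 s1" "exec (While e c) s1 t2 s2" "t1 + t2 \<le> t - 1" "R s2"
    using assms(3) unfolding run_def by (auto elim!: exec_SeqE)
  then have "exec (While e c) s (1 + t1 + t2) s2" using assms(1) by (auto intro: exec_intros)
  then show ?thesis
    unfolding run_def using * assms(2) by (intro exI[of _ s2] exI[of _ "1 + t1 + t2"]) auto
qed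

definition foreach :: "nat \<Rightarrow> nat \<Rightarrow> com \<Rightarrow> com" where
  "foreach x l c = While (Var l) (Seq (Assign x (Left (Var l))) (Seq (Assign l (Right (Var l))) c))"

text \<open>Each element costs one test and the two assignments of the loop header besides the body;
  the last \<open>1\<close> is the failing test. The invariant speaks of the prefix already consumed
  and of the store before the header overwrites \<open>x\<close> and \<open>l\<close>.\<close>

lemma run_foreach:
  assumes "s l = list_data xs" "I [] s" "x \<noteq> l"
    and step: "\<And>zs y ys s. xs = zs @ y # ys \<Longrightarrow> I zs s \<Longrightarrow>
      run c (s(x := y, l := list_data ys)) t (\<lambda>s'. s' l = list_data ys \<and> I (zs @ [y]) s')"
  shows "run (foreach x l c) s (length xs * (t + 3) + 1) (I xs)"
proof -
  have "run (foreach x l c) s (length ys * (t + 3) + 1) (I xs)"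
    if "xs = zs @ ys" "s l = list_data ys" "I zs s" for zs ys s
    using that
  proof (induction ys arbitrary: zs s)
    case Nil
    then show ?case unfolding foreach_def by (intro run_While_False) auto
  next
    case (Cons y ys)
    have "run c (s(x := y, l := list_data ys)) t (\<lambda>s'. s' l = list_data ys \<and> I (zs @ [y]) s')"
      using Cons.prems by (intro step) auto
    then have "run (Seq c (foreach x l c)) (s(x := y, l := list_data ys))
       (length ys * (t + 3) + 1 + t) (I xs)"
      by (rule run_Seq_call) (use Cons.IH[of "zs @ [y]"] Cons.prems in auto)
    then show ?case unfolding foreach_def
      by (intro run_While_True) (use Cons.prems assms(3) in \<open>auto elim: run_mono\<close>)
  qed
  from this[of "[]" xs s] show ?thesis using assms by simp
qed

section \<open>The decision procedure\<close>

text \<open>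
  The programs form a hierarchy \<open>eq_prog\<close>, \<open>mem_prog\<close>, \<open>succ_prog\<close>, and so on. The one on
  level \<open>j\<close>, counted from \<open>0\<close>, reads its arguments from variables at or above \<open>10 * (j + 1)\<close> and does
  not change those, except that \<open>flex_body\<close> and \<open>check_prog\<close> are parts of the programs that follow them.
\<close>

abbreviation "skip \<equiv> Assign 3 Const_Atom"
abbreviation "true_expr \<equiv> Mk_Pair Const_Atom Const_Atom"

text \<open>Comparison bit by bit. If the second number runs out first, \<open>Left\<close> and
  \<open>Right\<close> of \<open>Atom\<close> go on yielding zero bits, so only a longer second
  number needs the extra test after the loop.\<close>

definition eq_prog :: com where
  "eq_prog = Seq (Assign 0 true_expr) (Seq (Assign 4 (Var 10)) (Seq (Assign 2 (Var 11))
    (Seq (While (Var 4)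
       (Seq (Cond (Left (Var 4)) (Cond (Left (Var 2)) skip (Assign 0 Const_Atom))
              (Cond (Left (Var 2)) (Assign 0 Const_Atom) skip))
         (Seq (Assign 4 (Right (Var 4))) (Assign 2 (Right (Var 2))))))
     (Cond (Var 2) (Assign 0 Const_Atom) skip))))"

lemma nat_data_0 [simp]: "nat_data 0 = Atom"
  by (simp add: nat_data.simps)

lemma nat_data_eq_Atom_iff [simp]: "nat_data n = Atom \<longleftrightarrow> n = 0"
  by (subst nat_data.simps) simp

lemma left_nat_data [simp]: "left (nat_data n) = Atom \<longleftrightarrow> even n"
  by (subst nat_data.simps) simp

lemma right_nat_data [simp]: "right (nat_data n) = nat_data (n div 2)"
  by (subst nat_data.simps) simp

text \<open>The flag in variable 0 and the rest in variable 2 are meaningful only together, so the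
  induction carries their conjunction. One round takes at most 8 steps and shortens variable 4 by at
  least one cell.\<close>

lemma run_eq_loop:
  assumes "s 4 = nat_data a" "s 2 = nat_data b"
  shows "run (While (Var 4)
       (Seq (Cond (Left (Var 4)) (Cond (Left (Var 2)) skip (Assign 0 Const_Atom))
              (Cond (Left (Var 2)) (Assign 0 Const_Atom) skip))
         (Seq (Assign 4 (Right (Var 4))) (Assign 2 (Right (Var 2)))))) s (8 * size (nat_data a) + 1)
     (\<lambda>s'. (s' 0 \<noteq> Atom \<and> s' 2 = Atom \<longleftrightarrow> s 0 \<noteq> Atom \<and> a = b) \<and> (\<forall>v\<ge>10. s' v = s v))"
    (is "run (While _ ?c) s _ _")
  using assms
proof (induction a arbitrary: b s rule: less_induct)
  case (less a)
  show ?case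
  proof (cases "a = 0")
    case True
    then show ?thesis using less.prems by (intro run_While_False) auto
  next
    case False
    have sz: "size (nat_data a) \<ge> Suc (size (nat_data (a div 2)))"
      using False by (subst nat_data.simps) simp
    have eq: "a = b \<longleftrightarrow> (even a \<longleftrightarrow> even b) \<and> a div 2 = b div 2"
      by (metis even_iff_mod_2_eq_zero not_mod_2_eq_1_eq_0 div_mult_mod_eq)
    define s0 where "s0 = s(3 := if even a = even b then Atom else s 3,
       0 := if even a = even b then s 0 else Atom)"
    define s1 where "s1 = s0(4 := nat_data (a div 2), 2 := nat_data (b div 2))"
    have "run (While (Var 4) ?c) s1 (8 * size (nat_data (a div 2)) + 1)
     (\<lambda>s'. (s' 0 \<noteq> Atom \<and> s' 2 = Atom \<longleftrightarrow> s1 0 \<noteq> Atom \<and> a div 2 = b div 2) \<and> (\<forall>v\<ge>10. s' v = s1 v))"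
      by (intro less.IH) (use False in \<open>auto simp: s1_def\<close>)
    then have *: "run (While (Var 4) ?c) s1 (8 * size (nat_data a) - 7)
     (\<lambda>s'. (s' 0 \<noteq> Atom \<and> s' 2 = Atom \<longleftrightarrow> s 0 \<noteq> Atom \<and> a = b) \<and> (\<forall>v\<ge>10. s' v = s v))"
      by (rule run_mono) (use sz eq in \<open>auto simp: s1_def s0_def split: if_splits\<close>)
    have s1: "even a = even b \<Longrightarrow> s(3 := Atom, 4 := nat_data (a div 2), 2 := nat_data (b div 2)) = s1"
      "even a \<noteq> even b \<Longrightarrow> s(0 := Atom, 4 := nat_data (a div 2), 2 := nat_data (b div 2)) = s1"
      by (auto simp: s1_def s0_def fun_eq_iff)
    have "run (Seq ?c (While (Var 4) ?c)) s (8 * size (nat_data a))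
     (\<lambda>s'. (s' 0 \<noteq> Atom \<and> s' 2 = Atom \<longleftrightarrow> s 0 \<noteq> Atom \<and> a = b) \<and> (\<forall>v\<ge>10. s' v = s v))"
      using less.prems sz s1 by (auto intro!: run_mono[OF *])
    then show ?thesis by (intro run_While_True) (use less.prems False in auto)
  qed
qed

lemma run_eq_prog:
  assumes "s 10 = nat_data a" "s 11 = nat_data b" "size (nat_data a) \<le> m"
  shows "run eq_prog s (8 * m + 8) (\<lambda>s'. (s' 0 \<noteq> Atom \<longleftrightarrow> a = b) \<and> (\<forall>v\<ge>10. s' v = s v))"
proof -
  show ?thesis unfolding eq_prog_def using assms
    apply (simp del: run_Seq_Seq)
    apply (rule run_Seq_call[OF run_eq_loop[where a = a and b = b]])
    by auto
qed

definition mem_prog :: com where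
  "mem_prog = Seq (Assign 10 (Var 20)) (Seq (Assign 12 (Var 21)) (Seq (Assign 15 Const_Atom)
     (foreach 11 12 (Seq eq_prog (Cond (Var 0) (Assign 15 true_expr) skip)))))"

definition "mem_time m = m * (8 * m + 14) + 5" for m :: nat

abbreviation "nats_data ns \<equiv> list_data (map nat_data ns)"

lemma map_eq_appendE:
  assumes "map f xs = zs @ y # ys"
  obtains us v vs where "xs = us @ v # vs" "zs = map f us" "y = f v" "ys = map f vs"
  using assms by (auto simp: map_eq_append_conv map_eq_Cons_conv)

lemma nat_data_inject [simp]: "nat_data a = nat_data b \<longleftrightarrow> a = b"
proof (induction a arbitrary: b rule: less_induct)
  case (less a)
  show ?case
  proof (cases "a = 0")
    case True
    then show ?thesis by (metis nat_data_0 nat_data_eq_Atom_iff)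
  next
    case False
    then have "a div 2 < a" by simp
    then show ?thesis
      by (metis less.IH left_nat_data right_nat_data even_iff_mod_2_eq_zero not_mod_2_eq_1_eq_0 div_mult_mod_eq)
  qed
qed

lemma run_mem_prog:
  assumes "s 20 = nat_data a" "s 21 = nats_data W" "length W \<le> m" "size (nat_data a) \<le> m"
  shows "run mem_prog s (mem_time m) (\<lambda>s'. (s' 15 \<noteq> Atom \<longleftrightarrow> a \<in> set W) \<and> (\<forall>v\<ge>20. s' v = s v))"
proof -
  define I where "I = (\<lambda>zs (s'::store). s' 10 = nat_data a \<and>
     (s' 15 \<noteq> Atom \<longleftrightarrow> nat_data a \<in> set zs) \<and> (\<forall>v\<ge>20. s' v = s v))"
  define s0 where "s0 = s(10 := nat_data a, 12 := nats_data W, 15 := Atom)"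
  have "run (foreach 11 12 (Seq eq_prog (Cond (Var 0) (Assign 15 true_expr) skip))) s0
     (length (map nat_data W) * ((8 * m + 10) + 3) + 1) (I (map nat_data W))"
  proof (rule run_foreach)
    fix zs y ys and s1 :: store
    assume *: "map nat_data W = zs @ y # ys" "I zs s1"
    then obtain b where b: "y = nat_data b" by (elim map_eq_appendE)
    let ?s = "s1(11 := y, 12 := list_data ys)"
    have "run eq_prog ?s (8 * m + 8) (\<lambda>s'. (s' 0 \<noteq> Atom \<longleftrightarrow> a = b) \<and> (\<forall>v\<ge>10. s' v = ?s v))"
      using * b assms by (intro run_eq_prog) (auto simp: I_def)
    then show "run (Seq eq_prog (Cond (Var 0) (Assign 15 true_expr) skip)) ?s (8 * m + 10)
       (\<lambda>s'. s' 12 = list_data ys \<and> I (zs @ [y]) s')"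
      by (rule run_Seq_call) (use * b in \<open>auto simp: I_def\<close>)
  qed (auto simp: s0_def I_def)
  then have "run (foreach 11 12 (Seq eq_prog (Cond (Var 0) (Assign 15 true_expr) skip))) s0
     (mem_time m - 3) (\<lambda>s'. (s' 15 \<noteq> Atom \<longleftrightarrow> a \<in> set W) \<and> (\<forall>v\<ge>20. s' v = s v))"
  proof (rule run_mono)
    have "length W * (8 * m + 13) \<le> m * (8 * m + 13)" using assms by simp
    then show "length (map nat_data W) * (8 * m + 10 + 3) + 1 \<le> mem_time m - 3"
      by (simp add: mem_time_def algebra_simps)
  qed (auto simp: I_def)
  then show ?thesis unfolding mem_prog_def using assms
    by (simp add: s0_def mem_time_def)
qed


definition succ_prog :: com where
  "succ_prog = Seq (Assign 26 (Var 31)) (Seq (Assign 25 Const_Atom)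
     (foreach 24 26 (Seq (Assign 20 (Left (Var 24))) (Seq (Assign 21 (Var 30)) (Seq mem_prog
       (Cond (Var 15)
         (Seq (Assign 27 (Right (Var 24))) (foreach 23 27 (Assign 25 (Mk_Pair (Var 23) (Var 25)))))
         skip))))))"

definition "succ_time m = m * (mem_time m + 4 * m + 10) + 5" for m :: nat

definition config_edges :: "('a \<times> 'a list) set \<Rightarrow> ('a \<times> 'a) set" where
  "config_edges C = {(a, b). \<exists>bs. (a, bs) \<in> C \<and> b \<in> set bs}"

text \<open>All loops are bounded by one number \<open>m\<close>, later the size of the description.
  The strict bound on \<open>length bs\<close> leaves room for the list
  \<open>a # bs\<close>.\<close>

definition bounded_configs :: "nat \<Rightarrow> (nat \<times> nat list) list \<Rightarrow> bool" where
  "bounded_configs m cs \<longleftrightarrow> length cs \<le> m \<and> sum_list (map (length \<circ> snd) cs) \<le> m \<and>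
     (\<forall>(a, bs)\<in>set cs. length bs < m \<and> (\<forall>x\<in>insert a (set bs). size (nat_data x) \<le> m))"

abbreviation "configs_data cs \<equiv> list_data (map config_data cs)"

lemma config_data_Pair: "config_data (a, bs) = Pair (nat_data a) (nats_data bs)"
  by (simp add: config_data_def)

text \<open>Duplicates may accumulate in the new list, but harmlessly: each configuration
  contributes its children at most once, so the length is bounded by the total length of all
  configurations, however often a label occurs in \<open>W\<close>.\<close>

lemma run_succ_prog:
  assumes "s 30 = nats_data W" "s 31 = configs_data cs" "length W \<le> m" "bounded_configs m cs"
  shows "run succ_prog s (succ_time m) (\<lambda>s'. (\<exists>W'. s' 25 = nats_data W' \<and>
     set W' = config_edges (set cs) `` set W \<and> length W' \<le> m) \<and> (\<forall>v\<ge>30. s' v = s v))"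
proof -
  define I where "I = (\<lambda>ds (s'::store). \<exists>cs1. ds = map config_data cs1 \<and>
     (\<exists>W'. s' 25 = nats_data W' \<and> set W' = config_edges (set cs1) `` set W \<and>
       length W' \<le> sum_list (map (length \<circ> snd) cs1)) \<and> (\<forall>v\<ge>30. s' v = s v))"
  have inj: "inj config_data"
  proof (rule injI)
    fix c d assume "config_data c = config_data d"
    moreover have "inj nat_data"
    proof (rule injI)
      show "a = b" if "nat_data a = nat_data b" for a b using that nat_data_inject by blast
    qed
    moreover have "list_data xs = list_data ys \<Longrightarrow> xs = ys" for xs ys
    proof (induction xs arbitrary: ys)
      case Nil then show ?case by (cases ys) auto
    next
      case (Cons x xs) then show ?case by (cases ys) auto
    qed
    ultimately show "c = d"
      by (cases c; cases d) (auto simp: config_data_Pair dest: injD dest!: map_injective)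
  qed
  let ?c = "Seq (Assign 20 (Left (Var 24))) (Seq (Assign 21 (Var 30)) (Seq mem_prog
       (Cond (Var 15)
         (Seq (Assign 27 (Right (Var 24))) (foreach 23 27 (Assign 25 (Mk_Pair (Var 23) (Var 25)))))
         skip)))"
  define s0 where "s0 = s(26 := configs_data cs, 25 := Atom)"
  have "run (foreach 24 26 ?c) s0
     (length (map config_data cs) * ((mem_time m + 4 * m + 6) + 3) + 1) (I (map config_data cs))"
  proof (rule run_foreach)
    fix zs y ys and s1 :: store
    assume *: "map config_data cs = zs @ y # ys" "I zs s1"
    then obtain cs1 c cs2 where c: "cs = cs1 @ c # cs2" "zs = map config_data cs1" "y = config_data c"
      by (elim map_eq_appendE)
    obtain a bs where abs: "c = (a, bs)" by fastforce
    have bd: "size (nat_data a) \<le> m" "length bs < m"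
      using assms(4) c abs by (auto simp: bounded_configs_def)
    obtain W' where W': "s1 25 = nats_data W'" "set W' = config_edges (set cs1) `` set W"
      "length W' \<le> sum_list (map (length \<circ> snd) cs1)" "\<forall>v\<ge>30. s1 v = s v"
      using * c inj by (auto simp: I_def inj_map_eq_map)
    let ?s = "s1(24 := y, 26 := list_data ys)"
    let ?s' = "?s(20 := nat_data a, 21 := nats_data W)"
    have mem: "run mem_prog ?s' (mem_time m) (\<lambda>s'. (s' 15 \<noteq> Atom \<longleftrightarrow> a \<in> set W) \<and> (\<forall>v\<ge>20. s' v = ?s' v))"
      using assms bd by (intro run_mem_prog) auto
    have inner: "run (foreach 23 27 (Assign 25 (Mk_Pair (Var 23) (Var 25)))) s2
        (length (map nat_data bs) * (1 + 3) + 1)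
        (\<lambda>s'. s' 25 = nats_data (rev bs @ W') \<and> (\<forall>v\<ge>24. v \<noteq> 25 \<and> v \<noteq> 27 \<longrightarrow> s' v = s2 v))"
      if "s2 27 = nats_data bs" "s2 25 = nats_data W'" for s2
    proof -
      have "run (foreach 23 27 (Assign 25 (Mk_Pair (Var 23) (Var 25)))) s2
        (length (map nat_data bs) * (1 + 3) + 1)
        ((\<lambda>ns s'. s' 25 = list_data (rev ns @ map nat_data W') \<and> (\<forall>v\<ge>24. v \<noteq> 25 \<and> v \<noteq> 27 \<longrightarrow> s' v = s2 v))
          (map nat_data bs))"
        by (rule run_foreach) (use that in auto)
      then show ?thesis by (simp add: rev_map)
    qed
    have end1: "I (zs @ [y]) s'" if "a \<in> set W" "s' 25 = nats_data (rev bs @ W')" "\<forall>v\<ge>30. s' v = s v" for s'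
      unfolding I_def using that c abs W'
      by (intro exI[of _ "cs1 @ [c]"] conjI exI[of _ "rev bs @ W'"])
        (auto simp: config_edges_def)
    have end2: "I (zs @ [y]) s'" if "a \<notin> set W" "s' 25 = nats_data W'" "\<forall>v\<ge>30. s' v = s v" for s'
      unfolding I_def using that c abs W'
      by (intro exI[of _ "cs1 @ [c]"] conjI exI[of _ "W'"])
        (auto simp: config_edges_def)
    have "run (Seq mem_prog
       (Cond (Var 15)
         (Seq (Assign 27 (Right (Var 24))) (foreach 23 27 (Assign 25 (Mk_Pair (Var 23) (Var 25)))))
         skip)) ?s' (4 + (mem_time m + 4 * m)) (\<lambda>s'. s' 26 = list_data ys \<and> I (zs @ [y]) s')"
    proof (rule run_Seq_call[OF mem])
      fix s2 assume s2: "(s2 15 \<noteq> Atom \<longleftrightarrow> a \<in> set W) \<and> (\<forall>v\<ge>20. s2 v = ?s' v)"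
      let ?s2 = "s2(27 := nats_data bs)"
      have "run (foreach 23 27 (Assign 25 (Mk_Pair (Var 23) (Var 25)))) ?s2 (4 * m + 2)
         (\<lambda>s'. s' 26 = list_data ys \<and> I (zs @ [y]) s')" if "a \<in> set W"
        by (rule run_mono[OF inner]) (use s2 W' bd that end1 in auto)
      then show "run (Cond (Var 15)
         (Seq (Assign 27 (Right (Var 24))) (foreach 23 27 (Assign 25 (Mk_Pair (Var 23) (Var 25)))))
         skip) s2 (4 + (mem_time m + 4 * m) - mem_time m) (\<lambda>s'. s' 26 = list_data ys \<and> I (zs @ [y]) s')"
        using s2 W' end2 c abs by (auto simp: config_data_Pair)
    qed auto
    then show "run ?c ?s (mem_time m + 4 * m + 6) (\<lambda>s'. s' 26 = list_data ys \<and> I (zs @ [y]) s')"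
      using c abs W' assms by (auto simp: config_data_Pair)
  next
    show "I [] s0" unfolding I_def
      by (intro exI[of _ "[]"]) (auto simp: s0_def config_edges_def)
  qed (auto simp: s0_def)
  then have "run (foreach 24 26 ?c) s0 (succ_time m - 2) (\<lambda>s'. (\<exists>W'. s' 25 = nats_data W' \<and>
     set W' = config_edges (set cs) `` set W \<and> length W' \<le> m) \<and> (\<forall>v\<ge>30. s' v = s v))"
  proof (rule run_mono)
    have "length cs * (mem_time m + 4 * m + 9) \<le> m * (mem_time m + 4 * m + 9)"
      using assms by (intro mult_right_mono) (auto simp: bounded_configs_def)
    then show "length (map config_data cs) * (mem_time m + 4 * m + 6 + 3) + 1 \<le> succ_time m - 2"
      by (simp add: succ_time_def algebra_simps)
    show "(\<exists>W'. s' 25 = nats_data W' \<and> set W' = config_edges (set cs) `` set W \<and> length W' \<le> m) \<and>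
      (\<forall>v\<ge>30. s' v = s v)" if "I (map config_data cs) s'" for s'
      using that assms(4) inj by (fastforce simp: I_def inj_map_eq_map bounded_configs_def)
  qed
  then show ?thesis unfolding succ_prog_def using assms
    by (simp add: s0_def succ_time_def)
qed


definition flexible :: "('a \<times> 'a) set \<Rightarrow> 'a \<Rightarrow> bool" where
  "flexible E a \<longleftrightarrow> (\<exists>k. (a, a) \<in> E ^^ k \<and> (a, a) \<in> E ^^ Suc k)"

definition flexible_below :: "nat \<Rightarrow> ('a \<times> 'a) set \<Rightarrow> 'a \<Rightarrow> bool" where
  "flexible_below N E a \<longleftrightarrow> (\<exists>k<N. (a, a) \<in> E ^^ k \<and> (a, a) \<in> E ^^ Suc k)"

text \<open>One step of the walk. Variable 34 keeps the membership of the label before the step,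
  because the second call of \<open>mem_prog\<close> overwrites variable 15; variable 35 stays set
  once two consecutive layers contain the label.\<close>

definition flex_body :: com where
  "flex_body = Seq (Assign 20 (Var 40)) (Seq (Assign 21 (Var 30)) (Seq mem_prog
     (Seq (Assign 34 (Var 15)) (Seq succ_prog (Seq (Assign 20 (Var 40)) (Seq (Assign 21 (Var 25))
     (Seq mem_prog (Seq (Assign 30 (Var 25)) (Cond (Var 34) (Cond (Var 15) (Assign 35 true_expr) skip) skip)))))))))"

text \<open>Both loops over the label list serve as counters only: the body is repeated as often as
  there are pairs of labels, which is the range of walk lengths that has to be searched.\<close>

definition flex_prog :: com where
  "flex_prog = Seq (Assign 30 (Mk_Pair (Var 40) Const_Atom)) (Seq (Assign 31 (Var 41))
     (Seq (Assign 35 Const_Atom) (Seq (Assign 37 (Var 42))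
     (foreach 36 37 (Seq (Assign 39 (Var 42)) (foreach 38 39 flex_body))))))"

definition "body_time m = 2 * mem_time m + succ_time m + 10" for m :: nat
definition "flex_time m = m * (m * (body_time m + 3) + 6) + 10" for m :: nat

lemma run_flex_body:
  assumes "s 40 = nat_data a" "s 30 = nats_data W" "s 31 = configs_data cs" "bounded_configs m cs"
    "length W \<le> m" "size (nat_data a) \<le> m"
  shows "run flex_body s (body_time m) (\<lambda>s'. (\<exists>W'. s' 30 = nats_data W' \<and>
     set W' = config_edges (set cs) `` set W \<and> length W' \<le> m \<and>
     (s' 35 \<noteq> Atom \<longleftrightarrow> s 35 \<noteq> Atom \<or> a \<in> set W \<and> a \<in> set W')) \<and>
     (\<forall>v\<ge>31. v \<noteq> 34 \<and> v \<noteq> 35 \<longrightarrow> s' v = s v))"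
    (is "run _ _ _ ?R")
proof -
  let ?s1 = "s(20 := nat_data a, 21 := nats_data W)"
  have 1: "run mem_prog ?s1 (mem_time m) (\<lambda>s'. (s' 15 \<noteq> Atom \<longleftrightarrow> a \<in> set W) \<and> (\<forall>v\<ge>20. s' v = ?s1 v))"
    using assms by (intro run_mem_prog) auto
  have 2: "run succ_prog s2 (succ_time m) (\<lambda>s'. (\<exists>W'. s' 25 = nats_data W' \<and>
     set W' = config_edges (set cs) `` set W \<and> length W' \<le> m) \<and> (\<forall>v\<ge>30. s' v = s2 v))"
    if "\<forall>v\<ge>30. v \<noteq> 34 \<longrightarrow> s2 v = s v" for s2
    using assms that by (intro run_succ_prog) auto
  have 3: "run mem_prog s3 (mem_time m) (\<lambda>s'. (s' 15 \<noteq> Atom \<longleftrightarrow> a \<in> set W') \<and> (\<forall>v\<ge>20. s' v = s3 v))"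
    if "s3 20 = nat_data a" "s3 21 = nats_data W'" "length W' \<le> m" for s3 W'
    using assms that by (intro run_mem_prog) auto
  let ?c4 = "Seq (Assign 30 (Var 25)) (Cond (Var 34) (Cond (Var 15) (Assign 35 true_expr) skip) skip)"
  let ?c3 = "Seq (Assign 20 (Var 40)) (Seq (Assign 21 (Var 25)) (Seq mem_prog ?c4))"
  have c3: "run ?c3 s3 (mem_time m + 6) ?R"
    if s3: "(s3 34 \<noteq> Atom) = (a \<in> set W)" "s3 25 = nats_data W'" "set W' = config_edges (set cs) `` set W"
      "length W' \<le> m" "\<forall>v\<ge>30. v \<noteq> 34 \<longrightarrow> s3 v = s v" for s3 W'
  proof -
    let ?s3 = "s3(20 := nat_data a, 21 := nats_data W')"
    have "run (Seq mem_prog ?c4) ?s3 (4 + mem_time m) ?R"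
      by (rule run_Seq_call[OF 3]) (use that in auto)
    then show ?thesis using s3 assms by simp
  qed
  have c2: "run (Seq succ_prog ?c3) s2 (succ_time m + mem_time m + 6) ?R"
    if "(s2 34 \<noteq> Atom) = (a \<in> set W)" "\<forall>v\<ge>30. v \<noteq> 34 \<longrightarrow> s2 v = s v" for s2
  proof (rule run_Seq_call[OF 2])
    fix s3 assume "(\<exists>W'. s3 25 = nats_data W' \<and> set W' = config_edges (set cs) `` set W \<and> length W' \<le> m) \<and>
      (\<forall>v\<ge>30. s3 v = s2 v)"
    then obtain W' where "s3 25 = nats_data W'" "set W' = config_edges (set cs) `` set W" "length W' \<le> m"
      "\<forall>v\<ge>30. s3 v = s2 v" by blast
    then show "run ?c3 s3 (succ_time m + mem_time m + 6 - succ_time m) ?R"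
      using c3[of s3 W'] that by (simp add: add.commute)
  qed (use that in auto)
  have "run (Seq mem_prog (Seq (Assign 34 (Var 15)) (Seq succ_prog ?c3))) ?s1 (8 + (2 * mem_time m + succ_time m)) ?R"
  proof (rule run_Seq_call[OF 1])
    fix s2 assume s2: "(s2 15 \<noteq> Atom) = (a \<in> set W) \<and> (\<forall>v\<ge>20. s2 v = ?s1 v)"
    have "run (Seq succ_prog ?c3) (s2(34 := s2 15)) (succ_time m + mem_time m + 6) ?R"
      by (rule c2) (use s2 in auto)
    then show "run (Seq (Assign 34 (Var 15)) (Seq succ_prog ?c3)) s2
        (8 + (2 * mem_time m + succ_time m) - mem_time m) ?R"
      by (auto elim!: run_mono)
  qed auto
  then show ?thesis unfolding flex_body_def using assms by (simp add: body_time_def)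
qed

lemma run_flex_prog:
  assumes "s 40 = nat_data a" "s 41 = configs_data cs" "s 42 = list_data ls" "bounded_configs m cs"
    "length ls \<le> m" "size (nat_data a) \<le> m" "1 \<le> m"
  shows "run flex_prog s (flex_time m) (\<lambda>s'.
     (s' 35 \<noteq> Atom \<longleftrightarrow> flexible_below (length ls * length ls) (config_edges (set cs)) a) \<and>
     (\<forall>v\<ge>40. s' v = s v))"
proof -
  let ?E = "config_edges (set cs)" and ?n = "length ls"
  define J where "J = (\<lambda>k (s'::store). (\<exists>W. s' 30 = nats_data W \<and> set W = (?E ^^ k) `` {a} \<and> length W \<le> m) \<and>
     s' 31 = configs_data cs \<and> (s' 35 \<noteq> Atom \<longleftrightarrow> flexible_below k ?E a) \<and> (\<forall>v\<ge>40. s' v = s v))"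
  have body: "run flex_body s1 (body_time m) (\<lambda>s'. J (Suc k) s' \<and> (\<forall>v\<in>{36..39}. s' v = s1 v))"
    if J: "J k s1" for k s1
  proof -
    obtain W where W: "s1 30 = nats_data W" "set W = (?E ^^ k) `` {a}" "length W \<le> m"
      using J by (auto simp: J_def)
    have *: "flexible_below (Suc k) ?E a \<longleftrightarrow>
       flexible_below k ?E a \<or> a \<in> (?E ^^ k) `` {a} \<and> a \<in> (?E ^^ Suc k) `` {a}"
      unfolding flexible_below_def by (auto simp: less_Suc_eq)
    show ?thesis
    proof (rule run_mono[OF run_flex_body[where cs = cs and m = m]])
      fix s' assume s': "(\<exists>W'. s' 30 = nats_data W' \<and> set W' = ?E `` set W \<and> length W' \<le> m \<and>
         (s' 35 \<noteq> Atom \<longleftrightarrow> s1 35 \<noteq> Atom \<or> a \<in> set W \<and> a \<in> set W')) \<and>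
         (\<forall>v\<ge>31. v \<noteq> 34 \<and> v \<noteq> 35 \<longrightarrow> s' v = s1 v)"
      then obtain W' where "s' 30 = nats_data W'" "set W' = ?E `` set W" "length W' \<le> m"
         "s' 35 \<noteq> Atom \<longleftrightarrow> s1 35 \<noteq> Atom \<or> a \<in> set W \<and> a \<in> set W'" by blast
      moreover have "?E `` ((?E ^^ k) `` {a}) = (?E ^^ Suc k) `` {a}" by auto
      ultimately show "J (Suc k) s' \<and> (\<forall>v\<in>{36..39}. s' v = s1 v)"
        using J W s' unfolding J_def * by auto
    qed (use J W assms in \<open>auto simp: J_def\<close>)
  qed
  have inner: "run (foreach 38 39 flex_body) s1 (?n * (body_time m + 3) + 1)
      (\<lambda>s'. J (k + ?n) s' \<and> (\<forall>v\<in>{36,37}. s' v = s1 v))"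
    if "J k s1" "s1 39 = list_data ls" for k s1
  proof -
    have "run (foreach 38 39 flex_body) s1 (?n * (body_time m + 3) + 1)
      ((\<lambda>zs s'. J (k + length zs) s' \<and> (\<forall>v\<in>{36,37}. s' v = s1 v)) ls)"
    proof (rule run_foreach[where I = "\<lambda>zs s'. J (k + length zs) s' \<and> (\<forall>v\<in>{36,37}. s' v = s1 v)"])
      fix zs ys :: "data list" and y s2
      assume *: "J (k + length zs) s2 \<and> (\<forall>v\<in>{36, 37}. s2 v = s1 v)"
      have "J (k + length zs) (s2(38 := y, 39 := list_data ys))" using * by (auto simp: J_def)
      from body[OF this] show "run flex_body (s2(38 := y, 39 := list_data ys)) (body_time m)
           (\<lambda>s'. s' 39 = list_data ys \<and> J (k + length (zs @ [y])) s' \<and> (\<forall>v\<in>{36, 37}. s' v = s1 v))"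
        by (rule run_mono) (use * in auto)
    qed (use that in auto)
    then show ?thesis by simp
  qed
  let ?s0 = "s(30 := nats_data [a], 31 := configs_data cs, 35 := Atom, 37 := list_data ls)"
  let ?loop = "foreach 36 37 (Seq (Assign 39 (Var 42)) (foreach 38 39 flex_body))"
  have "run ?loop ?s0 (?n * ((?n * (body_time m + 3) + 2) + 3) + 1) ((\<lambda>zs s'. J (length zs * ?n) s') ls)"
  proof (rule run_foreach[where I = "\<lambda>zs s'. J (length zs * ?n) s'"])
    fix zs ys :: "data list" and y s2
    assume *: "J (length zs * ?n) s2"
    have "J (length zs * ?n) (s2(36 := y, 37 := list_data ys, 39 := list_data ls))"
      using * by (auto simp: J_def)
    from inner[OF this] have "run (foreach 38 39 flex_body) (s2(36 := y, 37 := list_data ys, 39 := list_data ls))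
        (?n * (body_time m + 3) + 1) (\<lambda>s'. s' 37 = list_data ys \<and> J (length (zs @ [y]) * ?n) s')"
      by (rule run_mono) (auto simp: algebra_simps)
    moreover have "s2 42 = list_data ls" using * assms by (auto simp: J_def)
    ultimately show "run (Seq (Assign 39 (Var 42)) (foreach 38 39 flex_body)) (s2(36 := y, 37 := list_data ys))
        (?n * (body_time m + 3) + 2) (\<lambda>s'. s' 37 = list_data ys \<and> J (length (zs @ [y]) * ?n) s')"
      by simp
  next
    show "J (length [] * ?n) ?s0" using assms
      by (auto simp: J_def flexible_below_def intro!: exI[of _ "[a]"])
  qed auto
  then have "run ?loop ?s0 (flex_time m - 4) (\<lambda>s'.
     (s' 35 \<noteq> Atom \<longleftrightarrow> flexible_below (?n * ?n) ?E a) \<and> (\<forall>v\<ge>40. s' v = s v))"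
  proof (rule run_mono)
    have "?n * (?n * (body_time m + 3) + 5) \<le> m * (m * (body_time m + 3) + 5)"
      using assms by (intro mult_mono add_mono) auto
    then show "?n * (?n * (body_time m + 3) + 2 + 3) + 1 \<le> flex_time m - 4"
      by (simp add: flex_time_def algebra_simps)
  qed (auto simp: J_def)
  then show ?thesis unfolding flex_prog_def using assms by (simp add: flex_time_def)
qed

definition robust_config :: "nat \<Rightarrow> (nat \<times> nat list) set \<Rightarrow> nat \<times> nat list \<Rightarrow> bool" where
  "robust_config N C = (\<lambda>(a, bs). \<forall>x\<in>insert a (set bs). flexible_below N (config_edges C) x)"

text \<open>The reversal reflects the accumulation in \<open>prune_prog\<close>, which puts each
  surviving configuration in front.\<close>

definition prune_list :: "nat \<Rightarrow> (nat \<times> nat list) list \<Rightarrow> (nat \<times> nat list) list" where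
  "prune_list N cs = rev (filter (robust_config N (set cs)) cs)"

definition check_prog :: com where
  "check_prog = Seq (Assign 43 true_expr) (Seq (Assign 47 (Var 44))
     (foreach 40 47 (Seq flex_prog (Cond (Var 35) skip (Assign 43 Const_Atom)))))"

definition prune_prog :: com where
  "prune_prog = Seq (Assign 41 (Var 51)) (Seq (Assign 42 (Var 52)) (Seq (Assign 46 (Var 51))
     (Seq (Assign 45 Const_Atom) (foreach 44 46
        (Seq check_prog (Cond (Var 43) (Assign 45 (Mk_Pair (Var 44) (Var 45))) skip))))))"

definition "check_time m = m * (flex_time m + 6) + 5" for m :: nat
definition "prune_time m = m * (check_time m + 6) + 5" for m :: nat

lemma run_check_prog:
  assumes "s 44 = config_data c" "s 41 = configs_data cs" "s 42 = list_data ls" "bounded_configs m cs"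
    "length ls \<le> m" "c \<in> set cs" "1 \<le> m"
  shows "run check_prog s (check_time m) (\<lambda>s'.
     (s' 43 \<noteq> Atom \<longleftrightarrow> robust_config (length ls * length ls) (set cs) c) \<and>
     (\<forall>v\<ge>41. v \<noteq> 43 \<and> v \<noteq> 47 \<longrightarrow> s' v = s v))"
proof -
  obtain a bs where c: "c = (a, bs)" by fastforce
  let ?E = "config_edges (set cs)" and ?n = "length ls"
  let ?c = "Seq flex_prog (Cond (Var 35) skip (Assign 43 Const_Atom))"
  let ?s0 = "s(43 := Pair Atom Atom, 47 := config_data c)"
  define I where "I = (\<lambda>ds (s'::store). \<exists>xs. ds = map nat_data xs \<and>
     (s' 43 \<noteq> Atom \<longleftrightarrow> (\<forall>x\<in>set xs. flexible_below (?n * ?n) ?E x)) \<and>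
     (\<forall>v\<ge>41. v \<noteq> 43 \<and> v \<noteq> 47 \<longrightarrow> s' v = s v))"
  have inj: "inj nat_data" by (auto simp: inj_def)
  have bd: "length (a # bs) \<le> m" "\<forall>x\<in>set (a # bs). size (nat_data x) \<le> m"
    using assms c by (auto simp: bounded_configs_def Suc_le_eq)
  have "run (foreach 40 47 ?c) ?s0 (length (map nat_data (a # bs)) * ((flex_time m + 2) + 3) + 1)
    (I (map nat_data (a # bs)))"
  proof (rule run_foreach)
    fix zs y ys s1
    assume *: "map nat_data (a # bs) = zs @ y # ys" "I zs s1"
    then obtain us x vs where x: "a # bs = us @ x # vs" "zs = map nat_data us" "y = nat_data x"
      by (elim map_eq_appendE)
    have s1: "s1 43 \<noteq> Atom \<longleftrightarrow> (\<forall>x\<in>set us. flexible_below (?n * ?n) ?E x)"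
      "\<forall>v\<ge>41. v \<noteq> 43 \<and> v \<noteq> 47 \<longrightarrow> s1 v = s v"
      using * x inj by (auto simp: I_def inj_map_eq_map)
    let ?s1 = "s1(40 := y, 47 := list_data ys)"
    have "x \<in> set (a # bs)" using x by simp
    then have "run flex_prog ?s1 (flex_time m) (\<lambda>s'.
     (s' 35 \<noteq> Atom \<longleftrightarrow> flexible_below (?n * ?n) ?E x) \<and> (\<forall>v\<ge>40. s' v = ?s1 v))"
      using assms s1 x bd by (intro run_flex_prog) auto
    then show "run ?c ?s1 (flex_time m + 2) (\<lambda>s'. s' 47 = list_data ys \<and> I (zs @ [y]) s')"
    proof (rule run_Seq_call)
      fix s2 assume s2: "(s2 35 \<noteq> Atom \<longleftrightarrow> flexible_below (?n * ?n) ?E x) \<and> (\<forall>v\<ge>40. s2 v = ?s1 v)"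
      have "I (zs @ [y]) s'" if "s' 43 \<noteq> Atom \<longleftrightarrow> s1 43 \<noteq> Atom \<and> flexible_below (?n * ?n) ?E x"
         "\<forall>v\<ge>41. v \<noteq> 43 \<and> v \<noteq> 47 \<longrightarrow> s' v = s v" for s'
        unfolding I_def using that x s1 by (intro exI[of _ "us @ [x]"]) auto
      then show "run (Cond (Var 35) skip (Assign 43 Const_Atom)) s2 (flex_time m + 2 - flex_time m)
         (\<lambda>s'. s' 47 = list_data ys \<and> I (zs @ [y]) s')"
        using s2 s1 by simp
    qed auto
  qed (auto simp: c config_data_def I_def)
  then have "run (foreach 40 47 ?c) ?s0 (check_time m - 2) (\<lambda>s'.
     (s' 43 \<noteq> Atom \<longleftrightarrow> robust_config (length ls * length ls) (set cs) c) \<and>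
     (\<forall>v\<ge>41. v \<noteq> 43 \<and> v \<noteq> 47 \<longrightarrow> s' v = s v))"
  proof (rule run_mono)
    have "length (a # bs) * (flex_time m + 5) \<le> m * (flex_time m + 5)"
      using bd by (intro mult_right_mono) auto
    then show "length (map nat_data (a # bs)) * (flex_time m + 2 + 3) + 1 \<le> check_time m - 2"
      by (simp add: check_time_def algebra_simps)
  qed (use inj in \<open>auto simp: I_def c robust_config_def inj_map_eq_map simp del: list.map\<close>)
  then show ?thesis unfolding check_prog_def using assms by (simp add: check_time_def)
qed

lemma run_prune_prog:
  assumes "s 51 = configs_data cs" "s 52 = list_data ls" "bounded_configs m cs"
    "length ls \<le> m" "1 \<le> m"
  shows "run prune_prog s (prune_time m) (\<lambda>s'.
     s' 45 = configs_data (prune_list (length ls * length ls) cs) \<and> (\<forall>v\<ge>50. s' v = s v))"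
proof -
  let ?c = "Seq check_prog (Cond (Var 43) (Assign 45 (Mk_Pair (Var 44) (Var 45))) skip)"
  let ?P = "robust_config (length ls * length ls) (set cs)"
  let ?s0 = "s(41 := configs_data cs, 42 := list_data ls, 46 := configs_data cs, 45 := Atom)"
  define I where "I = (\<lambda>ds (s'::store). \<exists>cs1 cs2. cs = cs1 @ cs2 \<and> ds = map config_data cs1 \<and>
     s' 45 = configs_data (rev (filter ?P cs1)) \<and>
     s' 41 = configs_data cs \<and> s' 42 = list_data ls \<and> (\<forall>v\<ge>50. s' v = s v))"
  have "run (foreach 44 46 ?c) ?s0 (length (map config_data cs) * ((check_time m + 2) + 3) + 1)
     (I (map config_data cs))"
  proof (rule run_foreach)
    fix zs y ys s1
    assume *: "map config_data cs = zs @ y # ys" "I zs s1"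
    from *(2) obtain cs1 cs' where cs1: "cs = cs1 @ cs'" "zs = map config_data cs1"
      "s1 45 = configs_data (rev (filter ?P cs1))"
      "s1 41 = configs_data cs" "s1 42 = list_data ls" "\<forall>v\<ge>50. s1 v = s v" by (auto simp: I_def)
    then obtain c cs2 where c: "cs' = c # cs2" "y = config_data c"
      using *(1) by (cases cs') auto
    let ?s1 = "s1(44 := y, 46 := list_data ys)"
    have "run check_prog ?s1 (check_time m) (\<lambda>s'. (s' 43 \<noteq> Atom \<longleftrightarrow> ?P c) \<and>
     (\<forall>v\<ge>41. v \<noteq> 43 \<and> v \<noteq> 47 \<longrightarrow> s' v = ?s1 v))"
      using assms cs1 c by (intro run_check_prog) auto
    then show "run ?c ?s1 (check_time m + 2) (\<lambda>s'. s' 46 = list_data ys \<and> I (zs @ [y]) s')"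
    proof (rule run_Seq_call)
      fix s2 assume s2: "(s2 43 \<noteq> Atom \<longleftrightarrow> ?P c) \<and> (\<forall>v\<ge>41. v \<noteq> 43 \<and> v \<noteq> 47 \<longrightarrow> s2 v = ?s1 v)"
      have "I (zs @ [y]) s'" if "s' 45 = configs_data (rev (filter ?P (cs1 @ [c])))"
        "\<forall>v\<ge>41. v \<noteq> 43 \<and> v \<noteq> 44 \<and> v \<noteq> 45 \<and> v \<noteq> 46 \<and> v \<noteq> 47 \<longrightarrow> s' v = s1 v" for s'
        unfolding I_def using that cs1 c
        by (intro exI[of _ "cs1 @ [c]"] exI[of _ cs2]) auto
      then show "run (Cond (Var 43) (Assign 45 (Mk_Pair (Var 44) (Var 45))) skip) s2
         (check_time m + 2 - check_time m) (\<lambda>s'. s' 46 = list_data ys \<and> I (zs @ [y]) s')"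
        using s2 cs1 c by auto
    qed auto
  next
    show "I [] ?s0" unfolding I_def by (intro exI[of _ "[]"] exI[of _ cs]) auto
  qed auto
  then have "run (foreach 44 46 ?c) ?s0 (prune_time m - 4) (\<lambda>s'.
     s' 45 = configs_data (prune_list (length ls * length ls) cs) \<and> (\<forall>v\<ge>50. s' v = s v))"
  proof (rule run_mono)
    have "length cs * (check_time m + 5) \<le> m * (check_time m + 5)"
      using assms by (intro mult_right_mono) (auto simp: bounded_configs_def)
    then show "length (map config_data cs) * (check_time m + 2 + 3) + 1 \<le> prune_time m - 4"
      by (simp add: prune_time_def algebra_simps)
    fix s' assume "I (map config_data cs) s'"
    then obtain cs1 cs2 where *: "cs = cs1 @ cs2" "map config_data cs = map config_data cs1"
      "s' 45 = configs_data (rev (filter ?P cs1))" "\<forall>v\<ge>50. s' v = s v"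
      unfolding I_def by blast
    from *(1) *(2)[THEN arg_cong[where f = length]] have "cs1 = cs" by simp
    then show "s' 45 = configs_data (prune_list (length ls * length ls) cs) \<and> (\<forall>v\<ge>50. s' v = s v)"
      using * by (auto simp: prune_list_def)
  qed
  then show ?thesis unfolding prune_prog_def using assms by (simp add: prune_time_def)
qed

text \<open>The copy of the configuration list in variable 54 is a counter: every round that changes
  anything removes a configuration, so as many rounds as there are configurations reach the fixed
  point.\<close>

definition decide_prog :: com where
  "decide_prog = Seq (Assign 52 (Left (Right (Var 0)))) (Seq (Assign 51 (Right (Right (Var 0))))
     (Seq (Assign 54 (Var 51)) (Seq (foreach 53 54 (Seq prune_prog (Assign 51 (Var 45))))
     (Assign 0 (Var 51)))))"

definition "decide_time m = m * (prune_time m + 6) + 10" for m :: nat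

lemma bounded_configs_prune_list:
  assumes "bounded_configs m cs"
  shows "bounded_configs m (prune_list N cs)"
proof -
  have "sum_list (map f (filter P cs)) \<le> sum_list (map f cs)" for f :: "_ \<Rightarrow> nat" and P
    by (induction cs) auto
  then show ?thesis using assms
    by (auto simp: bounded_configs_def prune_list_def rev_map[symmetric]
      intro: le_trans[OF length_filter_le] le_trans)
qed

lemma run_decide_prog:
  assumes "s 0 = Pair d (Pair (list_data ls) (configs_data cs))" "bounded_configs m cs"
    "length ls \<le> m" "1 \<le> m"
  shows "run decide_prog s (decide_time m) (\<lambda>s'.
     s' 0 \<noteq> Atom \<longleftrightarrow> (prune_list (length ls * length ls) ^^ length cs) cs \<noteq> [])"
proof -
  let ?F = "prune_list (length ls * length ls)"
  let ?c = "Seq prune_prog (Assign 51 (Var 45))"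
  let ?s0 = "s(52 := list_data ls, 51 := configs_data cs, 54 := configs_data cs)"
  define I where "I = (\<lambda>(ds::data list) (s'::store). s' 51 = configs_data ((?F ^^ length ds) cs) \<and>
     bounded_configs m ((?F ^^ length ds) cs) \<and> s' 52 = list_data ls)"
  have loop: "run (foreach 53 54 ?c) ?s0 (length (map config_data cs) * ((prune_time m + 1) + 3) + 1)
     (I (map config_data cs))"
  proof (rule run_foreach)
    fix zs y ys s1
    assume *: "I zs s1"
    let ?s1 = "s1(53 := y, 54 := list_data ys)"
    have "run prune_prog ?s1 (prune_time m)
       (\<lambda>s'. s' 45 = configs_data (?F ((?F ^^ length zs) cs)) \<and> (\<forall>v\<ge>50. s' v = ?s1 v))"
      by (rule run_prune_prog) (use * assms in \<open>auto simp: I_def\<close>)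
    then show "run ?c ?s1 (prune_time m + 1) (\<lambda>s'. s' 54 = list_data ys \<and> I (zs @ [y]) s')"
      by (rule run_Seq_call) (use * in \<open>auto simp: I_def bounded_configs_prune_list\<close>)
  qed (use assms in \<open>auto simp: I_def\<close>)
  have "run (Seq (foreach 53 54 ?c) (Assign 0 (Var 51))) ?s0 (decide_time m - 3) (\<lambda>s'.
     s' 0 \<noteq> Atom \<longleftrightarrow> (?F ^^ length cs) cs \<noteq> [])"
  proof (rule run_Seq_call[OF loop])
    have le: "length cs * (prune_time m + 4) \<le> m * (prune_time m + 4)"
      using assms by (intro mult_right_mono) (auto simp: bounded_configs_def)
    then show "length (map config_data cs) * (prune_time m + 1 + 3) + 1 \<le> decide_time m - 3"
      by (simp add: decide_time_def algebra_simps)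
    fix s' assume "I (map config_data cs) s'"
    moreover have "list_data xs = Atom \<longleftrightarrow> xs = []" for xs by (cases xs) auto
    ultimately show "run (Assign 0 (Var 51)) s'
       (decide_time m - 3 - (length (map config_data cs) * (prune_time m + 1 + 3) + 1))
       (\<lambda>s'. s' 0 \<noteq> Atom \<longleftrightarrow> (?F ^^ length cs) cs \<noteq> [])"
      using le by (simp add: I_def decide_time_def algebra_simps)
  qed
  then show ?thesis unfolding decide_prog_def using assms by (simp add: decide_time_def)
qed


section \<open>Bounded walks and iterated pruning\<close>

lemma decreasing_funpow_stable:
  fixes f :: "'a set \<Rightarrow> 'a set"
  assumes "\<And>X. f X \<subseteq> X" "finite X" "card X \<le> n"
  shows "f ((f ^^ n) X) = (f ^^ n) X"
  using assms(2,3)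
proof (induction n arbitrary: X)
  case 0
  then show ?case using assms(1)[of X] by auto
next
  case (Suc n)
  show ?case
  proof (cases "f X = X")
    case True
    then have "(f ^^ k) X = X" for k by (induction k) auto
    then show ?thesis using True by metis
  next
    case False
    then have "f X \<subset> X" using assms(1) by auto
    then have "card (f X) < card X" "finite (f X)"
      using Suc.prems by (auto simp: psubset_card_mono finite_subset)
    then have "f ((f ^^ n) (f X)) = (f ^^ n) (f X)" using Suc by auto
    then show ?thesis by (simp add: funpow_swap1)
  qed
qed

text \<open>A walk with at least \<open>card V\<close> steps visits some vertex twice, and cutting
  out the closed part between the two visits shortens it.\<close>

lemma relpow_less_card:
  assumes "(x, y) \<in> R ^^ k" "finite V" "x \<in> V" "R \<subseteq> V \<times> V"
  shows "\<exists>j<card V. (x, y) \<in> R ^^ j"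
  using assms(1)
proof (induction k rule: less_induct)
  case (less k)
  show ?case
  proof (cases "k < card V")
    case False
    from less.prems obtain f where f: "f 0 = x" "f k = y" "\<And>i. i < k \<Longrightarrow> (f i, f (Suc i)) \<in> R"
      by (auto simp: relpow_fun_conv)
    have "f i \<in> V" if "i \<le> k" for i
    proof (cases i)
      case (Suc l)
      then show ?thesis using f(3)[of l] that assms(4) by auto
    qed (use f assms in auto)
    then have "f ` {..k} \<subseteq> V" by auto
    then have "card (f ` {..k}) < card {..k}" using False assms(2) card_mono[of V "f ` {..k}"] by simp
    then have "\<not> inj_on f {..k}" using card_image by fastforce
    then obtain i j where ij: "i < j" "j \<le> k" "f i = f j"
      unfolding inj_on_def by (metis atMost_iff linorder_neqE_nat)
    have "(x, f i) \<in> R ^^ i" unfolding relpow_fun_conv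
      using f ij by (intro exI[of _ f]) auto
    moreover have "(f j, y) \<in> R ^^ (k - j)" unfolding relpow_fun_conv
      using f ij by (intro exI[of _ "\<lambda>l. f (l + j)"]) auto
    ultimately have "(x, y) \<in> R ^^ (i + (k - j))" using ij unfolding relpow_add by auto
    moreover have "i + (k - j) < k" using ij by auto
    ultimately show ?thesis using less.IH by blast
  qed (use less.prems in auto)
qed

text \<open>Walks of lengths \<open>k\<close> and \<open>k + 1\<close> are one walk of length \<open>k\<close> in the product of the graph with
  itself, whose length can be taken smaller than the number of pairs of vertices.\<close>

lemma flexible_iff_flexible_below:
  assumes "finite V" "E \<subseteq> V \<times> V"
  shows "flexible E a \<longleftrightarrow> flexible_below (card V * card V) E a"
proof
  assume "flexible E a"
  then obtain k where k: "(a, a) \<in> E ^^ k" "(a, a) \<in> E ^^ Suc k" by (auto simp: flexible_def)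
  \<comment> \<open>The longer walk gets a head start of one edge, to \<open>b\<close>; its
    remaining \<open>k\<close> steps then run in parallel with the shorter walk.\<close>
  then obtain b where b: "(a, b) \<in> E" "(b, a) \<in> E ^^ k" using relpow_Suc_D2[OF k(2)] by blast
  define R where "R = {((u, w), (u', w')). (u, u') \<in> E \<and> (w, w') \<in> E}"
  have R: "((u, w), (u', w')) \<in> R ^^ j \<longleftrightarrow> (u, u') \<in> E ^^ j \<and> (w, w') \<in> E ^^ j" for j u w u' w'
  proof (induction j arbitrary: u' w')
    case (Suc j)
    show ?case
    proof
      assume "((u, w), (u', w')) \<in> R ^^ Suc j"
      then obtain u1 w1 where "((u, w), (u1, w1)) \<in> R ^^ j" "((u1, w1), (u', w')) \<in> R" by auto
      then show "(u, u') \<in> E ^^ Suc j \<and> (w, w') \<in> E ^^ Suc j" using Suc by (auto simp: R_def)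
    next
      assume "(u, u') \<in> E ^^ Suc j \<and> (w, w') \<in> E ^^ Suc j"
      then obtain u1 w1 where "(u, u1) \<in> E ^^ j" "(u1, u') \<in> E" "(w, w1) \<in> E ^^ j" "(w1, w') \<in> E"
        by auto
      then have "((u, w), (u1, w1)) \<in> R ^^ j" "((u1, w1), (u', w')) \<in> R"
        using Suc by (auto simp: R_def)
      then show "((u, w), (u', w')) \<in> R ^^ Suc j" by auto
    qed
  qed auto
  have "((a, b), (a, a)) \<in> R ^^ k" using k b by (simp add: R)
  moreover have "(a, b) \<in> V \<times> V" using b assms by auto
  moreover have "R \<subseteq> (V \<times> V) \<times> (V \<times> V)" using assms by (auto simp: R_def)
  ultimately obtain j where "j < card (V \<times> V)" "((a, b), (a, a)) \<in> R ^^ j"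
    using relpow_less_card[of "(a, b)" "(a, a)" k R "V \<times> V"] assms by blast
  then have "j < card V * card V" "(a, a) \<in> E ^^ j" "(a, a) \<in> E ^^ Suc j"
    using b by (auto simp: R card_cartesian_product simp del: relpow.simps intro: relpow_Suc_I2)
  then show "flexible_below (card V * card V) E a" by (auto simp: flexible_below_def)
qed (auto simp: flexible_def flexible_below_def)

definition prune :: "('a \<times> 'a list) set \<Rightarrow> ('a \<times> 'a list) set" where
  "prune C = {(a, bs) \<in> C. \<forall>x\<in>insert a (set bs). flexible (config_edges C) x}"

definition robust :: "lcl \<Rightarrow> bool" where
  "robust \<P> \<longleftrightarrow> (\<exists>C\<subseteq>configs \<P>. C \<noteq> {} \<and> C \<subseteq> prune C)"

lemma flexible_mono:
  assumes "E \<subseteq> E'" "flexible E a"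
  shows "flexible E' a"
proof -
  have "E ^^ k \<subseteq> E' ^^ k" for k using assms(1) by (induction k) auto
  then show ?thesis using assms(2) unfolding flexible_def by blast
qed

lemma config_edges_mono: "C \<subseteq> D \<Longrightarrow> config_edges C \<subseteq> config_edges D"
  by (auto simp: config_edges_def)

lemma prune_mono: "C \<subseteq> D \<Longrightarrow> prune C \<subseteq> prune D"
  unfolding prune_def using flexible_mono[OF config_edges_mono, of C D] by blast

lemma prune_subset: "prune C \<subseteq> C"
  by (auto simp: prune_def)

text \<open>\<open>prune\<close> is monotone, so the iteration from above never drops below a robust
  set. It is also decreasing on a finite set, so after \<open>n\<close> rounds it stands still, and
  a nonempty fixed point is itself robust.\<close>

lemma robust_iff_funpow:
  assumes "finite (configs \<P>)" "card (configs \<P>) \<le> n"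
  shows "robust \<P> \<longleftrightarrow> (prune ^^ n) (configs \<P>) \<noteq> {}"
proof
  assume "robust \<P>"
  then obtain C where C: "C \<subseteq> configs \<P>" "C \<noteq> {}" "C \<subseteq> prune C" by (auto simp: robust_def)
  have "C \<subseteq> (prune ^^ k) (configs \<P>)" for k
  proof (induction k)
    case (Suc k)
    then show ?case using C(3) prune_mono[OF Suc] by auto
  qed (use C in auto)
  then show "(prune ^^ n) (configs \<P>) \<noteq> {}" using C by blast
next
  assume ne: "(prune ^^ n) (configs \<P>) \<noteq> {}"
  have "(prune ^^ k) (configs \<P>) \<subseteq> configs \<P>" for k
    by (induction k) (use prune_subset in auto)
  moreover have "prune ((prune ^^ n) (configs \<P>)) = (prune ^^ n) (configs \<P>)"
    by (intro decreasing_funpow_stable prune_subset assms)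
  ultimately show "robust \<P>" unfolding robust_def using ne by blast
qed

lemma set_prune_list_funpow:
  assumes "finite V" "config_edges (set cs) \<subseteq> V \<times> V"
  shows "set ((prune_list (card V * card V) ^^ k) cs) = (prune ^^ k) (set cs)"
proof (induction k)
  case (Suc k)
  let ?cs = "(prune_list (card V * card V) ^^ k) cs"
  have "(prune ^^ k) (set cs) \<subseteq> set cs" for k
    by (induction k) (use prune_subset in auto)
  then have "set ?cs \<subseteq> set cs" using Suc by simp
  then have "config_edges (set ?cs) \<subseteq> V \<times> V" using config_edges_mono assms(2) by blast
  from flexible_iff_flexible_below[OF assms(1) this]
  have "set (prune_list (card V * card V) ?cs) = prune (set ?cs)"
    by (auto simp: prune_list_def prune_def robust_config_def)
  then show ?case using Suc by simp
qed auto

definition decide_poly :: "nat poly" where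
  "decide_poly = (let m = [:0, 1:]; c = (\<lambda>k. [:k:]); mem = m * (8 * m + c 14) + c 5;
     succ = m * (mem + 4 * m + c 10) + c 5; body = 2 * mem + succ + c 10;
     flex = m * (m * (body + c 3) + c 6) + c 10; check = m * (flex + c 6) + c 5;
     prune = m * (check + c 6) + c 5
   in m * (prune + c 6) + c 10)"

lemma poly_decide_poly: "poly decide_poly m = decide_time m"
  by (simp add: decide_poly_def Let_def decide_time_def prune_time_def check_time_def flex_time_def
    body_time_def succ_time_def mem_time_def algebra_simps)

lemma size_list_data: "size (list_data xs) = length xs + sum_list (map size xs)"
  by (induction xs) auto

lemma decide_prog_correct:
  assumes "is_lcl \<P>" "describes d \<P>"
  shows "\<exists>t. answers decide_prog d t (robust \<P>) \<and> t \<le> poly decide_poly (size d)"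
proof -
  obtain ls cs where d: "distinct ls" "set ls = labels \<P>" "distinct cs" "set cs = configs \<P>"
    "d = Pair (nat_data (arity \<P>)) (Pair (nats_data ls) (configs_data cs))"
    using assms(2) by (auto simp: describes_def)
  let ?m = "size d"
  have sz_cs: "length cs + sum_list (map (size \<circ> config_data) cs) \<le> ?m"
    using d(5) by (simp add: size_list_data)
  have sz_c: "size (config_data (a, bs)) = size (nat_data a) + Suc (length bs + sum_list (map (size \<circ> nat_data) bs))" for a bs
    by (simp add: config_data_def size_list_data)
  have bd: "bounded_configs ?m cs" unfolding bounded_configs_def
  proof (intro conjI ballI)
    show "length cs \<le> ?m" using sz_cs by simp
    have "sum_list (map (length \<circ> snd) cs) \<le> sum_list (map (size \<circ> config_data) cs)"
      by (intro sum_list_mono) (auto simp: sz_c)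
    then show "sum_list (map (length \<circ> snd) cs) \<le> ?m" using sz_cs by simp
    fix c assume c: "c \<in> set cs"
    obtain a bs where abs: "c = (a, bs)" by fastforce
    have "size (config_data c) \<le> sum_list (map (size \<circ> config_data) cs)"
      using c by (intro member_le_sum_list) auto
    then have le: "size (nat_data a) + Suc (length bs + sum_list (map (size \<circ> nat_data) bs)) \<le> ?m"
      using sz_cs by (simp add: abs sz_c)
    have "size (nat_data x) \<le> sum_list (map (size \<circ> nat_data) bs)" if "x \<in> set bs" for x
      using that by (intro member_le_sum_list) auto
    then show "case c of (a, bs) \<Rightarrow> length bs < ?m \<and> (\<forall>x\<in>insert a (set bs). size (nat_data x) \<le> ?m)"
      using le abs by fastforce
  qed
  have len: "length ls \<le> ?m" "1 \<le> ?m" using d(5) by (simp_all add: size_list_data)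
  have card: "card (labels \<P>) = length ls" using d by (metis distinct_card)
  have "config_edges (set cs) \<subseteq> labels \<P> \<times> labels \<P>"
    using assms(1) d by (fastforce simp: config_edges_def is_lcl_def)
  then have "set ((prune_list (length ls * length ls) ^^ length cs) cs) = (prune ^^ length cs) (configs \<P>)"
    using set_prune_list_funpow[of "labels \<P>" cs] assms(1) d card by (simp add: is_lcl_def)
  then have rob: "robust \<P> \<longleftrightarrow> (prune_list (length ls * length ls) ^^ length cs) cs \<noteq> []"
    using robust_iff_funpow[of \<P> "length cs"] d
    by (metis List.finite_set card_length set_empty2)
  have "run decide_prog ((\<lambda>_. Atom)(0 := d)) (decide_time ?m) (\<lambda>s'. s' 0 \<noteq> Atom \<longleftrightarrow>
    (prune_list (length (map nat_data ls) * length (map nat_data ls)) ^^ length cs) cs \<noteq> [])"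
    by (rule run_decide_prog) (use d bd len in auto)
  then show ?thesis unfolding run_def answers_def poly_decide_poly by (auto simp: rob)
qed

section \<open>Locality\<close>

text \<open>Indistinguishability within \<open>r\<close> rounds, independent of any algorithm: the
  recursion follows exactly what \<open>history\<close> reads. The condition on \<open>last\<close>
  is there because a parent may send different messages through different ports.\<close>

primrec sim :: "nat \<Rightarrow> vertex set \<Rightarrow> (vertex \<Rightarrow> nat) \<Rightarrow> vertex \<Rightarrow>
    vertex set \<Rightarrow> (vertex \<Rightarrow> nat) \<Rightarrow> vertex \<Rightarrow> bool" where
  "sim 0 T ids v T' ids' v' \<longleftrightarrow> initial_knowledge T ids v = initial_knowledge T' ids' v'"
| "sim (Suc r) T ids v T' ids' v' \<longleftrightarrow> sim r T ids v T' ids' v' \<and>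
     (v \<noteq> [] \<longrightarrow> last v = last v' \<and> sim r T ids (butlast v) T' ids' (butlast v')) \<and>
     (\<forall>i<num_children T v. sim r T ids (v @ [i]) T' ids' (v' @ [i]))"

lemma sim_initial_knowledge:
  "sim r T ids v T' ids' v' \<Longrightarrow> initial_knowledge T ids v = initial_knowledge T' ids' v'"
  by (induction r) auto

lemma initial_knowledge_eqD:
  assumes "initial_knowledge T ids v = initial_knowledge T' ids' v'"
  shows "ids v = ids' v'" "v = [] \<longleftrightarrow> v' = []" "num_children T v = num_children T' v'" "card T = card T'"
  using assms by (auto simp: initial_knowledge_def vertex_degree_def split: if_splits)

lemma sim_antimono: "sim r T ids v T' ids' v' \<Longrightarrow> s \<le> r \<Longrightarrow> sim s T ids v T' ids' v'"
  by (induction r) (auto simp: le_Suc_eq simp del: sim.simps(2) dest: sim.simps(2)[THEN iffD1])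

lemma sim_history:
  "sim r T ids v T' ids' v' \<Longrightarrow> history A T ids r v = history A T' ids' r v'"
proof (induction r arbitrary: v v')
  case (Suc r)
  from Suc.prems have s: "sim r T ids v T' ids' v'" by simp
  note e = initial_knowledge_eqD[OF sim_initial_knowledge[OF s]]
  have p: "last v = last v'" "history A T ids r (butlast v) = history A T' ids' r (butlast v')"
    "initial_knowledge T ids (butlast v) = initial_knowledge T' ids' (butlast v')" if "v \<noteq> []"
    using Suc.prems that Suc.IH[of "butlast v" "butlast v'"] sim_initial_knowledge by auto
  have "sim r T ids (v @ [i]) T' ids' (v' @ [i])" if "i < num_children T v" for i
    using Suc.prems that by auto
  then have c: "history A T ids r (v @ [i]) = history A T' ids' r (v' @ [i])"
    "initial_knowledge T ids (v @ [i]) = initial_knowledge T' ids' (v' @ [i])"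
    if "i < num_children T v" for i
    using that Suc.IH[of "v @ [i]" "v' @ [i]"] sim_initial_knowledge[of r T ids "v @ [i]" T' ids' "v' @ [i]"] by auto
  show ?case
    using Suc.IH[OF s] e(2,3) p c by simp
qed simp

text \<open>The two vertices have equal decisions up to round \<open>t\<close>. As one of them
  decides by then, the first decisions of both fall into this range and coincide.\<close>

lemma sim_output_label:
  assumes "sim t T ids v T' ids' v'" "r \<le> t" "decision_at A T ids v r \<noteq> None"
  shows "output_label A T ids v = output_label A T' ids' v'"
proof -
  have eq: "decision_at A T ids v s = decision_at A T' ids' v' s" if "s \<le> t" for s
    unfolding decision_at_def
    using sim_history[OF sim_antimono[OF assms(1) that], of A] sim_initial_knowledge[OF assms(1)] by simp
  let ?L = "LEAST s. decision_at A T ids v s \<noteq> None" and ?L' = "LEAST s. decision_at A T' ids' v' s \<noteq> None"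
  have L: "decision_at A T ids v ?L \<noteq> None" by (rule LeastI) (rule assms(3))
  have "?L \<le> r" by (rule Least_le) (rule assms(3))
  then have le: "?L \<le> t" using assms(2) by simp
  have 1: "decision_at A T' ids' v' ?L \<noteq> None" using L eq[OF le] by simp
  have L': "decision_at A T' ids' v' ?L' \<noteq> None" by (rule LeastI) (rule 1)
  have le': "?L' \<le> ?L" by (rule Least_le) (rule 1)
  have "decision_at A T ids v ?L' \<noteq> None" using L' eq[of ?L'] le le' by simp
  then have "?L \<le> ?L'" by (rule Least_le)
  then have "?L = ?L'" using le' by simp
  then show ?thesis unfolding output_label_def using eq[OF le] by simp
qed

lemma full_tree_children:
  assumes "full_tree \<delta> T" "v \<in> T"
  shows "v @ [i] \<in> T \<longleftrightarrow> i < num_children T v" and "num_children T v = 0 \<or> num_children T v = \<delta>"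
proof -
  have "{i. v @ [i] \<in> T} = {} \<or> {i. v @ [i] \<in> T} = {..<\<delta>}" using assms by (auto simp: full_tree_def)
  then have "{i. v @ [i] \<in> T} = {..<num_children T v} \<and> (num_children T v = 0 \<or> num_children T v = \<delta>)"
    unfolding num_children_def by (elim disjE) simp_all
  then show "v @ [i] \<in> T \<longleftrightarrow> i < num_children T v" "num_children T v = 0 \<or> num_children T v = \<delta>"
    by blast+
qed

lemma full_tree_prefix_closed: "full_tree \<delta> T \<Longrightarrow> v @ w \<in> T \<Longrightarrow> v \<in> T"
proof (induction w rule: rev_induct)
  case (snoc x xs)
  then show ?case by (metis append_assoc full_tree_def)
qed simp

subsection \<open>Full-information algorithms\<close>

text \<open>Messages may be arbitrarily long, so the countable set of states can simply be coded in
  unary.\<close>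

definition encode :: "knowledge \<Rightarrow> inbox list \<Rightarrow> nat \<Rightarrow> message" where
  "encode k h p = replicate (to_nat (ident k, own_degree k, has_parent k, num_nodes k, max_degree k, h, p)) True"

lemma encode_inject: "encode k h p = encode k' h' p' \<longleftrightarrow> k = k' \<and> h = h' \<and> p = p'"
  by (auto simp: encode_def replicate_eq_replicate inj_eq[OF inj_to_nat])

text \<open>Port \<open>0\<close> stands for the parent, port \<open>Suc i\<close> for the \<open>i\<close>-th child.\<close>

definition full_information ::
    "(nat \<Rightarrow> nat) \<Rightarrow> (knowledge \<Rightarrow> inbox list \<Rightarrow> nat) \<Rightarrow> algorithm" where
  "full_information \<tau> g = \<lparr>to_parent = (\<lambda>k h. encode k h 0), to_child = (\<lambda>k h i. encode k h (Suc i)),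
     decision = (\<lambda>k h. if length h = \<tau> (num_nodes k) then Some (g k h) else None)\<rparr>"

lemma length_history [simp]: "length (history A T ids r v) = r"
  by (induction r arbitrary: v) auto

text \<open>Converse of \<open>sim_history\<close> for algorithms that always send their whole
  state; the port number inside the message recovers \<open>last v = last v'\<close>.\<close>

lemma sim_if_full_information:
  assumes "initial_knowledge T ids v = initial_knowledge T' ids' v'"
    "history (full_information \<tau> g) T ids r v = history (full_information \<tau> g) T' ids' r v'"
  shows "sim r T ids v T' ids' v'"
  using assms
proof (induction r arbitrary: v v')
  case (Suc r)
  let ?A = "full_information \<tau> g"
  note e = initial_knowledge_eqD[OF Suc.prems(1)]
  have h: "history ?A T ids r v = history ?A T' ids' r v'" using Suc.prems(2) by simp
  have "last v = last v' \<and> sim r T ids (butlast v) T' ids' (butlast v')" if "v \<noteq> []"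
    using Suc.prems(2) that e(2) Suc.IH[of "butlast v" "butlast v'"]
    by (auto simp: full_information_def encode_inject)
  moreover have "sim r T ids (v @ [i]) T' ids' (v' @ [i])" if "i < num_children T v" for i
    using Suc.prems(2) that e(3) Suc.IH[of "v @ [i]" "v' @ [i]"]
    by (auto simp: full_information_def encode_inject)
  ultimately show ?case using Suc.IH[OF Suc.prems(1) h] by simp
qed simp

text \<open>After collecting its neighbourhood, a vertex picks any instance that would have led to
  the same history and evaluates \<open>g\<close> there. By assumption the choice does not matter.
  All later constructions can thus be given as global functions of the instance.\<close>

lemma local_function_algorithm:
  fixes g :: "vertex set \<Rightarrow> (vertex \<Rightarrow> nat) \<Rightarrow> vertex \<Rightarrow> nat"
  assumes "\<And>T ids v T' ids' v'. (T, ids) \<in> I \<Longrightarrow> (T', ids') \<in> I \<Longrightarrow> v \<in> T \<Longrightarrow> v' \<in> T' \<Longrightarrow>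
    sim (\<tau> (card T)) T ids v T' ids' v' \<Longrightarrow> g T ids v = g T' ids' v'"
  obtains A where "\<And>T ids v. (T, ids) \<in> I \<Longrightarrow> v \<in> T \<Longrightarrow> output_label A T ids v = g T ids v \<and>
    output_time A T ids v = \<tau> (card T) \<and> (\<exists>r. decision_at A T ids v r \<noteq> None)"
proof -
  \<comment> \<open>The messages do not depend on the decision function, so histories can be taken
    from a dummy algorithm; this avoids a circular definition of \<open>G\<close> and
    \<open>A\<close>.\<close>
  define G where "G = (\<lambda>k h. let (T, ids, v) = (SOME (T, ids, v). (T, ids) \<in> I \<and> v \<in> T \<and>
     initial_knowledge T ids v = k \<and> history (full_information \<tau> (\<lambda>_ _. 0)) T ids (length h) v = h)
     in g T ids v)"
  define A where "A = full_information \<tau> G"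
  have hist: "history A T ids r v = history (full_information \<tau> g') T ids r v" for T ids r v g'
    by (induction r arbitrary: v) (auto simp: A_def full_information_def)
  show ?thesis
  proof
    fix T ids v
    assume Tv: "(T, ids) \<in> I" "v \<in> T"
    let ?t = "\<tau> (card T)"
    let ?k = "initial_knowledge T ids v" and ?h = "history A T ids ?t v"
    let ?P = "\<lambda>(T', ids', v'). (T', ids') \<in> I \<and> v' \<in> T' \<and> initial_knowledge T' ids' v' = ?k \<and>
      history (full_information \<tau> (\<lambda>_ _. 0)) T' ids' (length ?h) v' = ?h"
    have "?P (T, ids, v)" using Tv hist[of T ids _ v] by auto
    then have "?P (SOME x. ?P x)" by (rule someI)
    moreover obtain T' ids' v' where x: "(SOME x. ?P x) = (T', ids', v')" by (cases "SOME x. ?P x")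
    ultimately have *: "(T', ids') \<in> I" "v' \<in> T'" "?k = initial_knowledge T' ids' v'"
      "history A T ids ?t v = history A T' ids' ?t v'"
      using hist[of T' ids' ?t v' "\<lambda>_ _. 0"] by auto
    then have "sim ?t T ids v T' ids' v'"
      by (intro sim_if_full_information[of _ _ _ _ _ _ \<tau> G]) (auto simp: A_def)
    then have "g T ids v = g T' ids' v'" using assms Tv * by blast
    then have G: "G ?k ?h = g T ids v" unfolding G_def using x by simp
    have nn: "num_nodes ?k = card T" by (simp add: initial_knowledge_def)
    have dec: "decision_at A T ids v r = (if r = ?t then Some (g T ids v) else None)" for r
      using G unfolding decision_at_def by (simp add: A_def full_information_def nn)
    then have "(LEAST r. decision_at A T ids v r \<noteq> None) = ?t"
      by (intro Least_equality) (auto split: if_splits)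
    then show "output_label A T ids v = g T ids v \<and> output_time A T ids v = ?t \<and>
       (\<exists>r. decision_at A T ids v r \<noteq> None)"
      using dec by (auto simp: output_label_def output_time_def)
  qed
qed

section \<open>Rake and compress\<close>

text \<open>The \<open>k\<close>-th ancestor. By truncated subtraction it stays at the root for
  larger \<open>k\<close>, hence the explicit bound on \<open>length v\<close> in
  \<open>deep\<close>.\<close>

abbreviation up :: "nat \<Rightarrow> vertex \<Rightarrow> vertex" where
  "up k v \<equiv> take (length v - k) v"

text \<open>
  One phase removes from the remaining vertices \<open>X\<close> those without a child in \<open>X\<close>, and all chains
  of more than \<open>l\<close> vertices with exactly one child in \<open>X\<close>. The splitters are chosen among the deep
  vertices, which have at least \<open>l\<close> vertices of their chain above them.
\<close>

definition chain :: "vertex set \<Rightarrow> vertex set" where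
  "chain X = {v \<in> X. \<exists>!c. v @ [c] \<in> X}"

definition deep :: "nat \<Rightarrow> vertex set \<Rightarrow> vertex set" where
  "deep l X = {v. l \<le> length v \<and> (\<forall>k\<le>l. up k v \<in> chain X)}"

text \<open>The upper \<open>l\<close> vertices of a long chain are not deep themselves, so
  membership in the chain is detected by a deep vertex at most \<open>l\<close> below.\<close>

definition compressed :: "nat \<Rightarrow> vertex set \<Rightarrow> vertex set" where
  "compressed l X = {v. \<exists>z. length z \<le> l \<and> v @ z \<in> deep l X}"

primrec alive :: "nat \<Rightarrow> vertex set \<Rightarrow> nat \<Rightarrow> vertex set" where
  "alive l T 0 = T"
| "alive l T (Suc i) = {v \<in> alive l T i. \<exists>c. v @ [c] \<in> alive l T i} - compressed l (alive l T i)"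

lemma up_append [simp]: "length z = k \<Longrightarrow> up k (v @ z) = v"
  by simp

lemma up_up [simp]: "up j (up k v) = up (j + k) v"
proof -
  have "length (up k v) - j = length v - (j + k)" by simp
  then show ?thesis by (simp add: min.absorb1 del: length_take)
qed

lemma alive_antimono: "i \<le> j \<Longrightarrow> alive l T j \<subseteq> alive l T i"
  by (induction j) (auto simp: le_Suc_eq)

lemma deepD: "u \<in> deep l X \<Longrightarrow> k \<le> l \<Longrightarrow> up k u \<in> chain X"
  by (auto simp: deep_def)

lemma deep_up_compressed:
  assumes "u \<in> deep l X" "k \<le> l"
  shows "up k u \<in> compressed l X"
proof -
  have "up k u @ drop (length u - k) u \<in> deep l X" using assms by simp
  moreover have "length (drop (length u - k) u) \<le> l" using assms by simp
  ultimately show ?thesis unfolding compressed_def by blast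
qed

lemma compressed_chain:
  assumes "v \<in> compressed l X"
  shows "v \<in> chain X"
proof -
  obtain z where z: "length z \<le> l" "v @ z \<in> deep l X" using assms by (auto simp: compressed_def)
  then have "up (length z) (v @ z) \<in> chain X" by (intro deepD)
  then show ?thesis by simp
qed

text \<open>Compression removes a vertex from all later phases, so the phase is determined by the
  vertex. In this way two nearby deep vertices on a vertical path are seen to belong to the same
  phase.\<close>

lemma compressed_index:
  assumes "v \<in> compressed l (alive l T i)" "v \<in> compressed l (alive l T j)"
  shows "i = j"
proof -
  have *: "\<not> i < j" if "v \<in> compressed l (alive l T i)" "v \<in> compressed l (alive l T j)" for i j
  proof
    assume "i < j"
    then have "alive l T j \<subseteq> alive l T (Suc i)" by (intro alive_antimono) auto
    moreover have "v \<in> alive l T j" using compressed_chain[OF that(2)] by (auto simp: chain_def)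
    ultimately show False using that(1) by auto
  qed
  show ?thesis using *[of i j] *[of j i] assms by auto
qed

lemma deep_index: "u \<in> deep l (alive l T i) \<Longrightarrow> u \<in> compressed l (alive l T j) \<Longrightarrow> i = j"
  using deep_up_compressed[of u l "alive l T i" 0] by (intro compressed_index[of u]) auto

lemma deep_child:
  assumes "v \<in> deep l X" "v @ [c] \<in> chain X"
  shows "v @ [c] \<in> deep l X"
proof -
  have "up k (v @ [c]) \<in> chain X" if "k \<le> l" for k
  proof (cases k)
    case (Suc j)
    then show ?thesis using deepD[of v l X j] assms that by simp
  qed (use assms in simp)
  then show ?thesis using assms(1) by (auto simp: deep_def)
qed

lemma up_Suc_child:
  assumes "k < length v"
  obtains c where "up k v = up (Suc k) v @ [c]"
proof
  show "up k v = up (Suc k) v @ [v ! (length v - Suc k)]"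
    using assms by (metis Suc_diff_Suc diff_less length_greater_0_conv less_nat_zero_code list.size(3)
      take_Suc_conv_app_nth zero_less_Suc)
qed

text \<open>All proper positions \<open>k < e\<close> lie within \<open>l\<close> above
  \<open>u\<close> and are chain vertices; a chain vertex whose parent is deep is deep, so depth
  passes down from \<open>up e u\<close>.\<close>

lemma deep_between:
  assumes "u \<in> deep l X" "up e u \<in> deep l X" "e \<le> Suc l" "k \<le> e"
  shows "up k u \<in> deep l X"
  using assms(4)
proof (induction k rule: inc_induct)
  case (step k)
  show ?case
  proof (cases "k < length u")
    case True
    then obtain c where c: "up k u = up (Suc k) u @ [c]" using up_Suc_child[of k u] by auto
    have "up k u \<in> chain X" using assms(1,3) step by (intro deepD) auto
    then show ?thesis using deep_child[OF step.IH, of c] c by simp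
  qed (use step.IH in simp)
qed (rule assms(2))

text \<open>If the subtree did not branch in phase \<open>i\<close>, following surviving children
  downwards would give \<open>l + 1\<close> consecutive chain vertices of that phase, and
  \<open>v\<close> would be compressed at once.\<close>

lemma alive_branching:
  assumes "v \<in> alive l T (i + Suc l)"
  shows "\<exists>z c c'. c \<noteq> c' \<and> v @ z @ [c] \<in> alive l T i \<and> v @ z @ [c'] \<in> alive l T i"
proof (rule ccontr)
  assume no: "\<not> ?thesis"
  \<comment> \<open>Each step down costs one phase: a vertex survives a phase only if it has a child
    among the vertices present before that phase.\<close>
  have "\<exists>z. length z = j \<and> v @ z \<in> alive l T (i + Suc l - j) \<and>
    (\<forall>k<j. v @ take k z \<in> chain (alive l T i))" if "j \<le> Suc l" for j
    using that
  proof (induction j)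
    case (Suc j)
    then obtain z where z: "length z = j" "v @ z \<in> alive l T (i + Suc l - j)"
      "\<forall>k<j. v @ take k z \<in> chain (alive l T i)" by auto
    have *: "i + Suc l - j = Suc (i + l - j)" using Suc.prems by simp
    then obtain c where c: "v @ z @ [c] \<in> alive l T (i + l - j)" using z(2) by auto
    have le: "i \<le> i + l - j" "i \<le> i + Suc l - j" using Suc.prems by simp_all
    have "v @ z \<in> alive l T i" "v @ z @ [c] \<in> alive l T i"
      using z(2) c alive_antimono[OF le(1), of l T] alive_antimono[OF le(2), of l T] by auto
    then have "v @ z \<in> chain (alive l T i)" using no by (auto simp: chain_def)
    then show ?case using z c * by (intro exI[of _ "z @ [c]"]) (auto simp: less_Suc_eq)
  qed (use assms in auto)
  from this[of "Suc l"] obtain z where z: "length z = Suc l" "\<forall>k<Suc l. v @ take k z \<in> chain (alive l T i)"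
    by auto
  have "up k (v @ take l z) = v @ take (l - k) z" if "k \<le> l" for k
    using that z(1) by (simp add: min_def)
  then have "v @ take l z \<in> deep l (alive l T i)" using z by (auto simp: deep_def)
  then have "v \<in> compressed l (alive l T i)" unfolding compressed_def
    by (intro CollectI exI[of _ "take l z"]) auto
  then have "v \<notin> alive l T (Suc i)" by simp
  then show False using assms alive_antimono[of "Suc i" "i + Suc l" l T] by auto
qed

text \<open>Every \<open>l + 1\<close> further phases guarantee a branching into two disjoint
  subtrees whose roots have survived all the earlier phases, so the size doubles. Hence
  logarithmically many phases remove everything.\<close>

lemma card_subtree_alive:
  assumes "finite T" "v \<in> alive l T (i * Suc l)"
  shows "2 ^ i \<le> card {z. v @ z \<in> T}"
  using assms(2)
proof (induction i arbitrary: v)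
  case 0
  have fin: "finite {z. v @ z \<in> T}" using assms(1) by (intro finite_vimageI[of T "(@) v", unfolded vimage_def]) (auto simp: inj_def)
  have "[] \<in> {z. v @ z \<in> T}" using 0 by simp
  then have "card {z. v @ z \<in> T} \<noteq> 0" using fin by (metis card_0_eq empty_iff)
  then show ?case by simp
next
  case (Suc i)
  have fin: "finite {z. w @ z \<in> T}" for w
    using assms(1) by (intro finite_vimageI[of T "(@) w", unfolded vimage_def]) (auto simp: inj_def)
  have "v \<in> alive l T (i * Suc l + Suc l)" using Suc.prems by (metis mult_Suc add.commute)
  then obtain z c c' where *: "c \<noteq> c'" "v @ z @ [c] \<in> alive l T (i * Suc l)" "v @ z @ [c'] \<in> alive l T (i * Suc l)"
    using alive_branching by blast
  let ?f = "\<lambda>c. (\<lambda>y. z @ c # y) ` {y. (v @ z @ [c]) @ y \<in> T}"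
  have "card (?f d) = card {y. (v @ z @ [d]) @ y \<in> T}" for d
    by (intro card_image) (auto simp: inj_on_def)
  then have "2 ^ i \<le> card (?f c)" "2 ^ i \<le> card (?f c')" using Suc.IH[OF *(2)] Suc.IH[OF *(3)] by auto
  moreover have "card (?f c \<union> ?f c') = card (?f c) + card (?f c')"
    using *(1) fin[of "v @ z @ [c]"] fin[of "v @ z @ [c']"]
    by (intro card_Un_disjoint finite_imageI) auto
  moreover have "card (?f c \<union> ?f c') \<le> card {z. v @ z \<in> T}" using fin by (intro card_mono) auto
  ultimately show ?case by simp
qed

lemma alive_empty:
  assumes "finite T" "card T < 2 ^ b"
  shows "alive l T (b * Suc l) = {}"
proof (rule ccontr)
  assume "alive l T (b * Suc l) \<noteq> {}"
  then obtain v where "v \<in> alive l T (b * Suc l)" by blast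
  then have "2 ^ b \<le> card {z. v @ z \<in> T}" by (rule card_subtree_alive[OF assms(1)])
  also have "\<dots> = card ((\<lambda>z. v @ z) ` {z. v @ z \<in> T})" by (rule card_image[symmetric]) (auto simp: inj_on_def)
  also have "\<dots> \<le> card T" using assms(1) by (intro card_mono) auto
  finally show False using assms(2) by simp
qed

section \<open>Splitters by bitwise elimination\<close>

definition near :: "nat \<Rightarrow> vertex \<Rightarrow> vertex \<Rightarrow> bool" where
  "near l u v \<longleftrightarrow> (\<exists>z. length z < l \<and> (v = u @ z \<or> u = v @ z))"

definition chain_top :: "nat \<Rightarrow> vertex set \<Rightarrow> vertex set" where
  "chain_top l X = {u \<in> deep l X. butlast u \<notin> deep l X}"

text \<open>The second condition puts at least \<open>l\<close> levels between a candidate and the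
  first deep vertex of its chain, which is a splitter anyway.\<close>

definition cand :: "nat \<Rightarrow> vertex set \<Rightarrow> vertex set" where
  "cand l X = {u \<in> deep l X. up l u \<in> deep l X}"

text \<open>
  In step \<open>j\<close> the candidates whose identifiers agree above bit \<open>j\<close> compete: one with bit \<open>1\<close> drops
  out if one with bit \<open>0\<close> is near. The first deep vertex of each chain is always a splitter, so that a
  path which enters a chain from above soon meets one, whereas the gaps further down may be logarithmic.
\<close>

primrec ruling :: "nat \<Rightarrow> vertex set \<Rightarrow> (vertex \<Rightarrow> nat) \<Rightarrow> nat \<Rightarrow> nat \<Rightarrow> vertex set" where
  "ruling l T ids m 0 = (\<Union>i<m. cand l (alive l T i))"
| "ruling l T ids m (Suc j) = {u \<in> ruling l T ids m j. even (ids u div 2 ^ j) \<or>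
     \<not> (\<exists>v\<in>ruling l T ids m j. near l u v \<and> ids v div 2 ^ Suc j = ids u div 2 ^ Suc j \<and> even (ids v div 2 ^ j))}"

definition splitters :: "nat \<Rightarrow> vertex set \<Rightarrow> (vertex \<Rightarrow> nat) \<Rightarrow> nat \<Rightarrow> nat \<Rightarrow> vertex set" where
  "splitters l T ids m b = (\<Union>i<m. chain_top l (alive l T i)) \<union> ruling l T ids m b"

lemma ruling_antimono: "i \<le> j \<Longrightarrow> ruling l T ids m j \<subseteq> ruling l T ids m i"
  by (induction j) (auto simp: le_Suc_eq)

lemma near_sym: "near l u v \<longleftrightarrow> near l v u"
  by (auto simp: near_def)

text \<open>Two near survivors that agree above bit \<open>j\<close> would differ in bit
  \<open>j\<close> itself, by the induction hypothesis, and then the one with bit 1 would have been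
  eliminated by the other. When no bits are left, no near pairs are left.\<close>

lemma ruling_separated_aux:
  assumes "inj_on ids T" "u \<in> ruling l T ids m j" "v \<in> ruling l T ids m j" "near l u v" "u \<noteq> v"
    "ruling l T ids m 0 \<subseteq> T"
  shows "ids u div 2 ^ j \<noteq> ids v div 2 ^ j"
  using assms(2-5)
proof (induction j arbitrary: u v)
  case 0
  then show ?case using assms(1,6) by (auto simp: inj_on_def)
next
  case (Suc j)
  then have uv: "u \<in> ruling l T ids m j" "v \<in> ruling l T ids m j" by auto
  have ne: "ids u div 2 ^ j \<noteq> ids v div 2 ^ j" using Suc.IH uv Suc.prems by blast
  show ?case
  proof
    assume eq: "ids u div 2 ^ Suc j = ids v div 2 ^ Suc j"
    then have "(ids u div 2 ^ j) div 2 = (ids v div 2 ^ j) div 2"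
      by (simp only: power_Suc mult.commute[of 2] div_mult2_eq)
    then have "even (ids u div 2 ^ j) \<noteq> even (ids v div 2 ^ j)"
      using ne by (metis even_iff_mod_2_eq_zero not_mod_2_eq_1_eq_0 div_mult_mod_eq)
    then show False using Suc.prems uv eq near_sym[of l u v] by auto
  qed
qed

lemma ruling_separated:
  assumes "inj_on ids T" "u \<in> ruling l T ids m b" "v \<in> ruling l T ids m b" "u \<noteq> v"
    "\<forall>v\<in>T. ids v < 2 ^ b"
  shows "\<not> near l u v"
proof
  assume n: "near l u v"
  have "alive l T i \<subseteq> T" for i using alive_antimono[of 0 i l T] by simp
  then have sub: "ruling l T ids m 0 \<subseteq> T"
    using deepD[of _ l _ 0] by (auto simp: cand_def chain_def)
  have "ids w div 2 ^ b = 0" if "w \<in> ruling l T ids m b" for w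
  proof -
    have "w \<in> T" using that ruling_antimono[of 0 b l T ids m] sub by blast
    then show ?thesis using assms(5) by simp
  qed
  then show False using ruling_separated_aux[OF assms(1-3) n assms(4) sub] assms by auto
qed

lemma splitter_deep: "u \<in> splitters l T ids m b \<Longrightarrow> \<exists>i<m. u \<in> deep l (alive l T i)"
  using ruling_antimono[of 0 b l T ids m] by (auto simp: splitters_def chain_top_def cand_def)

text \<open>The upper splitter is within reach of the deep lower one, so both belong to the same
  phase and everything between them is deep. The lower one is thus no chain top but a candidate. Its
  distance condition makes the parent of the upper one deep, so that is no chain top either, and two
  near members of the ruling set contradict \<open>ruling_separated\<close>.\<close>

lemma splitters_comparable:
  assumes "inj_on ids T" "\<forall>v\<in>T. ids v < 2 ^ b" "u \<in> splitters l T ids m b"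
    "u @ z \<in> splitters l T ids m b" "length z < l" "0 < l"
  shows "z = []"
proof (rule ccontr)
  assume z: "z \<noteq> []"
  let ?D = "\<lambda>i. deep l (alive l T i)"
  obtain i where i: "i < m" "u @ z \<in> ?D i" using splitter_deep assms by blast
  obtain j where j: "j < m" "u \<in> ?D j" using splitter_deep assms by blast
  have "up (length z) (u @ z) \<in> compressed l (alive l T i)" using i assms by (intro deep_up_compressed) auto
  then have ij: "j = i" using j deep_index by simp
  have z_up: "up (length z) (u @ z) = u" by simp
  have nottop: "u @ z \<notin> chain_top l (alive l T i')" for i'
  proof
    assume t: "u @ z \<in> chain_top l (alive l T i')"
    then have "i' = i" using i deep_index deep_up_compressed[of "u @ z" l "alive l T i" 0] by (auto simp: chain_top_def)
    moreover have "up 1 (u @ z) \<in> ?D i"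
      by (rule deep_between[of _ _ _ "length z"]) (use i j ij z assms in \<open>auto simp: Suc_le_eq\<close>)
    ultimately show False using t by (simp add: chain_top_def butlast_conv_take)
  qed
  then have "u @ z \<in> ruling l T ids m b" using assms(4) by (auto simp: splitters_def)
  then have "u @ z \<in> ruling l T ids m 0" using ruling_antimono[of 0 b] by blast
  then obtain i' where "i' < m" "u @ z \<in> cand l (alive l T i')" by auto
  moreover then have "i' = i" using i deep_index deep_up_compressed[of "u @ z" l "alive l T i" 0] by (auto simp: cand_def)
  ultimately have c: "up l (u @ z) \<in> ?D i" by (simp add: cand_def)
  have "up (Suc (length z)) (u @ z) \<in> ?D i"
    by (rule deep_between[of _ _ _ l]) (use i c assms in auto)
  then have "butlast u \<in> ?D i" by (simp add: butlast_conv_take)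
  have "u \<notin> chain_top l (alive l T i')" for i'
  proof
    assume t: "u \<in> chain_top l (alive l T i')"
    then have "i' = i" using j ij deep_index deep_up_compressed[of u l "alive l T i" 0] by (auto simp: chain_top_def)
    then show False using t \<open>butlast u \<in> ?D i\<close> by (simp add: chain_top_def)
  qed
  then have "u \<in> ruling l T ids m b" using assms(3) by (auto simp: splitters_def)
  moreover have "near l u (u @ z)" using assms(5) by (auto simp: near_def)
  ultimately show False using ruling_separated[OF assms(1) _ _ _ assms(2)] \<open>u @ z \<in> ruling l T ids m b\<close> z
    by blast
qed

text \<open>Take the splitter of the earlier phase. The branching vertex \<open>w\<close> lies on
  its chain and so has only one child remaining in that phase, whereas the child towards the other
  splitter remains then as well.\<close>

lemma splitters_incomparable:
  assumes "w @ c # z \<in> splitters l T ids m b" "w @ c' # z' \<in> splitters l T ids m b'"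
    "length z < l" "length z' < l"
  shows "c = c'"
proof -
  have *: "c = c'" if "i \<le> j" "w @ c # z \<in> deep l (alive l T i)" "w @ c' # z' \<in> deep l (alive l T j)"
      "length z < l" "length z' < l" for i j c c' z z'
  proof -
    have "up (Suc (length z)) (w @ c # z) \<in> chain (alive l T i)" using that by (intro deepD) auto
    moreover have "up (length z) (w @ c # z) \<in> chain (alive l T i)" using that by (intro deepD) auto
    moreover have "up (length z') (w @ c' # z') \<in> chain (alive l T j)" using that by (intro deepD) auto
    ultimately have "w \<in> chain (alive l T i)" "w @ [c] \<in> alive l T i" "w @ [c'] \<in> alive l T j"
      by (auto simp: chain_def)
    then show ?thesis using alive_antimono[OF that(1), of l T] by (auto simp: chain_def)
  qed
  obtain i j where "w @ c # z \<in> deep l (alive l T i)" "w @ c' # z' \<in> deep l (alive l T j)"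
    using splitter_deep assms by blast
  then show ?thesis using *[of i j c z c' z'] *[of j i c' z' c z] assms by (cases "i \<le> j") auto
qed


text \<open>A chain vertex has exactly one remaining child, so the descent to a deep vertex cannot
  leave the path. This keeps a competitor from below on the vertical path under
  consideration.\<close>

lemma unique_descent:
  assumes "u = up k w" "u @ z \<in> deep l (alive l T i')" "length z \<le> l" "length z \<le> k" "k \<le> length w"
    "\<forall>k'\<le>k. up k' w \<in> deep l (alive l T i)"
  shows "u @ z = up (k - length z) w"
proof -
  let ?e = "length z"
  have "u \<in> compressed l (alive l T i')"
    unfolding compressed_def using assms(2,3) by blast
  then have i': "i' = i" using assms(1,6) deep_index by blast
  have "u @ take f z = up (k - f) w" if "f \<le> ?e" for f
    using that
  proof (induction f)
    case (Suc f)
    then have IH: "u @ take f z = up (k - f) w" by simp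
    have f: "k - f = Suc (k - Suc f)" "f < ?e" using Suc.prems assms(4) by auto
    have "k - Suc f < length w" using f assms(4,5) by linarith
    then obtain c where "up (k - Suc f) w = up (Suc (k - Suc f)) w @ [c]" by (rule up_Suc_child)
    then have c: "up (k - Suc f) w = up (k - f) w @ [c]" unfolding f(1) .
    have t: "take (Suc f) z = take f z @ [z ! f]" using f by (simp add: take_Suc_conv_app_nth)
    have "up (?e - Suc f) (u @ z) \<in> chain (alive l T i')" using assms(2,3) by (intro deepD) auto
    moreover have "up (?e - Suc f) (u @ z) = u @ take (Suc f) z" using f by simp
    ultimately have 1: "u @ take f z @ [z ! f] \<in> alive l T i" using i' t by (simp add: chain_def)
    have "up (k - Suc f) w \<in> chain (alive l T i)" using assms(6) deepD[of _ l _ 0] by fastforce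
    then have 2: "up (k - f) w @ [c] \<in> alive l T i" using c by (simp add: chain_def)
    have "up (k - f) w \<in> chain (alive l T i)" using assms(6) deepD[of _ l _ 0] by fastforce
    then have "c = z ! f" using 1 2 IH by (auto simp: chain_def simp flip: append_assoc)
    then show ?case using t c IH by (simp flip: append_assoc)
  qed (use assms in simp)
  from this[of ?e] show ?thesis by simp
qed

text \<open>Start with the vertex in the middle, at height \<open>l * b\<close>. In each of the
  \<open>b\<close> rounds the current vertex stays in or yields to a winner less than
  \<open>l\<close> away on the same path, so the drift is at most \<open>l * b\<close> either way.
  The additional \<open>l\<close> lets the starting vertex satisfy the condition of
  \<open>cand\<close>.\<close>

lemma deep_run_splitter:
  assumes deep: "\<forall>k<q. up k w \<in> deep l (alive l T i)" and "q > 2 * l * b + l" "0 < l" "i < m"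
  shows "\<exists>k<q. up k w \<in> splitters l T ids m b"
proof -
  let ?mid = "l * b"
  have lenw: "k \<le> length w" if "k < q" for k
  proof -
    have "q - 1 < q" using assms(2) by simp
    then have "up (q - 1) w \<in> deep l (alive l T i)" using deep by blast
    then have "l \<le> length (up (q - 1) w)" by (simp only: deep_def mem_Collect_eq)
    then show ?thesis using that assms(3) by simp
  qed
  have "\<exists>k. ?mid - l * j \<le> k \<and> k \<le> ?mid + l * j \<and> up k w \<in> ruling l T ids m j" if "j \<le> b" for j
    using that
  proof (induction j)
    case 0
    have "up ?mid w \<in> deep l (alive l T i)" using deep assms by simp
    moreover have "up l (up ?mid w) \<in> deep l (alive l T i)" using deep assms by (simp add: add.commute)
    ultimately have "up ?mid w \<in> cand l (alive l T i)" unfolding cand_def by blast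
    then show ?case using assms(4) by (intro exI[of _ ?mid]) auto
  next
    case (Suc j)
    then obtain k where k: "?mid - l * j \<le> k" "k \<le> ?mid + l * j" "up k w \<in> ruling l T ids m j" by auto
    have lj: "l * Suc j \<le> l * b" using Suc.prems by (intro mult_le_mono) auto
    have kq: "k < q" using k lj assms(2) by (simp add: algebra_simps)
    show ?case
    proof (cases "up k w \<in> ruling l T ids m (Suc j)")
      case True
      then show ?thesis using k(1,2) by (intro exI[of _ k]) (auto simp: algebra_simps)
    next
      case False
      then obtain u' where u': "u' \<in> ruling l T ids m j" "near l (up k w) u'" "even (ids u' div 2 ^ j)"
        using k(3) by auto
      then have R: "u' \<in> ruling l T ids m (Suc j)" by simp
      from u'(2) obtain z where z: "length z < l" "u' = up k w @ z \<or> up k w = u' @ z"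
        by (auto simp: near_def)
      from z(2) show ?thesis
      proof
        assume *: "up k w = u' @ z"
        then have "u' = up (length z) (up k w)" by simp
        then have "u' = up (length z + k) w" by (simp only: up_up)
        then show ?thesis using R k z(1) by (intro exI[of _ "length z + k"]) (auto simp: algebra_simps)
      next
        assume *: "u' = up k w @ z"
        have "u' \<in> ruling l T ids m 0" using u'(1) ruling_antimono[of 0 j] by blast
        then obtain i' where i': "u' \<in> deep l (alive l T i')" by (auto simp: cand_def)
        have zk: "length z \<le> k" using k(1) lj z(1) by simp
        have "up k w @ z = up (k - length z) w"
          by (rule unique_descent[where l = l and T = T and i' = i' and i = i])
            (use * i' z zk lenw[OF kq] deep kq in auto)
        then show ?thesis using R k z(1) * zk by (intro exI[of _ "k - length z"]) (auto simp: algebra_simps)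
      qed
    qed
  qed
  from this[of b] obtain k where "k \<le> ?mid + l * b" "up k w \<in> ruling l T ids m b" by auto
  then show ?thesis using assms(2) by (intro exI[of _ k]) (auto simp: splitters_def)
qed

text \<open>
  On a vertical path without deep vertices the phase of removal cannot decrease upwards, and as
  \<open>l + 1\<close> consecutive chain vertices include a deep one, it increases every \<open>l + 1\<close> steps.
\<close>

lemma non_deep_mono:
  assumes "up k v \<in> alive l T i" "Suc k \<le> length v" "\<forall>j. up (Suc k) v \<notin> deep l (alive l T j)"
    "up (Suc k) v \<in> T"
  shows "up (Suc k) v \<in> alive l T i"
proof (rule ccontr)
  let ?p = "up (Suc k) v"
  assume no: "?p \<notin> alive l T i"
  obtain c where c: "up k v = ?p @ [c]" using up_Suc_child[of k v] assms(2) by auto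
  have "\<exists>r<i. ?p \<in> alive l T r \<and> ?p \<notin> alive l T (Suc r)"
    using no assms(4)
  proof (induction i)
    case (Suc i)
    then show ?case by (cases "?p \<in> alive l T i") (auto simp: less_Suc_eq simp del: alive.simps(2))
  qed simp
  then obtain r where r: "r < i" "?p \<in> alive l T r" "?p \<notin> alive l T (Suc r)" by blast
  have ch: "?p @ [c] \<in> alive l T (Suc r)" "?p @ [c] \<in> alive l T r"
    using assms(1) r(1) alive_antimono[of "Suc r" i l T] alive_antimono[of r i l T] c
    by (auto simp del: alive.simps)
  \<comment> \<open>The parent leaves while its child stays, so it was not raked but compressed. Not
    being deep, it owes this to a deep vertex strictly below, which must lie below its only
    remaining child; but then that child is compressed in the same phase.\<close>
  have comp: "?p \<in> compressed l (alive l T r)" using r ch(2) by (auto simp del: take_append)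
  then obtain z where z: "length z \<le> l" "?p @ z \<in> deep l (alive l T r)" by (auto simp: compressed_def)
  obtain c' z' where z': "z = c' # z'" using z(2) assms(3) by (cases z) auto
  have "up (length z') (?p @ z) \<in> chain (alive l T r)" using z z' by (intro deepD) auto
  moreover have "up (length z') (?p @ z) = ?p @ [c']" using z' by simp
  ultimately have "?p @ [c'] \<in> alive l T r" by (simp add: chain_def)
  then have "c' = c" using compressed_chain[OF comp] ch(2) by (auto simp: chain_def)
  then have "(?p @ [c]) @ z' \<in> deep l (alive l T r)" "length z' \<le> l" using z z' by auto
  then have "?p @ [c] \<in> compressed l (alive l T r)" unfolding compressed_def by blast
  then show False using ch(1) by simp
qed

text \<open>If one of the first \<open>m * Suc l + 1\<close> vertices is deep, then going up either
  reaches the chain top or stays among deep vertices long enough for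
  \<open>deep_run_splitter\<close>. If none is deep, the phase of removal grows beyond
  \<open>m\<close>, although nothing is left by then.\<close>

lemma splitter_on_path:
  assumes T: "\<And>k. up k v \<in> T" and em: "alive l T m = {}" and "0 < l"
    and len: "m * Suc l + 2 * l * b + l + 2 \<le> length v"
  shows "\<exists>k < m * Suc l + 2 * l * b + l + 2. up k v \<in> splitters l T ids m b"
proof (rule ccontr)
  let ?L = "m * Suc l + 2 * l * b + l + 2" and ?D = "\<lambda>i. deep l (alive l T i)"
  assume no: "\<not> ?thesis"
  have i_m: "i < m" if "u \<in> ?D i" for u i
  proof (rule ccontr)
    assume "\<not> i < m"
    then have "alive l T i = {}" using alive_antimono[of m i l T] em by auto
    then show False using deepD[OF that, of 0] by (simp add: chain_def)
  qed
  show False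
  proof (cases "\<exists>k0 < m * Suc l + 1. \<exists>i. up k0 v \<in> ?D i")
    case True
    then obtain k0 i where k0: "k0 < m * Suc l + 1" "up k0 v \<in> ?D i" by blast
    have "up (k + k0) v \<in> ?D i" if "k + k0 < ?L" for k
      using that
    proof (induction k)
      case (Suc k)
      then have d: "up (k + k0) v \<in> ?D i" by simp
      have "up (k + k0) v \<notin> splitters l T ids m b" using no Suc.prems by auto
      then have "up (k + k0) v \<notin> chain_top l (alive l T i)" using i_m[OF d] by (auto simp: splitters_def)
      moreover have "butlast (up (k + k0) v) = up (Suc k + k0) v"
        using up_up[of v "k + k0" "Suc 0"] by (simp add: butlast_conv_take)
      ultimately show ?case using d by (simp add: chain_top_def)
    qed (use k0 in simp)
    then have "\<forall>k<?L - k0. up k (up k0 v) \<in> ?D i" by (simp only: up_up) simp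
    then have "\<exists>k<?L - k0. up k (up k0 v) \<in> splitters l T ids m b"
      using k0 assms(3) i_m by (intro deep_run_splitter) auto
    then obtain k where "k < ?L - k0" "up (k + k0) v \<in> splitters l T ids m b" by (auto simp only: up_up)
    then show False using no k0 by (auto dest!: spec[of _ "k + k0"])
  next
    case False
    then have nd: "up k v \<notin> ?D i" if "k \<le> m * Suc l" for k i using that by auto
    have mono: "up (k + j) v \<in> alive l T i" if "up k v \<in> alive l T i" "k + j \<le> m * Suc l" for k j i
      using that(2)
    proof (induction j)
      case (Suc j)
      then show ?case using non_deep_mono[where k = "k + j" and v = v and l = l and T = T and i = i] nd T len by auto
    qed (use that in simp)
    have "up (j * Suc l) v \<in> alive l T j" if "j \<le> m" for j
      using that
    proof (induction j)
      case 0
      then show ?case using T[of 0] by simp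
    next
      case (Suc j)
      let ?k = "j * Suc l"
      have le: "?k + Suc l \<le> m * Suc l" using mult_le_mono1[OF Suc.prems, of "Suc l"] by simp
      have al: "up ?k v \<in> alive l T j" using Suc by simp
      show ?case
      proof (rule ccontr)
        assume no: "\<not> ?case"
        \<comment> \<open>If the phase fails to grow, all these \<open>l + 1\<close> vertices
          disappear in phase \<open>j\<close> while each still has a child on the path. They were
          therefore compressed, hence are chain vertices, and the lowest of them is deep.\<close>
        have comp: "up (?k + Suc j') v \<in> chain (alive l T j)" if "j' \<le> l" for j'
        proof -
          have kl: "?k + Suc j' \<le> m * Suc l" using that le by simp
          have "up (?k + Suc j') v \<notin> alive l T (Suc j)"
          proof
            assume "up (?k + Suc j') v \<in> alive l T (Suc j)"
            moreover have e: "?k + Suc j' + (l - j') = Suc j * Suc l" using that by simp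
            ultimately have "up (Suc j * Suc l) v \<in> alive l T (Suc j)"
              using mono[of "?k + Suc j'" "Suc j" "l - j'"] mult_le_mono1[OF Suc.prems, of "Suc l"]
              by (simp only: e)
            then show False using no by blast
          qed
          moreover have "up (?k + Suc j') v \<in> alive l T j" using mono[OF al kl] .
          moreover have "up (?k + j') v \<in> alive l T j" using mono[OF al, of j'] kl by simp
          moreover obtain c where "up (?k + j') v = up (?k + Suc j') v @ [c]"
            using up_Suc_child[of "?k + j'" v] kl len by auto
          ultimately have "up (?k + Suc j') v \<in> compressed l (alive l T j)" by auto
          then show ?thesis by (rule compressed_chain)
        qed
        have "up k (up (?k + 1) v) \<in> chain (alive l T j)" if "k \<le> l" for k
          unfolding up_up using comp[OF that] by (simp add: add.commute)
        moreover have "l \<le> length (up (?k + 1) v)" using le len by simp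
        ultimately have "up (?k + 1) v \<in> ?D j" by (simp add: deep_def)
        then show False using nd[of "?k + 1" j] le by simp
      qed
    qed
    from this[of m] show False using em by simp
  qed
qed

section \<open>The logarithmic algorithm\<close>

lemma relpow_closed_mult: "(x, x) \<in> E ^^ j \<Longrightarrow> (x, x) \<in> E ^^ (n * j)"
proof (induction n)
  case (Suc n)
  then show ?case by (auto simp: relpow_add)
qed simp

text \<open>The coin problem for \<open>k\<close> and \<open>k + 1\<close>: if
  \<open>m = q * k + r\<close> with \<open>r < k\<close> and \<open>k\<close> at most
  \<open>q\<close>, then \<open>m = (q - r) * k + r * (k + 1)\<close>.\<close>

lemma relpow_closed_large:
  assumes "(x, x) \<in> E ^^ k" "(x, x) \<in> E ^^ Suc k" "k * k \<le> m"
  shows "(x, x) \<in> E ^^ m"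
proof (cases "k = 0")
  case True
  then show ?thesis using relpow_closed_mult[OF assms(2), of m] by simp
next
  case False
  define q r where "q = m div k" and "r = m mod k"
  have m: "m = q * k + r" by (simp add: q_def r_def)
  have "r < k" "k \<le> q" using False assms(3) by (auto simp: q_def r_def less_eq_div_iff_mult_less_eq)
  then have m': "m = (q - r) * k + r * Suc k" by (simp add: m algebra_simps)
  show ?thesis unfolding m' relpow_add[of "(q - r) * k"]
    by (rule relcompI[OF relpow_closed_mult[OF assms(1)] relpow_closed_mult[OF assms(2)]])
qed

definition inner_edges :: "lcl \<Rightarrow> nat set \<Rightarrow> (nat \<times> nat) set" where
  "inner_edges \<P> S = config_edges {(a, bs) \<in> configs \<P>. a \<in> S \<and> set bs \<subseteq> S}"

text \<open>A label with the fewest reachable labels lies in a sink component: whatever it reaches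
  has the same reachable set and so leads back. Flexibility of \<open>a0\<close> then evens out the
  different lengths of these return walks.\<close>

lemma robust_sink:
  assumes "is_lcl \<P>" "robust \<P>"
  obtains S a0 K where "0 < K" "a0 \<in> S" "S \<subseteq> labels \<P>" "\<forall>a\<in>S. \<exists>bs. (a, bs) \<in> configs \<P> \<and> set bs \<subseteq> S"
    "\<forall>a\<in>S. (a, a0) \<in> inner_edges \<P> S ^^ K"
proof -
  obtain C where C: "C \<subseteq> configs \<P>" "C \<noteq> {}" "C \<subseteq> prune C" using assms(2) by (auto simp: robust_def)
  let ?E = "config_edges C"
  define V where "V = {x. flexible ?E x \<and> x \<in> labels \<P>}"
  have EV: "(a, b) \<in> ?E \<Longrightarrow> b \<in> V" for a b
    using C assms(1) unfolding V_def is_lcl_def prune_def config_edges_def by blast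
  have "\<exists>a. a \<in> V"
  proof -
    obtain a bs where "(a, bs) \<in> C" using C(2) by auto
    then have "flexible ?E a" "a \<in> labels \<P>"
      using C(1,3) assms(1) by (auto simp: prune_def is_lcl_def)
    then show ?thesis by (auto simp: V_def)
  qed
  then obtain a0 where a0: "a0 \<in> V" "\<And>y. y \<in> V \<Longrightarrow> card (?E\<^sup>* `` {a0}) \<le> card (?E\<^sup>* `` {y})"
    using ex_has_least_nat[of "\<lambda>a. a \<in> V" _ "\<lambda>a. card (?E\<^sup>* `` {a})"] by auto
  let ?S = "?E\<^sup>* `` {a0}"
  have SV: "?S \<subseteq> V"
  proof
    fix x assume "x \<in> ?S"
    then have "(a0, x) \<in> ?E\<^sup>*" by simp
    then show "x \<in> V" by (induction rule: rtrancl_induct) (rule a0(1), rule EV)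
  qed
  have finV: "finite V" using assms(1) unfolding V_def is_lcl_def by auto
  have return: "(y, a0) \<in> ?E\<^sup>*" if "y \<in> ?S" for y
  proof -
    have "?E\<^sup>* `` {y} \<subseteq> ?S" using that by auto
    moreover have "card ?S \<le> card (?E\<^sup>* `` {y})" using that SV a0(2) by blast
    ultimately have "?E\<^sup>* `` {y} = ?S" using finV SV by (meson card_seteq finite_subset)
    then show ?thesis by blast
  qed
  have out: "\<exists>bs. (a, bs) \<in> configs \<P> \<and> set bs \<subseteq> ?S" if "a \<in> ?S" for a
  proof -
    have "flexible ?E a" using that SV by (auto simp: V_def)
    then obtain k where "(a, a) \<in> ?E ^^ Suc k" by (auto simp: flexible_def)
    then obtain b where "(a, b) \<in> ?E" by (meson relpow_Suc_D2)
    then obtain bs where bs: "(a, bs) \<in> C" by (auto simp: config_edges_def)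
    have "set bs \<subseteq> ?S"
    proof
      fix x assume "x \<in> set bs"
      then have "(a, x) \<in> ?E" using bs by (auto simp: config_edges_def)
      then show "x \<in> ?S" using that by (auto intro: rtrancl.rtrancl_into_rtrancl)
    qed
    then show ?thesis using bs C(1) by blast
  qed
  have edge: "(a, b) \<in> inner_edges \<P> ?S \<and> b \<in> ?S" if ab: "a \<in> ?S" "(a, b) \<in> ?E" for a b
  proof -
    obtain bs where bs: "(a, bs) \<in> C" "b \<in> set bs" using ab by (auto simp: config_edges_def)
    have "x \<in> ?S" if "x \<in> set bs" for x
    proof -
      have "(a, x) \<in> ?E" using bs that by (auto simp: config_edges_def)
      then show "x \<in> ?S" using ab(1) by (auto intro: rtrancl.rtrancl_into_rtrancl)
    qed
    then have "set bs \<subseteq> ?S" by blast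
    then show ?thesis using bs ab C(1) unfolding inner_edges_def config_edges_def by blast
  qed
  have walk: "(a, b) \<in> inner_edges \<P> ?S ^^ k \<and> b \<in> ?S" if "(a, b) \<in> ?E ^^ k" "a \<in> ?S" for a b k
    using that(1)
  proof (induction k arbitrary: b)
    case (Suc k)
    then obtain c where "(a, c) \<in> ?E ^^ k" "(c, b) \<in> ?E" by auto
    then show ?case using Suc.IH[of c] edge[of c b] by auto
  qed (use that in auto)
  obtain k where k: "(a0, a0) \<in> ?E ^^ k" "(a0, a0) \<in> ?E ^^ Suc k" using a0(1) by (auto simp: V_def flexible_def)
  have "\<forall>a\<in>?S. \<exists>p. (a, a0) \<in> ?E ^^ p" using return by (auto simp: rtrancl_power)
  then obtain p where p: "\<And>a. a \<in> ?S \<Longrightarrow> (a, a0) \<in> ?E ^^ p a" by metis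
  have finS: "finite ?S" using finV SV finite_subset by blast
  \<comment> \<open>After the walk from \<open>a\<close> to \<open>a0\<close> at least
    \<open>k * k\<close> steps remain, enough for a closed walk of the exact missing length; the
    \<open>1\<close> makes \<open>K\<close> positive.\<close>
  define K where "K = Max (p ` ?S) + k * k + 1"
  have "(a, a0) \<in> inner_edges \<P> ?S ^^ K" if "a \<in> ?S" for a
  proof -
    have "p a \<le> Max (p ` ?S)" using that finS by (intro Max_ge) auto
    then have "k * k \<le> K - p a" "p a \<le> K" by (auto simp: K_def)
    then have "(a0, a0) \<in> ?E ^^ (K - p a)" "p a + (K - p a) = K" using relpow_closed_large[OF k] by auto
    then have "(a, a0) \<in> ?E ^^ K" using relcompI[OF p[OF that]] relpow_add[of "p a" "K - p a" ?E] by metis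
    then show ?thesis using walk that by blast
  qed
  moreover have "?S \<subseteq> labels \<P>" using SV by (auto simp: V_def)
  moreover have "0 < K" by (simp add: K_def)
  moreover have "a0 \<in> ?S" by simp
  ultimately show ?thesis using out by (intro that[of K a0 ?S] ballI) blast+
qed

text \<open>A target \<open>Some (c, k)\<close> announces a splitter \<open>k\<close> levels down
  through child \<open>c\<close>; the label of that child must be able to reach \<open>a0\<close> in
  the remaining \<open>k - 1\<close> steps.\<close>

definition good_children :: "lcl \<Rightarrow> nat set \<Rightarrow> nat \<Rightarrow> nat \<Rightarrow> (nat \<times> nat) option \<Rightarrow> nat list \<Rightarrow> bool" where
  "good_children \<P> S a0 a t ls \<longleftrightarrow> length ls = arity \<P> \<and> set ls \<subseteq> S \<and>
     (\<exists>\<rho>. \<rho> permutes {..<arity \<P>} \<and> (a, map (\<lambda>i. ls ! \<rho> i) [0..<arity \<P>]) \<in> configs \<P>) \<and>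
     (\<forall>c k. t = Some (c, k) \<longrightarrow> (ls ! c, a0) \<in> inner_edges \<P> S ^^ (k - 1))"

lemma good_children_exists:
  assumes "is_lcl \<P>" "a \<in> S" "\<And>a. a \<in> S \<Longrightarrow> \<exists>bs. (a, bs) \<in> configs \<P> \<and> set bs \<subseteq> S"
    "\<And>c k. t = Some (c, k) \<Longrightarrow> c < arity \<P> \<and> 0 < k \<and> (a, a0) \<in> inner_edges \<P> S ^^ k"
  shows "\<exists>ls. good_children \<P> S a0 a t ls"
proof (cases t)
  case None
  obtain bs where bs: "(a, bs) \<in> configs \<P>" "set bs \<subseteq> S" using assms by blast
  then have "length bs = arity \<P>" using assms(1) by (auto simp: is_lcl_def)
  then have "map (\<lambda>i. bs ! id i) [0..<arity \<P>] = bs" by (auto intro: nth_equalityI)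
  then show ?thesis using bs None \<open>length bs = arity \<P>\<close> permutes_id[of "{..<arity \<P>}"]
    unfolding good_children_def by (metis option.discI)
next
  case (Some ck)
  obtain c k where ck: "t = Some (c, k)" using Some by (cases ck) auto
  then have c: "c < arity \<P>" "0 < k" "(a, a0) \<in> inner_edges \<P> S ^^ Suc (k - 1)" using assms(4) by auto
  from relpow_Suc_D2[OF c(3)] obtain b where b: "(a, b) \<in> inner_edges \<P> S" "(b, a0) \<in> inner_edges \<P> S ^^ (k - 1)"
    by blast
  then obtain bs where bs: "(a, bs) \<in> configs \<P>" "set bs \<subseteq> S" "b \<in> set bs"
    by (auto simp: inner_edges_def config_edges_def)
  have len: "length bs = arity \<P>" using bs assms(1) by (auto simp: is_lcl_def)
  obtain q where q: "q < arity \<P>" "bs ! q = b" using bs(3) len by (auto simp: in_set_conv_nth)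
  \<comment> \<open>The order of children in a configuration is free, so the label that continues
    the walk is swapped to port \<open>c\<close>.\<close>
  let ?\<rho> = "transpose c q"
  let ?ls = "map (\<lambda>i. bs ! ?\<rho> i) [0..<arity \<P>]"
  have perm: "?\<rho> permutes {..<arity \<P>}" using c q by (intro permutes_swap_id) auto
  have lt: "?\<rho> i < arity \<P>" if "i < arity \<P>" for i using c q that by (auto simp: transpose_def)
  have "map (\<lambda>i. ?ls ! ?\<rho> i) [0..<arity \<P>] = bs"
    using len lt by (auto intro!: nth_equalityI)
  moreover have "set ?ls \<subseteq> S" using bs(2) len lt by (auto simp: subset_iff)
  moreover have "?ls ! c = b" using c q by simp
  ultimately have "good_children \<P> S a0 a t ?ls"
    unfolding good_children_def using perm bs(1) b(2) ck by auto
  then show ?thesis by blast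
qed

text \<open>The choice is harmless where it is used: the separation of splitters leaves at most one
  within distance \<open>K\<close> below a vertex.\<close>

definition target :: "nat \<Rightarrow> vertex set \<Rightarrow> vertex \<Rightarrow> (nat \<times> nat) option" where
  "target K B w = (let Z = {z. z \<noteq> [] \<and> length z \<le> K \<and> w @ z \<in> B} in
     if Z = {} then None else Some (hd (SOME z. z \<in> Z), length (SOME z. z \<in> Z)))"

text \<open>The counter makes the dependence local. Its base value is arbitrary: with a sufficient
  counter the recursion meets a splitter or the root before running out, and then the result no
  longer depends on the counter.\<close>

primrec propagate :: "(nat \<Rightarrow> (nat \<times> nat) option \<Rightarrow> nat list) \<Rightarrow> nat \<Rightarrow> nat \<Rightarrow> vertex set \<Rightarrow> nat \<Rightarrow> vertex \<Rightarrow> nat" where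
  "propagate f a0 K B 0 v = a0"
| "propagate f a0 K B (Suc r) v = (if v = [] \<or> v \<in> B then a0
     else f (propagate f a0 K B r (butlast v)) (target K B (butlast v)) ! last v)"

lemma propagate_stable:
  assumes "length v \<le> k \<or> up k v \<in> B" "k < r" "k < s"
  shows "propagate f a0 K B r v = propagate f a0 K B s v"
  using assms
proof (induction k arbitrary: v r s)
  case 0
  then show ?case by (cases r; cases s) auto
next
  case (Suc k)
  obtain r' s' where rs: "r = Suc r'" "s = Suc s'" using Suc.prems by (cases r; cases s) auto
  have "length (butlast v) \<le> k \<or> up k (butlast v) \<in> B"
  proof -
    have "up k (butlast v) = up (k + 1) v" unfolding butlast_conv_take by (rule up_up)
    then show ?thesis using Suc.prems(1) by auto
  qed
  then have "propagate f a0 K B r' (butlast v) = propagate f a0 K B s' (butlast v)"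
    using Suc.prems rs by (intro Suc.IH) auto
  then show ?case using rs by simp
qed

text \<open>Labels are fixed top down. A splitter matters only once it comes within distance
  \<open>K\<close>, at which point every label of \<open>S\<close> has a walk of exactly that length
  to \<open>a0\<close>; from there on the walk is followed step by step. The root is free to be
  \<open>a0\<close>, as no splitter is closer to it than \<open>K\<close>.\<close>

lemma propagate_solution:
  assumes lcl: "is_lcl \<P>" and T: "full_tree (arity \<P>) T" and K: "0 < K"
    and S: "a0 \<in> S" "S \<subseteq> labels \<P>" "\<And>a. a \<in> S \<Longrightarrow> \<exists>bs. (a, bs) \<in> configs \<P> \<and> set bs \<subseteq> S"
      "\<And>a. a \<in> S \<Longrightarrow> (a, a0) \<in> inner_edges \<P> S ^^ K"
    and f: "\<And>a t. \<exists>ls. good_children \<P> S a0 a t ls \<Longrightarrow> good_children \<P> S a0 a t (f a t)"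
    and B: "B \<subseteq> T" "\<And>u. u \<in> B \<Longrightarrow> K \<le> length u"
      "\<And>u z. u \<in> B \<Longrightarrow> u @ z \<in> B \<Longrightarrow> length z \<le> K \<Longrightarrow> z = []"
      "\<And>w c z c' z'. w @ c # z \<in> B \<Longrightarrow> w @ c' # z' \<in> B \<Longrightarrow> length z \<le> K \<Longrightarrow> length z' \<le> K \<Longrightarrow> c = c'"
      "\<And>v. v \<in> T \<Longrightarrow> \<Lambda> \<le> length v \<Longrightarrow> \<exists>k<\<Lambda>. up k v \<in> B"
  shows "is_solution \<P> T (propagate f a0 K B (Suc \<Lambda>))"
proof -
  define L where "L = propagate f a0 K B (Suc \<Lambda>)"
  let ?E = "inner_edges \<P> S"
  have stable: "propagate f a0 K B \<Lambda> v = L v" if "v \<in> T" "0 < \<Lambda>" for v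
  proof -
    have "\<exists>k<\<Lambda>. length v \<le> k \<or> up k v \<in> B"
    proof (cases "\<Lambda> \<le> length v")
      case False
      then show ?thesis by (intro exI[of _ "length v"]) simp
    qed (use B(5)[OF that(1)] in blast)
    then obtain k where "length v \<le> k \<or> up k v \<in> B" "k < \<Lambda>" by blast
    then show ?thesis unfolding L_def by (intro propagate_stable[of _ k]) auto
  qed
  have L_rec: "L (w @ [c]) = f (L w) (target K B w) ! c" if "w @ [c] \<in> T" "w @ [c] \<notin> B" for w c
  proof -
    have "w \<in> T" using that T full_tree_prefix_closed by blast
    moreover have "0 < \<Lambda>" using B(5)[OF that(1)] by (cases \<Lambda>) auto
    ultimately show ?thesis using stable[of w] that by (simp add: L_def)
  qed
  have L_B: "L v = a0" if "v \<in> B \<or> v = []" for v using that by (auto simp: L_def)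
  have uniq: "z = z'" if "w @ z \<in> B" "w @ z' \<in> B" "length z \<le> K" "length z' \<le> K" for w z z'
  proof -
    consider "prefix z z'" | "prefix z' z" | "z \<parallel> z'" by blast
    then show ?thesis
    proof cases
      case 1
      then obtain y where "z' = z @ y" by (auto elim: prefixE)
      then show ?thesis using B(3)[of "w @ z" y] that by simp
    next
      case 2
      then obtain y where "z = z' @ y" by (auto elim: prefixE)
      then show ?thesis using B(3)[of "w @ z'" y] that by simp
    next
      case 3
      then obtain as b bs c cs where "b \<noteq> c" "z = as @ b # bs" "z' = as @ c # cs"
        using parallel_decomp by blast
      then show ?thesis using B(4)[of "w @ as" b bs c cs] that by simp
    qed
  qed
  have target_eq: "target K B w = Some (hd z, length z)" if "w @ z \<in> B" "length z \<le> K" "z \<noteq> []" for w z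
  proof -
    have "{z. z \<noteq> [] \<and> length z \<le> K \<and> w @ z \<in> B} = {z}" using uniq that by blast
    then show ?thesis by (simp add: target_def)
  qed
  have target_Some: "\<exists>z. w @ z \<in> B \<and> length z \<le> K \<and> z \<noteq> [] \<and> c = hd z \<and> k = length z"
    if "target K B w = Some (c, k)" for w c k
  proof -
    let ?Z = "{z. z \<noteq> [] \<and> length z \<le> K \<and> w @ z \<in> B}"
    have "?Z \<noteq> {}" using that by (auto simp: target_def Let_def split: if_splits)
    then obtain z where "z \<in> ?Z" by blast
    then show ?thesis using target_eq[of w z] that by (intro exI[of _ z]) auto
  qed
  \<comment> \<open>Besides membership in \<open>S\<close>, each label must still be able to reach
    \<open>a0\<close> on time for every splitter within distance \<open>K\<close>; uniqueness of
    that splitter keeps the demands from conflicting.\<close>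
  define inv where "inv = (\<lambda>v. L v \<in> S \<and> (\<forall>z. length z \<le> K \<and> v @ z \<in> B \<longrightarrow> (L v, a0) \<in> ?E ^^ length z))"
  have good: "good_children \<P> S a0 (L w) (target K B w) (f (L w) (target K B w))" if "inv w" for w
  proof (intro f good_children_exists lcl S(3))
    fix c k assume "target K B w = Some (c, k)"
    then obtain z where z: "w @ z \<in> B" "length z \<le> K" "z \<noteq> []" "c = hd z" "k = length z"
      using target_Some by blast
    obtain z' where z': "z = c # z'" using z by (cases z) auto
    have "w @ z \<in> T" using z B(1) by blast
    then have "w @ [c] \<in> T" "w \<in> T" using z' full_tree_prefix_closed[OF T, of "w @ [c]" z'] full_tree_prefix_closed[OF T, of w z] by auto
    then have "c < arity \<P>" using full_tree_children[OF T] by (metis gr_implies_not0)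
    then show "c < arity \<P> \<and> 0 < k \<and> (L w, a0) \<in> ?E ^^ k" using z that by (auto simp: inv_def)
  qed (use that in \<open>auto simp: inv_def\<close>)
  have inv: "inv v" if "v \<in> T" for v
    using that
  proof (induction v rule: rev_induct)
    case Nil
    have "length z = K" if "length z \<le> K" "z \<in> B" for z using that B(2)[of z] by simp
    then show ?case using S L_B by (auto simp: inv_def)
  next
    case (snoc c w)
    have "w \<in> T" using snoc.prems T full_tree_prefix_closed by blast
    then have iw: "inv w" using snoc.IH by blast
    show ?case
    proof (cases "w @ [c] \<in> B")
      case True
      have "length z = 0" if "length z \<le> K \<and> (w @ [c]) @ z \<in> B" for z
        using B(3)[OF True] that by blast
      moreover have "L (w @ [c]) = a0" using L_B True by blast
      ultimately show ?thesis unfolding inv_def using S(1) by force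
    next
      case False
      let ?t = "target K B w"
      have L: "L (w @ [c]) = f (L w) ?t ! c" using L_rec snoc.prems False by blast
      have c: "c < arity \<P>" using full_tree_children[OF T \<open>w \<in> T\<close>] snoc.prems by (metis gr_implies_not0)
      have "L (w @ [c]) \<in> set (f (L w) ?t)" using good[OF iw] c L by (auto simp: good_children_def)
      then have LS: "L (w @ [c]) \<in> S" using good[OF iw] by (auto simp: good_children_def)
      have "(L (w @ [c]), a0) \<in> ?E ^^ length z" if "length z \<le> K" "(w @ [c]) @ z \<in> B" for z
      proof (cases "length z = K")
        case True
        then show ?thesis using LS S(4) by auto
      next
        case False
        then have "?t = Some (c, Suc (length z))" using target_eq[of w "c # z"] that by simp
        then show ?thesis using good[OF iw] L by (auto simp: good_children_def)
      qed
      then show ?thesis using LS by (auto simp: inv_def)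
    qed
  qed
  have "\<exists>\<rho>. \<rho> permutes {..<arity \<P>} \<and> (L w, map (\<lambda>i. L (w @ [\<rho> i])) [0..<arity \<P>]) \<in> configs \<P>"
    if w: "w \<in> T" "num_children T w = arity \<P>" for w
  proof -
    let ?ls = "f (L w) (target K B w)"
    have g: "good_children \<P> S a0 (L w) (target K B w) ?ls" using good inv w by blast
    have Li: "L (w @ [i]) = ?ls ! i" if "i < arity \<P>" for i
    proof (cases "w @ [i] \<in> B")
      case True
      then have "target K B w = Some (i, 1)" using target_eq[of w "[i]"] K by simp
      then show ?thesis using g L_B True by (auto simp: good_children_def)
    next
      case False
      then show ?thesis using L_rec full_tree_children[OF T w(1)] w that by auto
    qed
    obtain \<rho> where \<rho>: "\<rho> permutes {..<arity \<P>}" "(L w, map (\<lambda>i. ?ls ! \<rho> i) [0..<arity \<P>]) \<in> configs \<P>"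
      using g by (auto simp: good_children_def)
    have "map (\<lambda>i. L (w @ [\<rho> i])) [0..<arity \<P>] = map (\<lambda>i. ?ls ! \<rho> i) [0..<arity \<P>]"
      using permutes_in_image[OF \<rho>(1)] Li by (auto intro!: map_cong)
    then show ?thesis using \<rho> by metis
  qed
  then show ?thesis unfolding is_solution_def L_def[symmetric] using inv S(2) by (auto simp: inv_def)
qed

section \<open>Radius of the labelling rule\<close>

lemma sim_sym: "sim r T ids v T' ids' v' \<Longrightarrow> sim r T' ids' v' T ids v"
proof (induction r arbitrary: v v')
  case (Suc r)
  have "sim r T ids v T' ids' v'" using Suc.prems by simp
  note e = initial_knowledge_eqD[OF sim_initial_knowledge[OF this]]
  show ?case using Suc e by auto
qed simp

lemma sim_up:
  "sim (r + k) T ids v T' ids' v' \<Longrightarrow> k \<le> length v \<Longrightarrow> k \<le> length v' \<and> sim r T ids (up k v) T' ids' (up k v')"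
proof (induction k arbitrary: r)
  case (Suc k)
  have "sim (Suc r + k) T ids v T' ids' v'" using Suc.prems(1) by simp
  then have IH: "k \<le> length v'" "sim (Suc r) T ids (up k v) T' ids' (up k v')"
    using Suc.IH[of "Suc r"] Suc.prems(2) by auto
  have ne: "up k v \<noteq> []" using Suc.prems(2) by auto
  have "sim r T ids (up k v) T' ids' (up k v')" using IH(2) by simp
  then have "up k v' \<noteq> []"
    using ne initial_knowledge_eqD(2)[OF sim_initial_knowledge] by blast
  then have k: "Suc k \<le> length v'" by simp
  have b: "butlast (up k w) = up (Suc k) w" for w :: vertex
    using up_up[of w k 1] by (simp add: butlast_conv_take)
  have "sim r T ids (butlast (up k v)) T' ids' (butlast (up k v'))" using IH(2) ne by simp
  then show ?case unfolding b using k by simp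
qed simp

lemma sim_down:
  assumes "full_tree \<delta> T" "full_tree \<delta> T'"
  shows "sim (r + length z) T ids v T' ids' v' \<Longrightarrow> v \<in> T \<Longrightarrow> v' \<in> T' \<Longrightarrow> v @ z \<in> T \<Longrightarrow>
    v' @ z \<in> T' \<and> sim r T ids (v @ z) T' ids' (v' @ z)"
proof (induction z arbitrary: v v')
  case (Cons c z)
  have s: "sim (r + length z) T ids v T' ids' v'" using Cons.prems(1) by simp
  have vc: "v @ [c] \<in> T" using Cons.prems(4) full_tree_prefix_closed[OF assms(1), of "v @ [c]" z] by simp
  then have c: "c < num_children T v" using full_tree_children[OF assms(1) Cons.prems(2)] by simp
  then have "c < num_children T' v'" using initial_knowledge_eqD(3)[OF sim_initial_knowledge[OF s]] by simp
  then have "v' @ [c] \<in> T'" using full_tree_children[OF assms(2) Cons.prems(3)] by simp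
  moreover have "sim (r + length z) T ids (v @ [c]) T' ids' (v' @ [c])" using Cons.prems(1) c by simp
  ultimately show ?case using Cons.IH[of "v @ [c]" "v' @ [c]"] vc Cons.prems(4) by simp
qed simp

locale two_instances =
  fixes \<delta> :: nat and T T' :: "vertex set" and ids ids' :: "vertex \<Rightarrow> nat"
  assumes full: "full_tree \<delta> T" "full_tree \<delta> T'"
begin

text \<open>Meant for results of the same rule on both instances: equal neighbourhoods of radius
  \<open>r\<close> imply equal membership. It is stated for pairs of sets, so that radii add up
  along the construction.\<close>

definition agree :: "nat \<Rightarrow> vertex set \<Rightarrow> vertex set \<Rightarrow> bool" where
  "agree r X X' \<longleftrightarrow> X \<subseteq> T \<and> X' \<subseteq> T' \<and>
     (\<forall>v\<in>T. \<forall>v'\<in>T'. sim r T ids v T' ids' v' \<longrightarrow> (v \<in> X \<longleftrightarrow> v' \<in> X'))"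

lemma agree_mono: "agree r X X' \<Longrightarrow> r \<le> s \<Longrightarrow> agree s X X'"
  unfolding agree_def using sim_antimono by blast

lemma agreeD: "agree r X X' \<Longrightarrow> sim s T ids v T' ids' v' \<Longrightarrow> r \<le> s \<Longrightarrow> v \<in> T \<Longrightarrow> v' \<in> T' \<Longrightarrow> v \<in> X \<longleftrightarrow> v' \<in> X'"
  unfolding agree_def using sim_antimono by blast

lemma up_in: "v \<in> T \<Longrightarrow> up k v \<in> T" "v' \<in> T' \<Longrightarrow> up k v' \<in> T'"
  using full_tree_prefix_closed[OF full(1), of "up k v" "drop (length v - k) v"]
    full_tree_prefix_closed[OF full(2), of "up k v'" "drop (length v' - k) v'"] by auto

lemma agree_down:
  assumes "agree r X X'" "sim s T ids v T' ids' v'" "r + length z \<le> s" "v \<in> T" "v' \<in> T'"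
  shows "v @ z \<in> X \<longleftrightarrow> v' @ z \<in> X'"
proof -
  have s: "sim (r + length z) T ids v T' ids' v'" using sim_antimono assms by blast
  have X: "X \<subseteq> T" "X' \<subseteq> T'" using assms(1) by (auto simp: agree_def)
  show ?thesis
  proof
    assume "v @ z \<in> X"
    then show "v' @ z \<in> X'" using sim_down[OF full s assms(4,5)] X assms(1) unfolding agree_def by blast
  next
    assume "v' @ z \<in> X'"
    then show "v @ z \<in> X"
      using sim_down[OF full(2,1) sim_sym[OF s] assms(5,4)] X assms(1) sim_sym unfolding agree_def by blast
  qed
qed

lemma agree_up:
  assumes "agree r X X'" "sim s T ids v T' ids' v'" "r + k \<le> s" "v \<in> T" "v' \<in> T'" "k \<le> length v"
  shows "k \<le> length v'" "up k v \<in> X \<longleftrightarrow> up k v' \<in> X'"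
proof -
  have s: "sim (r + k) T ids v T' ids' v'" using sim_antimono assms by blast
  from sim_up[OF s assms(6)] show "k \<le> length v'" "up k v \<in> X \<longleftrightarrow> up k v' \<in> X'"
    using assms(1,4,5) up_in unfolding agree_def by auto
qed

lemma agree_chain:
  assumes "agree r X X'"
  shows "agree (Suc r) (chain X) (chain X')"
proof -
  have "v \<in> chain X \<longleftrightarrow> v' \<in> chain X'" if s: "sim (Suc r) T ids v T' ids' v'" "v \<in> T" "v' \<in> T'" for v v'
  proof -
    have "v @ [c] \<in> X \<longleftrightarrow> v' @ [c] \<in> X'" for c
      using agree_down[OF assms s(1), of "[c]"] s by simp
    moreover have "v \<in> X \<longleftrightarrow> v' \<in> X'" using agreeD[OF assms s(1)] s by simp
    ultimately show ?thesis by (simp add: chain_def)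
  qed
  moreover have "chain X \<subseteq> X" "chain X' \<subseteq> X'" by (auto simp: chain_def)
  ultimately show ?thesis using assms unfolding agree_def by blast
qed

lemma agree_deep:
  assumes "agree r X X'"
  shows "agree (Suc r + l) (deep l X) (deep l X')"
proof -
  note ch = agree_chain[OF assms]
  have "v \<in> deep l X \<longleftrightarrow> v' \<in> deep l X'" if s: "sim (Suc r + l) T ids v T' ids' v'" "v \<in> T" "v' \<in> T'" for v v'
  proof -
    have *: "Suc r + k \<le> Suc r + l" if "k \<le> l" for k using that by simp
    have len: "l \<le> length v \<longleftrightarrow> l \<le> length v'" using sim_up[OF s(1)] sim_up[OF sim_sym[OF s(1)]] by blast
    have "up k v \<in> chain X \<longleftrightarrow> up k v' \<in> chain X'" if "k \<le> l" "l \<le> length v" for k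
      using agree_up(2)[OF ch s(1) *[OF that(1)] s(2,3)] that by simp
    then show ?thesis unfolding deep_def using len by blast
  qed
  moreover have "deep l X \<subseteq> X" "deep l X' \<subseteq> X'" using deepD[of _ l _ 0] by (auto simp: chain_def)
  ultimately show ?thesis using assms unfolding agree_def by blast
qed

lemma agree_compressed:
  assumes "agree r X X'"
  shows "agree (Suc r + 2 * l) (compressed l X) (compressed l X')"
proof -
  have "v @ z \<in> deep l X \<longleftrightarrow> v' @ z \<in> deep l X'"
    if "sim (Suc r + 2 * l) T ids v T' ids' v'" "v \<in> T" "v' \<in> T'" "length z \<le> l" for v v' z
    using agree_down[OF agree_deep[OF assms, of l] that(1)] that by simp
  moreover have "compressed l X \<subseteq> X" "compressed l X' \<subseteq> X'" using compressed_chain by (auto simp: chain_def)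
  ultimately show ?thesis using assms unfolding agree_def compressed_def by blast
qed

text \<open>A phase looks \<open>l\<close> down for a deep vertex, up to \<open>l\<close> up from
  there, and one step further for the number of remaining children.\<close>

lemma agree_alive: "agree (i * (2 * l + 1)) (alive l T i) (alive l T' i)"
proof (induction i)
  case 0
  then show ?case by (auto simp: agree_def)
next
  case (Suc i)
  let ?r = "i * (2 * l + 1)"
  have "v \<in> alive l T (Suc i) \<longleftrightarrow> v' \<in> alive l T' (Suc i)"
    if s: "sim (Suc ?r + 2 * l) T ids v T' ids' v'" "v \<in> T" "v' \<in> T'" for v v'
  proof -
    have "v @ [c] \<in> alive l T i \<longleftrightarrow> v' @ [c] \<in> alive l T' i" for c
      using agree_down[OF Suc s(1), of "[c]"] s by simp
    moreover have "v \<in> alive l T i \<longleftrightarrow> v' \<in> alive l T' i" using agreeD[OF Suc s(1)] s by simp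
    moreover have "v \<in> compressed l (alive l T i) \<longleftrightarrow> v' \<in> compressed l (alive l T' i)"
      using agreeD[OF agree_compressed[OF Suc] s(1)] s by simp
    ultimately show ?thesis by simp
  qed
  moreover have "alive l T (Suc i) \<subseteq> alive l T i" "alive l T' (Suc i) \<subseteq> alive l T' i" by auto
  moreover have "Suc i * (2 * l + 1) = Suc ?r + 2 * l" by simp
  ultimately show ?case using Suc unfolding agree_def by (metis subset_trans)
qed

lemma agree_top:
  assumes "agree r X X'"
  shows "agree (Suc (Suc r + l)) (chain_top l X) (chain_top l X')"
proof -
  note d = agree_deep[OF assms, of l]
  have "v \<in> chain_top l X \<longleftrightarrow> v' \<in> chain_top l X'" if s: "sim (Suc (Suc r + l)) T ids v T' ids' v'" "v \<in> T" "v' \<in> T'" for v v'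
  proof -
    have 1: "v \<in> deep l X \<longleftrightarrow> v' \<in> deep l X'" using agreeD[OF d s(1) _ s(2,3)] by simp
    have "butlast v \<in> deep l X \<longleftrightarrow> butlast v' \<in> deep l X'"
    proof (cases "v = []")
      case True
      then have "v' = []" using initial_knowledge_eqD(2)[OF sim_initial_knowledge[OF s(1)]] by simp
      then show ?thesis using 1 True by simp
    next
      case False
      then have "1 \<le> length v" by (cases v) auto
      then show ?thesis using agree_up(2)[OF d s(1) _ s(2,3), of 1] by (simp add: butlast_conv_take)
    qed
    then show ?thesis using 1 by (simp add: chain_top_def)
  qed
  moreover have "chain_top l X \<subseteq> T" "chain_top l X' \<subseteq> T'" using d by (auto simp: chain_top_def agree_def)
  ultimately show ?thesis unfolding agree_def by blast
qed

lemma agree_cand: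
  assumes "agree r X X'"
  shows "agree (Suc r + 2 * l) (cand l X) (cand l X')"
proof -
  note d = agree_deep[OF assms, of l]
  have "v \<in> cand l X \<longleftrightarrow> v' \<in> cand l X'" if s: "sim (Suc r + 2 * l) T ids v T' ids' v'" "v \<in> T" "v' \<in> T'" for v v'
  proof -
    have 1: "v \<in> deep l X \<longleftrightarrow> v' \<in> deep l X'" using agreeD[OF d s(1) _ s(2,3)] by simp
    have "up l v \<in> deep l X \<longleftrightarrow> up l v' \<in> deep l X'" if "v \<in> deep l X"
      using agree_up(2)[OF d s(1) _ s(2,3), of l] that by (auto simp: deep_def)
    then show ?thesis using 1 by (auto simp: cand_def)
  qed
  moreover have "cand l X \<subseteq> T" "cand l X' \<subseteq> T'" using d by (auto simp: cand_def agree_def)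
  ultimately show ?thesis unfolding agree_def by blast
qed

lemma agree_UN: "(\<And>i. i < m \<Longrightarrow> agree r (X i) (X' i)) \<Longrightarrow> agree r (\<Union>i<m. X i) (\<Union>i<m. X' i)"
  unfolding agree_def by (auto; blast)

lemma near_up: "near l u v \<longleftrightarrow> (\<exists>z. length z < l \<and> v = u @ z) \<or> (\<exists>k<l. k \<le> length u \<and> v = up k u)"
proof -
  have "(\<exists>z. length z < l \<and> u = v @ z) \<longleftrightarrow> (\<exists>k<l. k \<le> length u \<and> v = up k u)"
  proof
    assume "\<exists>k<l. k \<le> length u \<and> v = up k u"
    then obtain k where "k < l" "k \<le> length u" "v = up k u" by blast
    then show "\<exists>z. length z < l \<and> u = v @ z" by (intro exI[of _ "drop (length u - k) u"]) auto
  qed auto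
  then show ?thesis unfolding near_def by blast
qed

text \<open>Only one implication; the other is obtained by interpreting the locale with the two
  instances exchanged.\<close>

lemma agree_ruling_step:
  assumes "agree r X X'" "v \<in> T" "v' \<in> T'" "sim (r + l) T ids v T' ids' v'"
    and "\<exists>u\<in>X. near l v u \<and> P (ids u) (ids v)"
  shows "\<exists>u\<in>X'. near l v' u \<and> P (ids' u) (ids' v')"
proof -
  obtain u where u: "u \<in> X" "near l v u" "P (ids u) (ids v)" using assms(5) by blast
  have XT: "X \<subseteq> T" "X' \<subseteq> T'" using assms(1) by (auto simp: agree_def)
  have idv: "ids' v' = ids v" using initial_knowledge_eqD(1)[OF sim_initial_knowledge[OF assms(4)]] by simp
  from u(2)[unfolded near_up] show ?thesis
  proof (elim disjE exE conjE)
    fix z assume z: "length z < l" "u = v @ z"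
    have s: "sim (r + length z) T ids v T' ids' v'" by (rule sim_antimono[OF assms(4)]) (use z in simp)
    have uT: "v @ z \<in> T" using u XT z by blast
    from sim_down[OF full s assms(2,3) uT] have *: "v' @ z \<in> T'" "sim r T ids u T' ids' (v' @ z)" using z by auto
    then have "v' @ z \<in> X'" using agreeD[OF assms(1) *(2)] u(1) uT z by simp
    moreover have "ids' (v' @ z) = ids u" using initial_knowledge_eqD(1)[OF sim_initial_knowledge[OF *(2)]] by simp
    moreover have "near l v' (v' @ z)" using z(1) by (auto simp: near_def)
    ultimately show ?thesis using u(3) idv by (intro bexI[of _ "v' @ z"]) auto
  next
    fix k assume k: "k < l" "k \<le> length v" "u = up k v"
    have s: "sim (r + k) T ids v T' ids' v'" by (rule sim_antimono[OF assms(4)]) (use k in simp)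
    from sim_up[OF s k(2)] have *: "k \<le> length v'" "sim r T ids u T' ids' (up k v')" using k by auto
    have "up k v' \<in> T'" using up_in assms(3) by blast
    then have "up k v' \<in> X'" using agreeD[OF assms(1) *(2)] u(1) XT by blast
    moreover have "ids' (up k v') = ids u" using initial_knowledge_eqD(1)[OF sim_initial_knowledge[OF *(2)]] by simp
    moreover have "near l v' (up k v')" using k(1) *(1) unfolding near_up by blast
    ultimately show ?thesis using u(3) idv by (intro bexI[of _ "up k v'"]) auto
  qed
qed

end

lemma (in two_instances) two_instances_sym: "two_instances \<delta> T' T"
  using full by (simp add: two_instances_def)

lemma (in two_instances) agree_sym: "agree r X X' \<longleftrightarrow> two_instances.agree T' T ids' ids r X' X"
  unfolding agree_def two_instances.agree_def[OF two_instances_sym] using sim_sym by blast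

context two_instances
begin

lemma agree_ruling: "agree (m * (2 * l + 1) + 2 * l + 1 + j * l) (ruling l T ids m j) (ruling l T' ids' m j)"
proof (induction j)
  case 0
  have "agree (m * (2 * l + 1) + 2 * l + 1 + 0 * l) (\<Union>i<m. cand l (alive l T i)) (\<Union>i<m. cand l (alive l T' i))"
  proof (rule agree_UN, rule agree_mono[OF agree_cand[OF agree_alive]])
    fix i assume "i < m"
    then have "i * (2 * l + 1) \<le> m * (2 * l + 1)" by (intro mult_le_mono) auto
    then show "Suc (i * (2 * l + 1)) + 2 * l \<le> m * (2 * l + 1) + 2 * l + 1 + 0 * l" by simp
  qed
  then show ?case by simp
next
  case (Suc j)
  let ?r = "m * (2 * l + 1) + 2 * l + 1 + j * l" and ?R = "ruling l T ids m j" and ?R' = "ruling l T' ids' m j"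
  let ?P = "\<lambda>a b. a div 2 ^ Suc j = b div 2 ^ Suc j \<and> even (a div 2 ^ j)"
  interpret o: two_instances \<delta> T' T ids' ids by (rule two_instances_sym)
  have Suc': "o.agree ?r ?R' ?R" using Suc agree_sym by blast
  have "v \<in> ruling l T ids m (Suc j) \<longleftrightarrow> v' \<in> ruling l T' ids' m (Suc j)"
    if s: "sim (?r + l) T ids v T' ids' v'" "v \<in> T" "v' \<in> T'" for v v'
  proof -
    have id: "ids v = ids' v'" using initial_knowledge_eqD(1)[OF sim_initial_knowledge[OF s(1)]] .
    have "v \<in> ?R \<longleftrightarrow> v' \<in> ?R'" using agreeD[OF Suc s(1) _ s(2,3)] by simp
    moreover have "(\<exists>u\<in>?R. near l v u \<and> ?P (ids u) (ids v)) \<longleftrightarrow> (\<exists>u\<in>?R'. near l v' u \<and> ?P (ids' u) (ids' v'))"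
      using agree_ruling_step[OF Suc s(2,3,1), of ?P] o.agree_ruling_step[OF Suc' s(3,2) sim_sym[OF s(1)], of ?P]
      by blast
    ultimately show ?thesis unfolding ruling.simps mem_Collect_eq id by blast
  qed
  moreover have "ruling l T ids m (Suc j) \<subseteq> ?R" "ruling l T' ids' m (Suc j) \<subseteq> ?R'" by auto
  ultimately have "agree (?r + l) (ruling l T ids m (Suc j)) (ruling l T' ids' m (Suc j))"
    using Suc unfolding agree_def by blast
  then show ?case by (simp add: algebra_simps)
qed

lemma agree_splitters:
  "agree (m * (2 * l + 1) + 2 * l + 2 + b * l) (splitters l T ids m b) (splitters l T' ids' m b)"
proof -
  have "agree (m * (2 * l + 1) + 2 * l + 2 + b * l) (\<Union>i<m. chain_top l (alive l T i)) (\<Union>i<m. chain_top l (alive l T' i))"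
  proof (rule agree_UN, rule agree_mono[OF agree_top[OF agree_alive]])
    fix i assume "i < m"
    then have "i * (2 * l + 1) \<le> m * (2 * l + 1)" by (intro mult_le_mono) auto
    then show "Suc (Suc (i * (2 * l + 1)) + l) \<le> m * (2 * l + 1) + 2 * l + 2 + b * l" by simp
  qed
  moreover have "agree (m * (2 * l + 1) + 2 * l + 2 + b * l) (ruling l T ids m b) (ruling l T' ids' m b)"
    by (rule agree_mono[OF agree_ruling]) simp
  ultimately show ?thesis unfolding agree_def splitters_def by blast
qed

lemma agree_target:
  assumes "agree r B B'" "sim (r + K) T ids v T' ids' v'" "v \<in> T" "v' \<in> T'"
  shows "target K B v = target K B' v'"
proof -
  have "v @ z \<in> B \<longleftrightarrow> v' @ z \<in> B'" if "length z \<le> K" for z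
    using agree_down[OF assms(1,2) _ assms(3,4), of z] that by simp
  then have "{z. z \<noteq> [] \<and> length z \<le> K \<and> v @ z \<in> B} = {z. z \<noteq> [] \<and> length z \<le> K \<and> v' @ z \<in> B'}"
    by blast
  then show ?thesis by (simp add: target_def)
qed

lemma agree_propagate:
  assumes "agree r B B'"
  shows "sim (r + K + j) T ids v T' ids' v' \<Longrightarrow> v \<in> T \<Longrightarrow> v' \<in> T' \<Longrightarrow>
    propagate f a0 K B j v = propagate f a0 K B' j v'"
proof (induction j arbitrary: v v')
  case (Suc j)
  have s: "sim (Suc (r + K + j)) T ids v T' ids' v'" using Suc.prems(1) by simp
  have nil: "v = [] \<longleftrightarrow> v' = []" using initial_knowledge_eqD(2)[OF sim_initial_knowledge[OF s]] .
  have B: "v \<in> B \<longleftrightarrow> v' \<in> B'" using agreeD[OF assms s _ Suc.prems(2,3)] by simp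
  show ?case
  proof (cases "v = []")
    case False
    then have p: "last v = last v'" "sim (r + K + j) T ids (butlast v) T' ids' (butlast v')" using s by auto
    have bT: "butlast v \<in> T" "butlast v' \<in> T'" using up_in(1)[OF Suc.prems(2), of 1] up_in(2)[OF Suc.prems(3), of 1]
      by (simp_all add: butlast_conv_take)
    have "target K B (butlast v) = target K B' (butlast v')"
      by (rule agree_target[OF assms sim_antimono[OF p(2)] bT]) simp
    then show ?thesis using Suc.IH[OF p(2) bT] p(1) nil B False by simp
  qed (use nil in simp)
qed simp

end

section \<open>Logarithmic complexity of robust problems\<close>

lemma is_solution_cong:
  assumes "is_solution \<P> T L" "full_tree (arity \<P>) T" "\<And>v. v \<in> T \<Longrightarrow> L' v = L v"
  shows "is_solution \<P> T L'"
  unfolding is_solution_def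
proof (intro conjI ballI impI)
  fix v assume v: "v \<in> T" "num_children T v = arity \<P>"
  then obtain \<rho> where \<rho>: "\<rho> permutes {..<arity \<P>}" "(L v, map (\<lambda>i. L (v @ [\<rho> i])) [0..<arity \<P>]) \<in> configs \<P>"
    using assms(1) by (auto simp: is_solution_def)
  have "L' (v @ [\<rho> i]) = L (v @ [\<rho> i])" if "i < arity \<P>" for i
    using permutes_in_image[OF \<rho>(1), of i] that full_tree_children[OF assms(2) v(1)] v(2) by (intro assms(3)) simp
  then have "map (\<lambda>i. L' (v @ [\<rho> i])) [0..<arity \<P>] = map (\<lambda>i. L (v @ [\<rho> i])) [0..<arity \<P>]"
    by simp
  then show "\<exists>\<rho>. \<rho> permutes {..<arity \<P>} \<and> (L' v, map (\<lambda>i. L' (v @ [\<rho> i])) [0..<arity \<P>]) \<in> configs \<P>"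
    using \<rho> assms(3)[OF v(1)] by metis
qed (use assms in \<open>auto simp: is_solution_def\<close>)

lemma less_power_floorlog: "n < 2 ^ floorlog 2 n"
  using floorlog_bounds[of n 2] by (cases "n = 0") auto

lemma robust_O_log:
  assumes lcl: "is_lcl \<P>" and rob: "robust \<P>" and c: "1 \<le> c"
  shows "complexity_O_log c \<P>"
proof -
  obtain S a0 K where K: "0 < K" and S: "a0 \<in> S" "S \<subseteq> labels \<P>"
    "\<forall>a\<in>S. \<exists>bs. (a, bs) \<in> configs \<P> \<and> set bs \<subseteq> S"
    "\<forall>a\<in>S. (a, a0) \<in> inner_edges \<P> S ^^ K"
    by (rule robust_sink[OF lcl rob])
  define f where "f = (\<lambda>a t. SOME ls. good_children \<P> S a0 a t ls)"
  have f: "good_children \<P> S a0 a t (f a t)" if "\<exists>ls. good_children \<P> S a0 a t ls" for a t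
    unfolding f_def using that by (rule someI_ex)
  \<comment> \<open>\<open>l = K + 1\<close> turns the separation below \<open>l\<close> into one up
    to \<open>K\<close>. \<open>m\<close> is the number of phases after which the doubling argument
    exceeds \<open>n\<close>, and \<open>b\<close> bits suffice for identifiers up to
    \<open>n ^ c\<close>.\<close>
  define l where "l = Suc K"
  define m where "m = (\<lambda>n. floorlog 2 n * Suc l)"
  define b where "b = (\<lambda>n. c * floorlog 2 n)"
  define \<Lambda> where "\<Lambda> = (\<lambda>n. m n * Suc l + 2 * l * b n + l + 2)"
  \<comment> \<open>The radius for recognising splitters, plus \<open>K\<close> for the target, plus
    one round per recursion step of \<open>propagate\<close>.\<close>
  define \<tau> where "\<tau> = (\<lambda>n. m n * (2 * l + 1) + 2 * l + 2 + b n * l + K + Suc (\<Lambda> n))"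
  define B where "B = (\<lambda>T ids. splitters l T ids (m (card T)) (b (card T)))"
  define g where "g = (\<lambda>T ids. propagate f a0 K (B T ids) (Suc (\<Lambda> (card T))))"
  let ?I = "\<Union>n. instances c (arity \<P>) n"
  have l: "0 < l" "K < l" by (auto simp: l_def)
  have solution: "is_solution \<P> T (g T ids)" if "(T, ids) \<in> ?I" for T ids
  proof -
    from that have T: "full_tree (arity \<P>) T" and inj: "inj_on ids T" and ids: "ids ` T \<subseteq> {1..card T ^ c}"
      by (auto simp: instances_def)
    have fin: "finite T" using T by (simp add: full_tree_def)
    let ?n = "card T"
    have "?n ^ c < 2 ^ b ?n" unfolding b_def
      using power_strict_mono[OF less_power_floorlog[of ?n], of c] c
      by (simp add: power_mult[symmetric] mult.commute)
    then have bits: "\<forall>v\<in>T. ids v < 2 ^ b ?n" using ids by fastforce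
    have deep: "\<exists>i. u \<in> deep l (alive l T i)" if "u \<in> B T ids" for u
      using splitter_deep[of u l T ids] that unfolding B_def by blast
    have "B T ids \<subseteq> T"
    proof
      fix u assume "u \<in> B T ids"
      then obtain i where "u \<in> deep l (alive l T i)" using deep by blast
      then have "u \<in> alive l T i" using deepD[of u l _ 0] by (auto simp: chain_def)
      then show "u \<in> T" using alive_antimono[of 0 i l T] by auto
    qed
    moreover have "K \<le> length u" if "u \<in> B T ids" for u using deep[OF that] l by (auto simp: deep_def)
    moreover have "z = []" if "u \<in> B T ids" "u @ z \<in> B T ids" "length z \<le> K" for u z
      using splitters_comparable[OF inj bits, of u l _ z] that l unfolding B_def by simp
    moreover have "d = d'" if "w @ d # z \<in> B T ids" "w @ d' # z' \<in> B T ids" "length z \<le> K" "length z' \<le> K"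
      for w d z d' z'
      using splitters_incomparable[of w d z l T ids _ _ d' z'] that l unfolding B_def by (meson le_less_trans)
    moreover have "\<exists>k<\<Lambda> ?n. up k v \<in> B T ids" if v: "v \<in> T" "\<Lambda> ?n \<le> length v" for v
      unfolding B_def \<Lambda>_def
    proof (rule splitter_on_path)
      show "up k v \<in> T" for k
        using full_tree_prefix_closed[OF T, of "up k v" "drop (length v - k) v"] v(1) by simp
      show "alive l T (m ?n) = {}" unfolding m_def by (rule alive_empty[OF fin less_power_floorlog])
    qed (use l v in \<open>auto simp: \<Lambda>_def\<close>)
    ultimately show ?thesis unfolding g_def
      by (intro propagate_solution[OF lcl T K S(1,2) bspec[OF S(3)] bspec[OF S(4)] f]) blast+
  qed
  obtain A where A: "\<And>T ids v. (T, ids) \<in> ?I \<Longrightarrow> v \<in> T \<Longrightarrow> output_label A T ids v = g T ids v \<and>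
    output_time A T ids v = \<tau> (card T) \<and> (\<exists>r. decision_at A T ids v r \<noteq> None)"
  proof (rule local_function_algorithm[of ?I \<tau> g])
    fix T ids v T' ids' v'
    assume I: "(T, ids) \<in> ?I" "(T', ids') \<in> ?I" and v: "v \<in> T" "v' \<in> T'"
      and s: "sim (\<tau> (card T)) T ids v T' ids' v'"
    interpret two_instances "arity \<P>" T T' ids ids' using I by unfold_locales (auto simp: instances_def)
    have n: "card T' = card T" using initial_knowledge_eqD(4)[OF sim_initial_knowledge[OF s]] by simp
    show "g T ids v = g T' ids' v'" unfolding g_def B_def n
      by (rule agree_propagate[OF agree_splitters _ v]) (use s in \<open>simp add: \<tau>_def\<close>)
  qed blast
  have "solves c A \<P>" unfolding solves_def
  proof (intro allI ballI, clarify)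
    fix n T ids assume I: "(T, ids) \<in> instances c (arity \<P>) n"
    have "is_solution \<P> T (output_label A T ids)"
    proof (rule is_solution_cong[OF solution[of T ids]])
      show "output_label A T ids v = g T ids v" if "v \<in> T" for v using A[of T ids v] I that by blast
    qed (use I in \<open>auto simp: instances_def\<close>)
    then show "(\<forall>v\<in>T. \<exists>r. decision_at A T ids v r \<noteq> None) \<and> is_solution \<P> T (output_label A T ids)"
      using A[of T ids] I by blast
  qed
  then have rc: "round_complexity c \<P> n \<le> enat (\<tau> n)" for n
    unfolding round_complexity_def
  proof (intro INF_lower2[of A] SUP_least, simp, clarify)
    fix T ids assume I: "(T, ids) \<in> instances c (arity \<P>) n"
    then have "card T = n" by (auto simp: instances_def)
    then show "running_time A T ids \<le> enat (\<tau> n)"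
      unfolding running_time_def
    proof (intro SUP_least)
      show "output_time A T ids v \<le> enat (\<tau> n)" if "v \<in> T" for v
        using A[of T ids v] I that \<open>card T = n\<close> by (metis UN_I UNIV_I order_refl)
    qed
  qed
  obtain C1 C2 where \<tau>: "\<And>n. \<tau> n = C1 * floorlog 2 n + C2"
  proof
    show "\<tau> n = (Suc l * (2 * l + 1) + c * l + Suc l * Suc l + 2 * l * c) * floorlog 2 n + (3 * l + K + 5)" for n
      by (simp add: \<tau>_def \<Lambda>_def m_def b_def algebra_simps)
  qed
  have "ereal_of_enat (round_complexity c \<P> n) \<le> ereal ((2 * (C1 + C2) / ln 2) * ln (real n))" if n: "2 \<le> n" for n
  proof -
    have "floorlog 2 n = nat \<lfloor>log 2 n\<rfloor> + 1" using n by (simp add: floorlog_def)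
    then have "real (floorlog 2 n) \<le> log 2 n + 1" "1 \<le> floorlog 2 n" using n by auto
    moreover have "1 \<le> log 2 n" using n by simp
    ultimately have fl: "real (floorlog 2 n) \<le> 2 * log 2 n" "1 \<le> floorlog 2 n" by auto
    have "real (\<tau> n) \<le> real (C1 + C2) * real (floorlog 2 n)"
      unfolding \<tau> using fl(2) mult_left_mono[of 1 "real (floorlog 2 n)" "real C2"] by (simp add: algebra_simps)
    also have "\<dots> \<le> real (C1 + C2) * (2 * log 2 n)" using fl by (intro mult_left_mono) auto
    also have "\<dots> = (2 * (C1 + C2) / ln 2) * ln (real n)" by (simp add: log_def)
    finally have "ereal (real (\<tau> n)) \<le> ereal ((2 * (C1 + C2) / ln 2) * ln (real n))" by simp
    moreover have "ereal_of_enat (round_complexity c \<P> n) \<le> ereal (real (\<tau> n))"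
      using rc[of n] by (simp flip: ereal_of_enat_simps(1))
    ultimately show ?thesis by (rule order_trans[rotated])
  qed
  then show ?thesis unfolding complexity_O_log_def by blast
qed

section \<open>Caterpillars\<close>

text \<open>One spine vertex: the port at which the spine continues, and the trees below the ports.
  The tree given for the spine port itself is overwritten in \<open>cat\<close>.\<close>

type_synonym item = "nat \<times> (nat \<Rightarrow> vertex set)"

definition node :: "nat \<Rightarrow> (nat \<Rightarrow> vertex set) \<Rightarrow> vertex set" where
  "node \<delta> F = insert [] {j # x |j x. j < \<delta> \<and> x \<in> F j}"

primrec cat :: "nat \<Rightarrow> item list \<Rightarrow> vertex set \<Rightarrow> vertex set" where
  "cat \<delta> [] E = E"
| "cat \<delta> (p # ps) E = node \<delta> ((snd p)(fst p := cat \<delta> ps E))"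

abbreviation spine :: "item list \<Rightarrow> vertex" where
  "spine \<equiv> map fst"

definition items_all :: "nat \<Rightarrow> (vertex set \<Rightarrow> bool) \<Rightarrow> item list \<Rightarrow> bool" where
  "items_all \<delta> P ps \<longleftrightarrow> (\<forall>(i, F)\<in>set ps. i < \<delta> \<and> (\<forall>j<\<delta>. j \<noteq> i \<longrightarrow> P (F j)))"

lemma items_all_append [simp]: "items_all \<delta> P (ps @ qs) \<longleftrightarrow> items_all \<delta> P ps \<and> items_all \<delta> P qs"
  by (auto simp: items_all_def)

lemma items_all_Nil [simp]: "items_all \<delta> P []"
  by (simp add: items_all_def)

lemma items_all_Cons [simp]: "items_all \<delta> P (p # ps) \<longleftrightarrow>
    fst p < \<delta> \<and> (\<forall>j<\<delta>. j \<noteq> fst p \<longrightarrow> P (snd p j)) \<and> items_all \<delta> P ps"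
  by (auto simp: items_all_def)

lemma items_all_mono: "items_all \<delta> P ps \<Longrightarrow> (\<And>X. P X \<Longrightarrow> Q X) \<Longrightarrow> items_all \<delta> Q ps"
  by (induction ps) auto

lemma items_all_subset: "items_all \<delta> P ps \<Longrightarrow> set qs \<subseteq> set ps \<Longrightarrow> items_all \<delta> P qs"
  by (auto simp: items_all_def)

lemma items_all_replicate: "i < \<delta> \<Longrightarrow> (\<And>j. P (F j)) \<Longrightarrow> items_all \<delta> P (replicate m (i, F))"
  by (induction m) auto

lemma Nil_in_node [simp]: "[] \<in> node \<delta> F"
  by (simp add: node_def)

lemma Cons_in_node [simp]: "j # x \<in> node \<delta> F \<longleftrightarrow> j < \<delta> \<and> x \<in> F j"
  by (auto simp: node_def)

lemma cat_append: "cat \<delta> (ps @ qs) E = cat \<delta> ps (cat \<delta> qs E)"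
  by (induction ps) auto

lemma spine_in_cat: "items_all \<delta> P ps \<Longrightarrow> spine ps @ z \<in> cat \<delta> ps E \<longleftrightarrow> z \<in> E"
  by (induction ps) auto

lemma cat_off_spine: "\<not> prefix (spine ps) z \<Longrightarrow> z \<in> cat \<delta> ps E \<longleftrightarrow> z \<in> cat \<delta> ps E'"
proof (induction ps arbitrary: z)
  case (Cons p ps)
  then show ?case by (cases z) auto
qed simp

text \<open>With an empty end, \<open>cat\<close> yields the vertices of a window, namely those not
  at or below its lower pole, whatever hangs there.\<close>

lemma cat_empty: "items_all \<delta> P ps \<Longrightarrow> z \<in> cat \<delta> ps {} \<longleftrightarrow> z \<in> cat \<delta> ps E \<and> \<not> prefix (spine ps) z"
  using cat_off_spine[of ps z \<delta> "{}" E] spine_in_cat[of \<delta> P ps _ "{}"]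
  by (cases "prefix (spine ps) z") (auto elim!: prefixE)

lemma full_tree_leaf: "full_tree \<delta> {[]}"
  by (auto simp: full_tree_def)

lemma finite_node:
  assumes "\<And>j. j < \<delta> \<Longrightarrow> finite (F j)"
  shows "finite (node \<delta> F)" "card (node \<delta> F) = 1 + (\<Sum>j<\<delta>. card (F j))"
proof -
  have eq: "node \<delta> F = insert [] (\<Union>j<\<delta>. (#) j ` F j)" by (auto simp: node_def)
  show "finite (node \<delta> F)" unfolding eq using assms by auto
  have "card (\<Union>j<\<delta>. (#) j ` F j) = (\<Sum>j<\<delta>. card ((#) j ` F j))"
    using assms by (intro card_UN_disjoint) auto
  also have "\<dots> = (\<Sum>j<\<delta>. card (F j))" by (intro sum.cong refl card_image) auto
  finally show "card (node \<delta> F) = 1 + (\<Sum>j<\<delta>. card (F j))" unfolding eq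
    using assms by (subst card_insert_disjoint) auto
qed

lemma full_tree_node:
  assumes F: "\<And>j. j < \<delta> \<Longrightarrow> full_tree \<delta> (F j)"
  shows "full_tree \<delta> (node \<delta> F)"
  unfolding full_tree_def
proof (intro conjI allI impI ballI)
  show "finite (node \<delta> F)" using F by (intro finite_node) (auto simp: full_tree_def)
  show "v \<in> node \<delta> F" if "v @ [i] \<in> node \<delta> F" for v i
  proof (cases v)
    case (Cons j x)
    then have "j < \<delta>" "x @ [i] \<in> F j" using that by auto
    then have "x \<in> F j" using F[of j] unfolding full_tree_def by blast
    then show ?thesis using Cons \<open>j < \<delta>\<close> by simp
  qed simp
  show "{i. v @ [i] \<in> node \<delta> F} = {} \<or> {i. v @ [i] \<in> node \<delta> F} = {..<\<delta>}" if "v \<in> node \<delta> F" for v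
  proof (cases v)
    case Nil
    then have "{i. v @ [i] \<in> node \<delta> F} = {..<\<delta>}" using F by (auto simp: full_tree_def)
    then show ?thesis ..
  next
    case (Cons j x)
    then have "j < \<delta>" "x \<in> F j" using that by auto
    then show ?thesis using F[of j] Cons by (auto simp: full_tree_def)
  qed
qed simp

lemma full_tree_cat: "items_all \<delta> (full_tree \<delta>) ps \<Longrightarrow> full_tree \<delta> E \<Longrightarrow> full_tree \<delta> (cat \<delta> ps E)"
  by (induction ps) (auto intro!: full_tree_node)

lemma card_cat_le:
  assumes "items_all \<delta> (\<lambda>X. finite X \<and> card X \<le> a) ps" "finite E"
  shows "finite (cat \<delta> ps E) \<and> card (cat \<delta> ps E) \<le> length ps * (1 + \<delta> * a) + card E"
  using assms
proof (induction ps)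
  case (Cons p ps)
  let ?F = "(snd p)(fst p := cat \<delta> ps E)"
  have p: "fst p < \<delta>" and IH: "finite (cat \<delta> ps E)" "card (cat \<delta> ps E) \<le> length ps * (1 + \<delta> * a) + card E"
    and fin: "\<And>j. j < \<delta> \<Longrightarrow> finite (?F j)"
    using Cons by auto
  have "(\<Sum>j<\<delta>. card (?F j)) = card (?F (fst p)) + (\<Sum>j\<in>{..<\<delta>} - {fst p}. card (?F j))"
    using p by (intro sum.remove) auto
  also have "(\<Sum>j\<in>{..<\<delta>} - {fst p}. card (?F j)) \<le> (\<Sum>j\<in>{..<\<delta>} - {fst p}. a)"
    using Cons.prems by (intro sum_mono) auto
  also have "\<dots> \<le> \<delta> * a" using p by simp
  finally show ?case using finite_node[of \<delta> ?F, OF fin] IH by simp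
qed simp

lemma full_tree_card:
  assumes "full_tree \<delta> T"
  shows "\<exists>m. card T = 1 + \<delta> * m"
proof -
  let ?I = "{v \<in> T. {i. v @ [i] \<in> T} = {..<\<delta>}}"
  have fin: "finite T" using assms by (simp add: full_tree_def)
  have "T - {[]} = (\<lambda>(v, i). v @ [i]) ` (?I \<times> {..<\<delta>})"
  proof (intro equalityI subsetI)
    fix x assume x: "x \<in> T - {[]}"
    obtain v i where vi: "x = v @ [i]" using x by (cases x rule: rev_cases) auto
    then have "v \<in> T" using x assms unfolding full_tree_def by blast
    then have "{i. v @ [i] \<in> T} = {} \<or> {i. v @ [i] \<in> T} = {..<\<delta>}" using assms by (auto simp: full_tree_def)
    then have "{i. v @ [i] \<in> T} = {..<\<delta>}" using x vi by auto
    then show "x \<in> (\<lambda>(v, i). v @ [i]) ` (?I \<times> {..<\<delta>})" using \<open>v \<in> T\<close> vi x by auto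
  qed auto
  moreover have "card ((\<lambda>(v, i). v @ [i]) ` (?I \<times> {..<\<delta>})) = card (?I \<times> {..<\<delta>})"
    by (intro card_image) (auto simp: inj_on_def)
  ultimately have "card (T - {[]}) = \<delta> * card ?I" by (simp add: card_cartesian_product mult.commute)
  moreover have "[] \<in> T" using assms by (simp add: full_tree_def)
  ultimately have "card T = 1 + \<delta> * card ?I" using fin by (metis card.remove plus_1_eq_Suc)
  then show ?thesis by blast
qed

subsection \<open>Padding\<close>

definition comb :: "nat \<Rightarrow> nat \<Rightarrow> vertex set" where
  "comb \<delta> q = cat \<delta> (replicate q (0, \<lambda>_. {[]})) {[]}"

lemma full_tree_comb: "0 < \<delta> \<Longrightarrow> full_tree \<delta> (comb \<delta> q)"
  unfolding comb_def by (intro full_tree_cat items_all_replicate full_tree_leaf)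

lemma card_cat_eq:
  assumes "items_all \<delta> finite ps" "finite E"
  shows "finite (cat \<delta> ps E) \<and> card (cat \<delta> ps E) + 1 = card (cat \<delta> ps {[]}) + card E"
  using assms
proof (induction ps)
  case (Cons p ps)
  let ?F = "\<lambda>E. (snd p)(fst p := cat \<delta> ps E)"
  have IH: "finite (cat \<delta> ps E)" "card (cat \<delta> ps E) + 1 = card (cat \<delta> ps {[]}) + card E"
    using Cons by auto
  have fin0: "finite (cat \<delta> ps {[]})"
    using Cons.prems(1) by (induction ps) (auto intro!: finite_node)
  have f: "j < \<delta> \<Longrightarrow> finite (?F E j)" "j < \<delta> \<Longrightarrow> finite (?F {[]} j)" for j using Cons.prems IH fin0 by auto
  have p: "fst p \<in> {..<\<delta>}" using Cons.prems by simp
  have "(\<Sum>j<\<delta>. card (?F E j)) = card (cat \<delta> ps E) + (\<Sum>j\<in>{..<\<delta>} - {fst p}. card (snd p j))" for E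
    using sum.remove[OF _ p, of "\<lambda>j. card (?F E j)"] by simp
  then show ?case using finite_node[of \<delta> "?F E"] finite_node[of \<delta> "?F {[]}"] f IH(2) by simp
qed simp

lemma card_comb: "0 < \<delta> \<Longrightarrow> card (comb \<delta> q) = 1 + \<delta> * q"
proof (induction q)
  case (Suc q)
  have "comb \<delta> (Suc q) = cat \<delta> [(0, \<lambda>_. {[]})] (comb \<delta> q)" by (simp add: comb_def)
  moreover have "finite (comb \<delta> q)" using full_tree_comb Suc.prems by (auto simp: full_tree_def)
  moreover have "card (cat \<delta> [(0, \<lambda>_. {[]})] {[]}) = 1 + \<delta>"
    using finite_node[of \<delta> "(\<lambda>_. {[]})(0 := {[]})"] by simp
  ultimately show ?case using card_cat_eq[of \<delta> "[(0, \<lambda>_. {[]})]" "comb \<delta> q"] Suc by simp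
qed (simp add: comb_def)

text \<open>Full trees have \<open>1 + \<delta> * m\<close> vertices, so what is missing is a
  multiple of \<open>\<delta>\<close>, and a comb replacing the last leaf supplies it.\<close>

lemma padding_exists:
  assumes "items_all \<delta> (full_tree \<delta>) ps" "card (cat \<delta> ps {[]}) \<le> n" "n = 1 + \<delta> * m" "0 < \<delta>"
  shows "\<exists>q. card (cat \<delta> ps (comb \<delta> q)) = n"
proof -
  obtain m' where m': "card (cat \<delta> ps {[]}) = 1 + \<delta> * m'"
    using full_tree_card[OF full_tree_cat[OF assms(1) full_tree_leaf]] by blast
  have "items_all \<delta> finite ps" by (rule items_all_mono[OF assms(1)]) (simp add: full_tree_def)
  moreover have "finite (comb \<delta> (m - m'))" using full_tree_comb assms(4) by (auto simp: full_tree_def)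
  ultimately have "card (cat \<delta> ps (comb \<delta> (m - m'))) + 1 = 1 + \<delta> * m' + (1 + \<delta> * (m - m'))"
    using card_cat_eq card_comb assms(4) m' by metis
  moreover have "m' \<le> m" using assms m' by simp
  ultimately show ?thesis using assms(3) by (intro exI[of _ "m - m'"]) (simp add: diff_mult_distrib2)
qed

subsection \<open>Truncation\<close>

definition trunc :: "nat \<Rightarrow> vertex set \<Rightarrow> vertex set" where
  "trunc M X = {x \<in> X. length x \<le> M}"

text \<open>The bound is a depth below the top of the spine, so it shrinks by one for every spine
  vertex passed.\<close>

primrec ctrunc :: "nat \<Rightarrow> item list \<Rightarrow> item list" where
  "ctrunc M [] = []"
| "ctrunc M (p # ps) = (fst p, \<lambda>j. trunc (M - 1) (snd p j)) # ctrunc (M - 1) ps"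

lemma length_ctrunc [simp]: "length (ctrunc M ps) = length ps"
  by (induction ps arbitrary: M) auto

lemma spine_ctrunc [simp]: "spine (ctrunc M ps) = spine ps"
  by (induction ps arbitrary: M) auto

lemma full_tree_trunc:
  assumes "full_tree \<delta> X"
  shows "full_tree \<delta> (trunc M X)"
proof -
  have "{i. v @ [i] \<in> trunc M X} = {} \<or> {i. v @ [i] \<in> trunc M X} = {..<\<delta>}" if "v \<in> X" for v
  proof (cases "length v < M")
    case True
    then have "{i. v @ [i] \<in> trunc M X} = {i. v @ [i] \<in> X}" by (auto simp: trunc_def)
    then show ?thesis using assms that by (auto simp: full_tree_def)
  qed (auto simp: trunc_def)
  then show ?thesis using assms by (fastforce simp: full_tree_def trunc_def)
qed

lemma trunc_node: "trunc (Suc M) (node \<delta> F) = node \<delta> (\<lambda>j. trunc M (F j))"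
  by (auto simp: trunc_def node_def)

lemma trunc_cat: "length ps \<le> M \<Longrightarrow> trunc M (cat \<delta> ps E) = cat \<delta> (ctrunc M ps) (trunc (M - length ps) E)"
proof (induction ps arbitrary: M)
  case (Cons p ps)
  then obtain M' where M': "M = Suc M'" by (cases M) auto
  have "trunc M' (cat \<delta> ps E) = cat \<delta> (ctrunc M' ps) (trunc (M' - length ps) E)"
    using Cons M' by simp
  then have "(\<lambda>j. trunc M' (((snd p)(fst p := cat \<delta> ps E)) j)) =
      (\<lambda>j. trunc M' (snd p j))(fst p := cat \<delta> (ctrunc M' ps) (trunc (M' - length ps) E))"
    by (intro ext) simp
  then show ?case by (simp add: M' trunc_node)
qed simp

lemma items_all_ctrunc:
  assumes "items_all \<delta> P ps" "\<And>X M'. P X \<Longrightarrow> M - length ps \<le> M' \<Longrightarrow> M' \<le> M \<Longrightarrow> Q (trunc M' X)"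
  shows "items_all \<delta> Q (ctrunc M ps)"
  using assms
proof (induction ps arbitrary: M)
  case (Cons p ps)
  have "items_all \<delta> Q (ctrunc (M - 1) ps)"
    using Cons.prems(1) by (intro Cons.IH Cons.prems(2)) auto
  moreover have "Q (trunc (M - 1) (snd p j))" if "j < \<delta>" "j \<noteq> fst p" for j
    using Cons.prems that by auto
  ultimately show ?case using Cons.prems(1) by simp
qed simp

lemma trunc_cat_subset:
  "trunc M (cat \<delta> ps E) \<subseteq> cat \<delta> (map (\<lambda>p. (fst p, \<lambda>j. trunc M (snd p j))) ps) (trunc M E)"
proof (induction ps)
  case (Cons p ps)
  show ?case
  proof
    fix x assume "x \<in> trunc M (cat \<delta> (p # ps) E)"
    then show "x \<in> cat \<delta> (map (\<lambda>p. (fst p, \<lambda>j. trunc M (snd p j))) (p # ps)) (trunc M E)"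
      using Cons by (cases x) (auto simp: trunc_def subset_iff split: if_splits)
  qed
qed simp

text \<open>Cutting every hanging tree at the full depth \<open>M\<close>, regardless of where it
  hangs, keeps too much but needs no bookkeeping of depths.\<close>

lemma card_trunc_cat_le:
  assumes "items_all \<delta> (\<lambda>X. finite X \<and> card (trunc M X) \<le> a) ps" "finite E"
  shows "card (trunc M (cat \<delta> ps E)) \<le> length ps * (1 + \<delta> * a) + card (trunc M E)"
proof -
  let ?ps = "map (\<lambda>p. (fst p, \<lambda>j. trunc M (snd p j))) ps"
  have "items_all \<delta> (\<lambda>X. finite X \<and> card X \<le> a) ?ps"
    using assms(1) by (induction ps) (auto simp: trunc_def)
  moreover have "finite (trunc M E)" using assms(2) by (simp add: trunc_def)
  ultimately have "finite (cat \<delta> ?ps (trunc M E))"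
    "card (cat \<delta> ?ps (trunc M E)) \<le> length ?ps * (1 + \<delta> * a) + card (trunc M E)"
    using card_cat_le by blast+
  then show ?thesis using card_mono[OF _ trunc_cat_subset[of M \<delta> ps E]] by simp
qed

text \<open>The bound does not involve \<open>q\<close>: arbitrarily long padding stays small for
  \<open>rich\<close>, which measures truncated trees only.\<close>

lemma card_trunc_comb: "0 < \<delta> \<Longrightarrow> card (trunc M (comb \<delta> q)) \<le> 1 + \<delta> * M"
proof (induction M arbitrary: q)
  case 0
  have "trunc 0 (comb \<delta> q) \<subseteq> {[]}" by (auto simp: trunc_def)
  then have "card (trunc 0 (comb \<delta> q)) \<le> card {[] :: vertex}" by (intro card_mono) auto
  then show ?case by simp
next
  case (Suc M)
  note d = Suc.prems
  show ?case
  proof (cases q)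
    case 0
    have "trunc (Suc M) (comb \<delta> q) \<subseteq> {[]}" using 0 by (auto simp: trunc_def comb_def)
    then have "card (trunc (Suc M) (comb \<delta> q)) \<le> card {[] :: vertex}" by (intro card_mono) auto
    then show ?thesis by simp
  next
    case (Suc q')
    let ?it = "(0, \<lambda>_. {[]}) :: item"
    have fin: "finite (comb \<delta> q')" using full_tree_comb Suc.prems by (auto simp: full_tree_def)
    have "comb \<delta> q = cat \<delta> [?it] (comb \<delta> q')" by (simp add: comb_def Suc)
    moreover have "trunc M {[]} = {[]}" by (auto simp: trunc_def)
    ultimately have "trunc (Suc M) (comb \<delta> q) = cat \<delta> [(0, \<lambda>_. {[]})] (trunc M (comb \<delta> q'))"
      using trunc_cat[of "[?it]" "Suc M" \<delta> "comb \<delta> q'"] by simp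
    moreover have "finite (trunc M (comb \<delta> q'))" using fin by (simp add: trunc_def)
    moreover have "card (cat \<delta> [?it] {[]}) = 1 + \<delta>"
      using finite_node[of \<delta> "(\<lambda>_. {[]})(0 := {[]})"] by simp
    ultimately have "card (trunc (Suc M) (comb \<delta> q)) + 1 = 1 + \<delta> + card (trunc M (comb \<delta> q'))"
      using card_cat_eq[of \<delta> "[?it]" "trunc M (comb \<delta> q')"] d by simp
    then show ?thesis using Suc.IH[OF d, of q'] by simp
  qed
qed

subsection \<open>Moving windows between instances\<close>

lemma transplant_ids:
  fixes T T' :: "vertex set" and ids :: "vertex \<Rightarrow> nat"
  assumes "finite T'" "card T' = n" "inj_on ids T" "ids ` T \<subseteq> {1..n}"
    and in_trees: "\<And>w z. w \<in> W \<Longrightarrow> z \<in> Z w \<Longrightarrow> q w @ z \<in> T' \<and> p w @ z \<in> T"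
    and eq: "\<And>w w' z z'. w \<in> W \<Longrightarrow> w' \<in> W \<Longrightarrow> z \<in> Z w \<Longrightarrow> z' \<in> Z w' \<Longrightarrow>
      q w @ z = q w' @ z' \<longleftrightarrow> p w @ z = p w' @ z'"
  obtains ids' where "inj_on ids' T'" "ids' ` T' \<subseteq> {1..n}"
    "\<And>w z. w \<in> W \<Longrightarrow> z \<in> Z w \<Longrightarrow> ids' (q w @ z) = ids (p w @ z)"
proof -
  define R where "R = {q w @ z |w z. w \<in> W \<and> z \<in> Z w}"
  define f where "f = (\<lambda>y. ids (SOME x. \<exists>w z. w \<in> W \<and> z \<in> Z w \<and> y = q w @ z \<and> x = p w @ z))"
  have f: "f (q w @ z) = ids (p w @ z)" if "w \<in> W" "z \<in> Z w" for w z
  proof -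
    have "(SOME x. \<exists>w' z'. w' \<in> W \<and> z' \<in> Z w' \<and> q w @ z = q w' @ z' \<and> x = p w' @ z') = p w @ z"
    proof (rule some_equality)
      fix x assume "\<exists>w' z'. w' \<in> W \<and> z' \<in> Z w' \<and> q w @ z = q w' @ z' \<and> x = p w' @ z'"
      then show "x = p w @ z" using that eq by metis
    qed (use that in blast)
    then show ?thesis by (simp add: f_def)
  qed
  have RT: "R \<subseteq> T'" using in_trees by (auto simp: R_def)
  then have finR: "finite R" using assms(1) finite_subset by blast
  have injR: "inj_on f R"
  proof (rule inj_onI)
    fix y y' assume "y \<in> R" "y' \<in> R" "f y = f y'"
    then obtain w z w' z' where *: "w \<in> W" "z \<in> Z w" "y = q w @ z" "w' \<in> W" "z' \<in> Z w'" "y' = q w' @ z'"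
      by (auto simp: R_def)
    then have "ids (p w @ z) = ids (p w' @ z')" using \<open>f y = f y'\<close> f by simp
    then have "p w @ z = p w' @ z'" using assms(3) in_trees * by (meson inj_onD)
    then show "y = y'" using eq * by blast
  qed
  have fR: "f ` R \<subseteq> {1..n}"
  proof
    fix b assume "b \<in> f ` R"
    then obtain w z where "w \<in> W" "z \<in> Z w" "b = ids (p w @ z)" using f by (auto simp: R_def)
    then show "b \<in> {1..n}" using assms(4) in_trees by blast
  qed
  have "card (T' - R) = card ({1..n} - f ` R)"
    using card_Diff_subset[OF finR RT] card_Diff_subset[OF _ fR] finR assms(2) card_image[OF injR] by simp
  then obtain h where h: "bij_betw h (T' - R) ({1..n} - f ` R)"
    using assms(1) by (metis finite_Diff finite_atLeastAtMost finite_same_card_bij)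
  define ids' where "ids' = (\<lambda>y. if y \<in> R then f y else h y)"
  have hR: "h y \<in> {1..n} - f ` R" if "y \<in> T' - R" for y using h that by (auto simp: bij_betw_def)
  show ?thesis
  proof
    show "inj_on ids' T'"
    proof (rule inj_onI)
      fix y y' assume y: "y \<in> T'" "y' \<in> T'" "ids' y = ids' y'"
      consider "y \<in> R" "y' \<in> R" | "y \<in> R" "y' \<notin> R" | "y \<notin> R" "y' \<in> R" | "y \<notin> R" "y' \<notin> R" by blast
      then show "y = y'"
      proof cases
        case 1
        then show ?thesis using y injR by (auto simp: ids'_def dest: inj_onD)
      next
        case 4
        then show ?thesis using y h by (auto simp: ids'_def bij_betw_def dest: inj_onD)
      next
        case 2
        then have "f y = h y'" "h y' \<notin> f ` R" using y hR[of y'] by (auto simp: ids'_def)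
        then show ?thesis using 2 by (metis imageI)
      next
        case 3
        then have "f y' = h y" "h y \<notin> f ` R" using y hR[of y] by (auto simp: ids'_def)
        then show ?thesis using 3 by (metis imageI)
      qed
    qed
    show "ids' ` T' \<subseteq> {1..n}" using fR hR by (fastforce simp: ids'_def)
    show "ids' (q w @ z) = ids (p w @ z)" if "w \<in> W" "z \<in> Z w" for w z
      using f that by (auto simp: ids'_def R_def)
  qed
qed

lemma max_vertex_degree:
  assumes "full_tree \<delta> T" "[i, j] \<in> T"
  shows "Max (vertex_degree T ` T) = \<delta> + 1"
proof (rule Max_eqI)
  show "finite (vertex_degree T ` T)" using assms(1) by (auto simp: full_tree_def)
  show "d \<le> \<delta> + 1" if d: "d \<in> vertex_degree T ` T" for d
  proof -
    obtain v where v: "v \<in> T" "d = vertex_degree T v" using d by blast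
    then show ?thesis using full_tree_children(2)[OF assms(1) v(1)] by (auto simp: vertex_degree_def)
  qed
  have i: "[i] \<in> T" using full_tree_prefix_closed[OF assms(1), of "[i]" "[j]"] assms(2) by simp
  have "[i] @ [j] \<in> T" using assms(2) by simp
  then have "num_children T [i] = \<delta>" using full_tree_children[OF assms(1) i] by (metis gr_implies_not0)
  then have "vertex_degree T [i] = \<delta> + 1" by (simp add: vertex_degree_def)
  then show "\<delta> + 1 \<in> vertex_degree T ` T" using i by force
qed

text \<open>The window consists of the vertices \<open>p @ z\<close> such that \<open>z\<close> does not pass the lower pole
  \<open>s\<close>; a vertex that is more than \<open>t\<close> away from both poles cannot distinguish the two trees.\<close>

lemma sim_window:
  assumes T: "full_tree \<delta> T" "full_tree \<delta> T'" "card T = card T'"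
    and deg: "Max (vertex_degree T ` T) = Max (vertex_degree T' ` T')"
    and mem: "\<And>z. length z \<le> M \<Longrightarrow> \<not> strict_prefix s z \<Longrightarrow> p @ z \<in> T \<longleftrightarrow> p' @ z \<in> T'"
    and ids: "\<And>z. length z \<le> M \<Longrightarrow> \<not> prefix s z \<Longrightarrow> p @ z \<in> T \<Longrightarrow> ids (p @ z) = ids' (p' @ z)"
    and s: "p @ s \<in> T" "t < D" "D + t < M" "D + t + 1 < length s"
  shows "sim t T ids (p @ take D s) T' ids' (p' @ take D s)"
proof -
  \<comment> \<open>Generalised to all vertices around the middle: \<open>r < length z\<close> keeps
    the neighbourhood of radius \<open>r\<close> below the upper pole, the prefix condition keeps it
    clear of the lower pole, and \<open>length z + r < M\<close> keeps it above the depth up to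
    which the trees agree.\<close>
  have *: "sim r T ids (p @ z) T' ids' (p' @ z)"
    if "r \<le> t" "r < length z" "length z + r < M" "\<not> prefix (take (length s - 1 - r) s) z" "p @ z \<in> T" for r z
    using that
  proof (induction r arbitrary: z)
    case 0
    have npre: "\<not> prefix s z" using 0(4) prefix_order.trans[OF take_is_prefix] by blast
    have "\<not> strict_prefix s (z @ [i])" for i using npre by (auto simp: strict_prefix_def)
    then have "p @ z @ [i] \<in> T \<longleftrightarrow> p' @ z @ [i] \<in> T'" for i using mem[of "z @ [i]"] 0(3) by simp
    then have nc: "num_children T (p @ z) = num_children T' (p' @ z)" by (simp add: num_children_def)
    show ?case using nc ids[of z] npre 0 T(3) deg
      by (auto simp: initial_knowledge_def vertex_degree_def)
  next
    case (Suc r)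
    have le: "take (length s - 1 - Suc r) s = take (length s - 1 - Suc r) (take (length s - 1 - r) s)" by simp
    have mono: "\<not> prefix (take (length s - 1 - r) s) y" if "\<not> prefix (take (length s - 1 - Suc r) s) y" for y
      using that le take_is_prefix prefix_order.trans by metis
    have "sim r T ids (p @ z) T' ids' (p' @ z)" using Suc mono by auto
    moreover have "sim r T ids (p @ butlast z) T' ids' (p' @ butlast z)"
    proof (rule Suc.IH)
      show "\<not> prefix (take (length s - 1 - r) s) (butlast z)"
        using mono[OF Suc.prems(4)] prefixeq_butlast prefix_order.trans by blast
      have "z \<noteq> []" using Suc.prems(2) by auto
      then have "p @ z = (p @ butlast z) @ [last z]" by simp
      then show "p @ butlast z \<in> T" using Suc.prems(5) full_tree_prefix_closed[OF T(1)] by metis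
    qed (use Suc.prems in auto)
    moreover have "sim r T ids (p @ z @ [i]) T' ids' (p' @ z @ [i])" if i: "i < num_children T (p @ z)" for i
    proof (rule Suc.IH)
      show "p @ z @ [i] \<in> T" using full_tree_children[OF T(1) Suc.prems(5)] i by simp
      show "\<not> prefix (take (length s - 1 - r) s) (z @ [i])"
      proof
        assume pre: "prefix (take (length s - 1 - r) s) (z @ [i])"
        have q: "length s - 1 - r = Suc (length s - 1 - Suc r)" using s Suc.prems(1) by simp
        from pre have "take (length s - 1 - r) s = z @ [i] \<or> prefix (take (length s - 1 - r) s) z" by simp
        then have "prefix (take (length s - 1 - Suc r) s) z"
        proof
          assume e: "take (length s - 1 - r) s = z @ [i]"
          have "length z = length s - 1 - Suc r" using arg_cong[OF e, of length] q by simp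
          moreover have "take (length s - 1 - Suc r) s = take (length s - 1 - Suc r) (z @ [i])"
            using le e by metis
          ultimately have "take (length s - 1 - Suc r) s = z" by simp
          then show ?thesis by simp
        qed (use mono in blast)
        then show False using Suc.prems(4) by blast
      qed
    qed (use Suc.prems in auto)
    moreover have "z \<noteq> []" using Suc.prems(2) by auto
    ultimately show ?case by (simp add: butlast_append)
  qed
  have "\<not> prefix (take (length s - 1 - t) s) (take D s)"
    using s by (auto dest: prefix_length_le)
  moreover have "p @ take D s \<in> T"
    using full_tree_prefix_closed[OF T(1), of "p @ take D s" "drop D s"] s(1) by simp
  ultimately show ?thesis using s by (intro *) auto
qed

section \<open>The polynomial lower bound\<close>

primrec spine_tree :: "nat \<Rightarrow> nat \<Rightarrow> nat \<Rightarrow> vertex set" where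
  "spine_tree \<delta> D 0 = {[]}"
| "spine_tree \<delta> D (Suc i) = cat \<delta> (replicate D (0, \<lambda>_. spine_tree \<delta> D i)) {[]}"

text \<open>The recursion pays for one turn of the path: what is left of a main path with at most
  \<open>10 * D + 1\<close> items becomes a hanging tree, and its padding comb, cut at depth
  \<open>k * Suc D + 2 * D\<close>, contributes the last summands.\<close>

primrec size_bound :: "nat \<Rightarrow> nat \<Rightarrow> nat \<Rightarrow> nat \<Rightarrow> nat" where
  "size_bound \<delta> D k 0 = card (spine_tree \<delta> D k)"
| "size_bound \<delta> D k (Suc r) =
     (10 * D + 1) * (1 + \<delta> * size_bound \<delta> D k r) + 1 + \<delta> * (k * Suc D + 2 * D)"

lemma full_tree_spine_tree: "0 < \<delta> \<Longrightarrow> full_tree \<delta> (spine_tree \<delta> D i)"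
  by (induction i) (auto intro!: full_tree_cat items_all_replicate full_tree_leaf)

text \<open>For \<open>\<delta> = 1\<close> nothing hangs off a spine and all positive levels are
  the same path. Otherwise a copy of the tree of level \<open>j\<close> sits at port 1 of the root
  of level \<open>j + 1\<close>.\<close>

lemma card_spine_tree_mono:
  assumes "0 < \<delta>" "0 < D" "i \<le> j"
  shows "card (spine_tree \<delta> D i) \<le> card (spine_tree \<delta> D j)"
  using assms(3)
proof (induction j rule: dec_induct)
  case (step j)
  obtain D' where D: "D = Suc D'" using assms(2) by (cases D) auto
  have fin: "finite (spine_tree \<delta> D j)" "finite (spine_tree \<delta> D (Suc j))"
    using full_tree_spine_tree[OF assms(1)] by (auto simp: full_tree_def simp del: spine_tree.simps)
  show ?case
  proof (cases "\<delta> = 1")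
    case True
    have "x \<in> cat 1 (replicate m (0, F)) E \<Longrightarrow> x \<in> cat 1 (replicate m (0, F')) E" for m x F F' E
      by (induction m arbitrary: x) (auto simp: node_def)
    then have same: "spine_tree 1 D (Suc i) = cat 1 (replicate D (0, F)) {[]}" for F i by auto
    have "spine_tree 1 D j \<subseteq> spine_tree 1 D (Suc j)"
      using same by (cases j) (auto simp: D)
    then show ?thesis using step.IH True fin by (meson card_mono le_trans)
  next
    case False
    have "(#) 1 ` spine_tree \<delta> D j \<subseteq> spine_tree \<delta> D (Suc j)" using False assms(1) by (auto simp: D)
    then have "card ((#) 1 ` spine_tree \<delta> D j) \<le> card (spine_tree \<delta> D (Suc j))" using fin by (intro card_mono)
    moreover have "card ((#) 1 ` spine_tree \<delta> D j) = card (spine_tree \<delta> D j)" by (intro card_image) simp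
    ultimately show ?thesis using step.IH by simp
  qed
qed simp

lemma size_bound_mono:
  assumes "0 < \<delta>" "r \<le> r'"
  shows "size_bound \<delta> D k r \<le> size_bound \<delta> D k r'"
  using assms(2)
proof (induction r' rule: dec_induct)
  case (step r')
  have "size_bound \<delta> D k r' \<le> \<delta> * size_bound \<delta> D k r'" using assms(1) by simp
  also have "\<dots> \<le> (10 * D + 1) * (1 + \<delta> * size_bound \<delta> D k r')" by (simp add: algebra_simps)
  also have "\<dots> \<le> size_bound \<delta> D k (Suc r')" by simp
  finally show ?case using step.IH by simp
qed simp

lemma mult_split:
  fixes c :: nat
  shows "g \<le> k \<Longrightarrow> c * Suc k = c * g + (c + c * (k - g))"
  by (auto simp: algebra_simps elim: less_eqE)

lemma mult_split_less:
  fixes c :: nat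
  shows "g < k \<Longrightarrow> c * k = c * g + (c + c * (k - g - 1))"
  using mult_split[of g "k - 1" c] by simp

text \<open>Identifiers from \<open>{1..n}\<close> are allowed for every exponent of the model, and
  a single size \<open>n\<close> at which the algorithm is fast is all that the argument
  takes.\<close>

locale fast_algorithm =
  fixes \<P> :: lcl and A :: algorithm and n t :: nat
  assumes lcl: "is_lcl \<P>"
    and sol: "(T, ids) \<in> instances 1 (arity \<P>) n \<Longrightarrow> is_solution \<P> T (output_label A T ids)"
    and fast: "(T, ids) \<in> instances 1 (arity \<P>) n \<Longrightarrow> v \<in> T \<Longrightarrow> \<exists>r\<le>t. decision_at A T ids v r \<noteq> None"
begin

text \<open>The middle of a window of length \<open>2 * D\<close> needs \<open>t < D\<close> and
  \<open>D + t + 1 < 2 * D\<close> to be out of sight of both poles.\<close>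

definition "D = t + 2"
definition "k = card (labels \<P>)"
text \<open>A rich tree of level \<open>i\<close> stays rich when cut at depth
  \<open>i * Suc D\<close>: every level uses \<open>D\<close> spine vertices and one step into a
  hanging tree. The \<open>2 * D\<close> is the spine of the window from which the trees
  hang.\<close>

definition "M = k * Suc D + 2 * D"

abbreviation "\<delta> \<equiv> arity \<P>"
abbreviation "out \<equiv> output_label A"
abbreviation "bnd i \<equiv> size_bound \<delta> D k (k - i)"

text \<open>
  The trees \<open>X\<close> with \<open>rich i X\<close> may hang off a spine of level \<open>i\<close>. Only their part up to
  depth \<open>M\<close> has to be small: the remainder of the current spine has to be admissible as well when the
  path turns off into another tree.
\<close>

primrec rich :: "nat \<Rightarrow> vertex set \<Rightarrow> bool" where
  "rich 0 X \<longleftrightarrow> full_tree \<delta> X \<and> card (trunc M X) \<le> bnd 0"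
| "rich (Suc i) X \<longleftrightarrow> full_tree \<delta> X \<and> card (trunc M X) \<le> bnd (Suc i) \<and>
     (\<exists>qs E. X = cat \<delta> qs E \<and> length qs = D \<and> full_tree \<delta> E \<and> items_all \<delta> (rich i) qs)"

text \<open>Pruning of labels instead of configurations: it is stable after as many rounds as there
  are labels, which fixes the number \<open>k\<close> of levels.\<close>

primrec \<Sigma> :: "nat \<Rightarrow> nat set" where
  "\<Sigma> 0 = labels \<P>"
| "\<Sigma> (Suc i) = {a \<in> \<Sigma> i. flexible (inner_edges \<P> (\<Sigma> i)) a}"

lemma \<delta>_pos: "0 < \<delta>" using lcl by (auto simp: is_lcl_def)

lemma D_pos: "0 < D" by (simp add: D_def)

lemma rich_full_tree: "rich i X \<Longrightarrow> full_tree \<delta> X"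
  by (cases i) auto

lemma rich_card: "rich i X \<Longrightarrow> card (trunc M X) \<le> bnd i"
  by (cases i) auto

lemma rich_Suc: "rich (Suc i) X \<Longrightarrow> rich i X"
proof (induction i arbitrary: X)
  case 0
  have "bnd (Suc 0) \<le> bnd 0" by (intro size_bound_mono \<delta>_pos) auto
  then show ?case using 0 by simp
next
  case (Suc i)
  have b: "bnd (Suc (Suc i)) \<le> bnd (Suc i)" by (intro size_bound_mono \<delta>_pos) auto
  from Suc.prems obtain qs E where "X = cat \<delta> qs E" "length qs = D" "full_tree \<delta> E" "items_all \<delta> (rich (Suc i)) qs"
    unfolding rich.simps(2)[of "Suc i"] by blast
  moreover from this(4) have "items_all \<delta> (rich i) qs" by (rule items_all_mono) (rule Suc.IH)
  ultimately show ?case using b rich_full_tree[OF Suc.prems] rich_card[OF Suc.prems] unfolding rich.simps(2)[of i]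
    by (intro conjI) (auto intro: le_trans)
qed

lemma finite_full_tree: "full_tree \<delta> X \<Longrightarrow> finite X"
  by (simp add: full_tree_def)

lemma card_trunc_trunc: "full_tree \<delta> X \<Longrightarrow> card (trunc M' (trunc M'' X)) \<le> card (trunc M' X)"
  by (intro card_mono) (auto simp: trunc_def finite_full_tree)

lemma rich_trunc: "rich i X \<Longrightarrow> i * Suc D \<le> M' \<Longrightarrow> rich i (trunc M' X)"
proof (induction i arbitrary: X M')
  case 0
  then show ?case using full_tree_trunc card_trunc_trunc[of X M M'] by (auto intro: le_trans)
next
  case (Suc i)
  from Suc.prems obtain qs E where X: "X = cat \<delta> qs E" "length qs = D" "full_tree \<delta> E" "items_all \<delta> (rich i) qs"
    by auto
  have DM: "D + i * Suc D \<le> M'" using Suc.prems(2) by simp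
  then have "trunc M' X = cat \<delta> (ctrunc M' qs) (trunc (M' - D) E)" using trunc_cat[of qs M' \<delta> E] X by simp
  moreover have "items_all \<delta> (rich i) (ctrunc M' qs)"
    by (rule items_all_ctrunc[OF X(4)]) (use DM X(2) Suc.IH in auto)
  moreover have "full_tree \<delta> (trunc M' X)" "full_tree \<delta> (trunc (M' - D) E)"
    using full_tree_trunc Suc.prems X(3) by auto
  moreover have "card (trunc M (trunc M' X)) \<le> bnd (Suc i)"
    using card_trunc_trunc[of X M M'] Suc.prems(1) by auto
  ultimately show ?case using X(2) unfolding rich.simps(2)
    by (intro conjI exI[of _ "ctrunc M' qs"] exI[of _ "trunc (M' - D) E"]) auto
qed

lemma rich_spine_tree: "i \<le> k \<Longrightarrow> rich i (spine_tree \<delta> D i)"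
proof (induction i)
  case 0
  have "trunc M {[]} \<subseteq> {[]}" by (auto simp: trunc_def)
  then have "card (trunc M {[]}) \<le> card {[] :: vertex}" by (intro card_mono) auto
  also have "\<dots> \<le> card (spine_tree \<delta> D k)" using card_spine_tree_mono[OF \<delta>_pos D_pos, of 0 k] by simp
  also have "\<dots> \<le> bnd 0" using size_bound_mono[OF \<delta>_pos, of 0 k D k] by simp
  finally show ?case using full_tree_leaf by simp
next
  case (Suc i)
  have full: "full_tree \<delta> (spine_tree \<delta> D (Suc i))" by (rule full_tree_spine_tree[OF \<delta>_pos])
  have "card (trunc M (spine_tree \<delta> D (Suc i))) \<le> card (spine_tree \<delta> D (Suc i))"
    using full by (intro card_mono finite_full_tree) (auto simp: trunc_def)
  also have "\<dots> \<le> card (spine_tree \<delta> D k)" using card_spine_tree_mono[OF \<delta>_pos D_pos Suc.prems] .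
  also have "\<dots> \<le> bnd (Suc i)" using size_bound_mono[OF \<delta>_pos, of 0 "k - Suc i" D k] by simp
  finally have "card (trunc M (spine_tree \<delta> D (Suc i))) \<le> bnd (Suc i)" .
  moreover have "items_all \<delta> (rich i) (replicate D (0, \<lambda>_. spine_tree \<delta> D i))"
    using Suc \<delta>_pos by (intro items_all_replicate) auto
  moreover have "\<exists>qs E. spine_tree \<delta> D (Suc i) = cat \<delta> qs E \<and> length qs = D \<and> full_tree \<delta> E \<and> items_all \<delta> (rich i) qs"
    using calculation(2) full_tree_leaf by (intro exI[of _ "replicate D (0, \<lambda>_. spine_tree \<delta> D i)"] exI[of _ "{[]}"]) auto
  ultimately show ?case using full unfolding rich.simps(2) by blast
qed

lemma rich_antimono: "i \<le> j \<Longrightarrow> rich j X \<Longrightarrow> rich i X"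
  by (induction j rule: dec_induct) (use rich_Suc in auto)

definition gitem :: item where
  "gitem = (0, \<lambda>_. spine_tree \<delta> D k)"

lemma items_all_gitem: "i \<le> k \<Longrightarrow> items_all \<delta> (rich i) (replicate m gitem)"
  unfolding gitem_def using rich_antimono[OF _ rich_spine_tree] \<delta>_pos by (intro items_all_replicate) auto

lemma items_full: "items_all \<delta> (rich i) ps \<Longrightarrow> items_all \<delta> (full_tree \<delta>) ps"
  by (erule items_all_mono) (rule rich_full_tree)

definition inst :: "item list \<Rightarrow> vertex set \<Rightarrow> (vertex \<Rightarrow> nat) \<Rightarrow> bool" where
  "inst L E ids \<longleftrightarrow> items_all \<delta> (full_tree \<delta>) L \<and> full_tree \<delta> E \<and> card (cat \<delta> L E) = n \<and>
     inj_on ids (cat \<delta> L E) \<and> ids ` cat \<delta> L E \<subseteq> {1..n}"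

lemma inst_instances: "inst L E ids \<Longrightarrow> (cat \<delta> L E, ids) \<in> instances 1 \<delta> n"
  using full_tree_cat by (auto simp: inst_def instances_def)

lemma instD:
  assumes "inst L E ids"
  shows "full_tree \<delta> (cat \<delta> L E)" "items_all \<delta> (full_tree \<delta>) L" "full_tree \<delta> E" "[] \<in> E" "card (cat \<delta> L E) = n"
proof -
  show *: "items_all \<delta> (full_tree \<delta>) L" "full_tree \<delta> E" "card (cat \<delta> L E) = n"
    using assms unfolding inst_def by blast+
  show "full_tree \<delta> (cat \<delta> L E)" using * by (intro full_tree_cat)
  show "[] \<in> E" using *(2) by (simp add: full_tree_def)
qed

text \<open>Nothing is required of the part above the window or of the tree below it beyond being
  full; this freedom allows the path to be rerouted into side trees.\<close>

definition claim :: "nat \<Rightarrow> bool" where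
  "claim i \<longleftrightarrow> (\<forall>ps1 ps2 E ids. length ps2 = 2 * D \<longrightarrow> items_all \<delta> (rich i) ps2 \<longrightarrow> inst (ps1 @ ps2) E ids \<longrightarrow>
     out (cat \<delta> (ps1 @ ps2) E) ids (spine ps1 @ take D (spine ps2)) \<in> \<Sigma> i)"

lemma window_label:
  assumes "inst (pre @ ps) E ids" "inst (pre' @ ps') E' ids'" "length ps = 2 * D" "spine ps' = spine ps"
    and mem: "\<And>z. length z \<le> M \<Longrightarrow> z \<in> cat \<delta> ps {} \<longleftrightarrow> z \<in> cat \<delta> ps' {}"
    and ids: "\<And>z. length z \<le> M \<Longrightarrow> z \<in> cat \<delta> ps' {} \<Longrightarrow> ids (spine pre @ z) = ids' (spine pre' @ z)"
  shows "out (cat \<delta> (pre @ ps) E) ids (spine pre @ take D (spine ps)) =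
    out (cat \<delta> (pre' @ ps') E') ids' (spine pre' @ take D (spine ps))"
proof -
  let ?T = "cat \<delta> (pre @ ps) E" and ?T' = "cat \<delta> (pre' @ ps') E'" and ?s = "spine ps"
  have full: "full_tree \<delta> ?T" "full_tree \<delta> ?T'" and card: "card ?T = card ?T'"
    and items: "items_all \<delta> (full_tree \<delta>) pre" "items_all \<delta> (full_tree \<delta>) ps"
      "items_all \<delta> (full_tree \<delta>) pre'" "items_all \<delta> (full_tree \<delta>) ps'" and E: "[] \<in> E" "[] \<in> E'"
    using instD[OF assms(1)] instD[OF assms(2)] by simp_all
  have len: "length ps' = 2 * D" using assms(3,4) by (metis length_map)
  \<comment> \<open>The maximum degree is part of the initial knowledge; a spine with at least two
    edges forces it to be \<open>\<delta> + 1\<close> in both trees.\<close>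
  have deg: "Max (vertex_degree (cat \<delta> (qre @ qs) F) ` cat \<delta> (qre @ qs) F) = \<delta> + 1"
    if q: "items_all \<delta> (full_tree \<delta>) (qre @ qs)" "full_tree \<delta> (cat \<delta> (qre @ qs) F)" "[] \<in> F" "length qs = 2 * D" for qre qs F
  proof -
    have "length (spine (qre @ qs)) = Suc (Suc (length qre + 2 * t + 2))" using q(4) by (simp add: D_def)
    then obtain i j y where y: "spine (qre @ qs) = i # j # y" by (metis length_Suc_conv)
    have "spine (qre @ qs) @ [] \<in> cat \<delta> (qre @ qs) F" using spine_in_cat[OF q(1)] q(3) by blast
    then have "[i, j] @ y \<in> cat \<delta> (qre @ qs) F" using y by simp
    then show ?thesis using max_vertex_degree[OF q(2)] full_tree_prefix_closed[OF q(2)] by blast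
  qed
  have memT: "spine pre @ z \<in> ?T \<longleftrightarrow> z \<in> cat \<delta> ps E" "spine pre' @ z \<in> ?T' \<longleftrightarrow> z \<in> cat \<delta> ps' E'" for z
    using spine_in_cat[OF items(1)] spine_in_cat[OF items(3)] by (auto simp: cat_append)
  have sE: "?s \<in> cat \<delta> ps E" "?s \<in> cat \<delta> ps' E'"
    using spine_in_cat[OF items(2), of "[]" E] spine_in_cat[OF items(4), of "[]" E'] E assms(4) by auto
  have "sim t ?T ids (spine pre @ take D ?s) ?T' ids' (spine pre' @ take D ?s)"
  proof (rule sim_window[OF full card, of M ?s])
    show "Max (vertex_degree ?T ` ?T) = Max (vertex_degree ?T' ` ?T')"
      using deg[of pre ps E] deg[of pre' ps' E'] items full E len assms(3) by simp
    show "spine pre @ z \<in> ?T \<longleftrightarrow> spine pre' @ z \<in> ?T'" if "length z \<le> M" "\<not> strict_prefix ?s z" for z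
    proof (cases "prefix ?s z")
      case True
      then have "z = ?s" using that(2) by (auto simp: strict_prefix_def)
      then show ?thesis using memT sE by simp
    next
      case False
      then show ?thesis unfolding memT
        using mem[OF that(1)] cat_empty[OF items(2), of z E] cat_empty[OF items(4), of z E'] assms(4) by simp
    qed
    show "ids (spine pre @ z) = ids' (spine pre' @ z)"
      if "length z \<le> M" "\<not> prefix ?s z" "spine pre @ z \<in> ?T" for z
      using ids[OF that(1)] mem[OF that(1)] that(2,3) memT(1) cat_empty[OF items(2), of z E] by blast
    show "spine pre @ ?s \<in> ?T" using memT sE by simp
  qed (use assms(3) in \<open>auto simp: D_def M_def\<close>)
  moreover have "spine pre @ take D ?s \<in> ?T"
    using memT(1)[of ?s] sE(1) full_tree_prefix_closed[OF full(1), of "spine pre @ take D ?s" "drop D ?s"] by simp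
  ultimately show ?thesis using fast[OF inst_instances[OF assms(1)]] sim_output_label by blast
qed

lemma claim_0: "claim 0"
  unfolding claim_def
proof (intro allI impI)
  fix ps1 ps2 :: "item list" and E ids
  assume *: "length ps2 = 2 * D" "inst (ps1 @ ps2) E ids"
  let ?T = "cat \<delta> (ps1 @ ps2) E"
  note full = instD(1,2,4)[OF *(2)]
  have "spine (ps1 @ ps2) @ [] \<in> ?T" using spine_in_cat[OF full(2)] full(3) by blast
  then have "(spine ps1 @ take D (spine ps2)) @ drop D (spine ps2) \<in> ?T" by simp
  then have "spine ps1 @ take D (spine ps2) \<in> ?T" using full_tree_prefix_closed[OF full(1)] by blast
  then show "out ?T ids (spine ps1 @ take D (spine ps2)) \<in> \<Sigma> 0"
    using sol[OF inst_instances[OF *(2)]] by (simp add: is_solution_def)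
qed

lemma main_path:
  assumes "claim i" "items_all \<delta> (rich i) L" "inst L E ids" "D \<le> j" "j + D \<le> length L"
  shows "out (cat \<delta> L E) ids (spine (take j L)) \<in> \<Sigma> i"
proof -
  let ?ps1 = "take (j - D) L" and ?ps2 = "take (2 * D) (drop (j - D) L)" and ?ps3 = "drop (j + D) L"
  have L: "L = ?ps1 @ ?ps2 @ ?ps3"
  proof -
    have "?ps2 @ ?ps3 = drop (j - D) L"
      using append_take_drop_id[of "2 * D" "drop (j - D) L"] assms(4) by (simp add: add.commute)
    then show ?thesis by simp
  qed
  have len: "length ?ps2 = 2 * D" using assms(4,5) by simp
  have items: "items_all \<delta> (rich i) ?ps2"
    by (rule items_all_subset[OF assms(2)]) (meson set_drop_subset set_take_subset subset_trans)
  have eq: "cat \<delta> L E = cat \<delta> (?ps1 @ ?ps2) (cat \<delta> ?ps3 E)" by (subst L) (simp only: cat_append append_assoc)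
  have all: "items_all \<delta> (full_tree \<delta>) (?ps1 @ ?ps2 @ ?ps3)" using assms(3) L by (simp add: inst_def)
  have "inst (?ps1 @ ?ps2) (cat \<delta> ?ps3 E) ids"
    using assms(3) all unfolding inst_def eq[symmetric] by (auto intro: full_tree_cat)
  then have "out (cat \<delta> L E) ids (spine ?ps1 @ take D (spine ?ps2)) \<in> \<Sigma> i"
    using assms(1) len items unfolding claim_def eq by blast
  moreover have "spine ?ps1 @ take D (spine ?ps2) = spine (take j L)"
  proof -
    have "take j L = take (j - D) L @ take D (drop (j - D) L)" using assms(4) by (metis take_add le_add_diff_inverse2)
    then show ?thesis by (simp add: take_map min_def)
  qed
  ultimately show ?thesis by simp
qed

text \<open>The path of length \<open>2 * D\<close> turns off the main path into the rich tree below a child, and what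
  remains of the main path becomes a rich tree off the new path.\<close>

lemma off_path:
  assumes "claim i" "items_all \<delta> (rich (Suc i)) L" "inst L (comb \<delta> q) ids" "D \<le> j" "j + D < length L"
    "length L \<le> 10 * D + 1" "c < \<delta>" "c \<noteq> fst (L ! j)" "i < k"
  shows "out (cat \<delta> L (comb \<delta> q)) ids (spine (take j L) @ [c]) \<in> \<Sigma> i"
proof -
  let ?E = "comb \<delta> q"
  let ?l = "fst (L ! j)" and ?F = "snd (L ! j)" and ?rest = "cat \<delta> (drop (Suc j) L) ?E"
  have L: "L = take j L @ L ! j # drop (Suc j) L" using assms(5) by (simp add: id_take_nth_drop)
  have "items_all \<delta> (rich (Suc i)) (take j L @ L ! j # drop (Suc j) L)" using assms(2) L by simp
  then have it: "items_all \<delta> (rich (Suc i)) (take j L)" "items_all \<delta> (rich (Suc i)) (drop (Suc j) L)"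
     "?l < \<delta>" "\<And>j'. j' < \<delta> \<Longrightarrow> j' \<noteq> ?l \<Longrightarrow> rich (Suc i) (?F j')" by auto
  have fullE: "full_tree \<delta> ?E" using full_tree_comb \<delta>_pos by blast
  obtain qs Ec where qs: "?F c = cat \<delta> qs Ec" "length qs = D" "full_tree \<delta> Ec" "items_all \<delta> (rich i) qs"
    using it(4)[OF assms(7,8)] by auto
  have full_rest: "full_tree \<delta> ?rest" using items_full[OF it(2)] fullE by (intro full_tree_cat)
  have "items_all \<delta> (\<lambda>X. finite X \<and> card (trunc M X) \<le> bnd (Suc i)) (drop (Suc j) L)"
    by (rule items_all_mono[OF it(2)]) (use rich_full_tree rich_card finite_full_tree in blast)
  then have "card (trunc M ?rest) \<le> length (drop (Suc j) L) * (1 + \<delta> * bnd (Suc i)) + card (trunc M ?E)"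
    using finite_full_tree[OF fullE] by (rule card_trunc_cat_le)
  also have "\<dots> \<le> (10 * D + 1) * (1 + \<delta> * bnd (Suc i)) + (1 + \<delta> * M)"
    using assms(6) card_trunc_comb[OF \<delta>_pos] by (intro add_mono mult_right_mono) auto
  also have "\<dots> = bnd i"
  proof -
    have "k - i = Suc (k - Suc i)" using assms(9) by simp
    then show ?thesis by (simp add: M_def)
  qed
  finally have card_rest: "card (trunc M ?rest) \<le> bnd i" .
  \<comment> \<open>By \<open>j + D < length L\<close> at least \<open>D\<close> spine items remain
    below the turn, so the rest of the main path has a spine of its own, as richness
    demands.\<close>
  have rich_rest: "rich i ?rest"
  proof (cases i)
    case (Suc i')
    let ?d = "drop (Suc j) L"
    have "?rest = cat \<delta> (take D ?d) (cat \<delta> (drop D ?d) ?E)" by (metis append_take_drop_id cat_append)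
    moreover have "length (take D ?d) = D" using assms(5) by simp
    moreover have "items_all \<delta> (rich (Suc i)) (take D ?d)" "items_all \<delta> (rich (Suc i)) (drop D ?d)"
      by (rule items_all_subset[OF it(2)], rule set_take_subset) (rule items_all_subset[OF it(2)], rule set_drop_subset)
    moreover from this(1) have "items_all \<delta> (rich i') (take D ?d)"
      by (rule items_all_mono) (use rich_antimono[of i' "Suc i"] Suc in auto)
    moreover have "full_tree \<delta> (cat \<delta> (drop D ?d) ?E)"
      using items_full[OF calculation(4)] fullE by (intro full_tree_cat)
    ultimately show ?thesis using full_rest card_rest unfolding Suc rich.simps(2) by blast
  qed (use full_rest card_rest in simp)
  let ?it = "(c, ?F(?l := ?rest))"
  have new_item: "items_all \<delta> (rich i) [?it]"
    using rich_rest it(4) rich_Suc assms(7) by auto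
  \<comment> \<open>The new window has \<open>D - 1\<close> old items, the turning vertex and the
    \<open>D\<close> items of the side tree, so its middle is the child \<open>c\<close>.\<close>
  let ?ps1 = "take (j - (D - 1)) L" and ?ps2 = "drop (j - (D - 1)) (take j L) @ ?it # qs"
  have ps: "?ps1 @ ?ps2 = take j L @ ?it # qs"
    using append_take_drop_id[of "j - (D - 1)" "take j L"] by (simp add: min_def)
  have F: "((?F(?l := ?rest))(c := cat \<delta> qs Ec)) = ?F(?l := ?rest)" using qs(1) assms(8) by (intro ext) simp
  have "cat \<delta> (?it # qs) Ec = cat \<delta> (L ! j # drop (Suc j) L) ?E" by (simp add: F del: fun_upd_apply)
  then have T: "cat \<delta> (?ps1 @ ?ps2) Ec = cat \<delta> L ?E"
    unfolding ps by (subst L) (simp only: cat_append)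
  have full_items: "items_all \<delta> (full_tree \<delta>) (?ps1 @ ?ps2)"
    unfolding ps using items_full[OF it(1)] items_full[OF new_item] items_full[OF qs(4)] by simp
  have inst: "inst (?ps1 @ ?ps2) Ec ids" using assms(3) full_items qs(3) unfolding inst_def T by blast
  have len: "length ?ps2 = 2 * D" using qs(2) assms(4,5) D_pos by simp
  have "items_all \<delta> (rich i) (take j L)" by (rule items_all_mono[OF it(1)]) (rule rich_Suc)
  then have "items_all \<delta> (rich i) (drop (j - (D - 1)) (take j L))"
    by (rule items_all_subset) (rule set_drop_subset)
  then have "items_all \<delta> (rich i) ?ps2" using new_item qs(4) by simp
  then have "out (cat \<delta> L ?E) ids (spine ?ps1 @ take D (spine ?ps2)) \<in> \<Sigma> i"
    using assms(1) len inst T unfolding claim_def by metis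
  moreover have "spine ?ps1 @ take D (spine ?ps2) = spine (take j L) @ [c]"
  proof -
    have l: "length (drop (j - (D - 1)) (take j L)) = D - 1" using assms(4,5) by simp
    then have "take D (spine ?ps2) = spine (drop (j - (D - 1)) (take j L)) @ [c]"
      using D_pos by (simp add: take_Cons')
    moreover have "?ps1 @ drop (j - (D - 1)) (take j L) = take j L"
      using append_take_drop_id[of "j - (D - 1)" "take j L"] by (simp add: min_def)
    then have "spine ?ps1 @ spine (drop (j - (D - 1)) (take j L)) = spine (take j L)"
      by (metis map_append)
    ultimately show ?thesis by simp
  qed
  ultimately show ?thesis by simp
qed

lemma inst_regroup: "inst (L @ L') E ids \<Longrightarrow> inst L (cat \<delta> L' E) ids"
  by (auto simp: inst_def cat_append intro: full_tree_cat)

lemma window_label_append: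
  assumes "inst (pre @ ps @ post) E ids" "inst (pre' @ ps' @ post') E' ids'" "length ps = 2 * D" "spine ps' = spine ps"
    and "\<And>z. length z \<le> M \<Longrightarrow> z \<in> cat \<delta> ps {} \<longleftrightarrow> z \<in> cat \<delta> ps' {}"
    and "\<And>z. length z \<le> M \<Longrightarrow> z \<in> cat \<delta> ps' {} \<Longrightarrow> ids (spine pre @ z) = ids' (spine pre' @ z)"
  shows "out (cat \<delta> (pre @ ps @ post) E) ids (spine pre @ take D (spine ps)) =
    out (cat \<delta> (pre' @ ps' @ post') E') ids' (spine pre' @ take D (spine ps))"
proof -
  have "inst (pre @ ps) (cat \<delta> post E) ids" "inst (pre' @ ps') (cat \<delta> post' E') ids'"
    using assms(1,2) inst_regroup[of "pre @ ps"] inst_regroup[of "pre' @ ps'"] by auto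
  from window_label[OF this assms(3-6)] show ?thesis by (simp add: cat_append)
qed

lemma window_mem:
  assumes "items_all \<delta> P (pre @ ps @ post)" "z \<in> cat \<delta> ps {}"
  shows "spine pre @ z \<in> cat \<delta> (pre @ ps @ post) E"
  using assms cat_empty[of \<delta> P ps z "cat \<delta> post E"] spine_in_cat[of \<delta> P pre z] by (simp add: cat_append)

lemma window_disjoint:
  assumes "items_all \<delta> P ps" "z \<in> cat \<delta> ps {}"
  shows "spine pre @ z \<noteq> spine (pre @ ps @ mid) @ z'"
proof
  assume "spine pre @ z = spine (pre @ ps @ mid) @ z'"
  then have "prefix (spine ps) z" by simp
  then show False using assms cat_empty[of \<delta> P ps z "{}"] by blast
qed

text \<open>The configuration used at the spine vertex has to lie within \<open>\<Sigma> i\<close>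
  as a whole: \<open>main_path\<close> covers the vertex and its spine child,
  \<open>off_path\<close> the other children.\<close>

lemma main_edge:
  assumes "claim i" "items_all \<delta> (rich (Suc i)) L" "inst L (comb \<delta> q) ids" "D \<le> j" "j + D < length L"
    "length L \<le> 10 * D + 1" "i < k"
  shows "(out (cat \<delta> L (comb \<delta> q)) ids (spine (take j L)),
    out (cat \<delta> L (comb \<delta> q)) ids (spine (take (Suc j) L))) \<in> inner_edges \<P> (\<Sigma> i)"
proof -
  let ?T = "cat \<delta> L (comb \<delta> q)" and ?w = "spine (take j L)" and ?l = "fst (L ! j)"
  let ?lab = "out ?T ids"
  have i_items: "items_all \<delta> (rich i) L" by (rule items_all_mono[OF assms(2)]) (rule rich_Suc)
  have j: "j < length L" using assms(5) by simp
  have next_spine: "spine (take (Suc j) L) = ?w @ [?l]" using j by (simp add: take_Suc_conv_app_nth)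
  have l: "?l < \<delta>" using assms(2) nth_mem[OF j] by (auto simp: items_all_def)
  note full = instD(1)[OF assms(3)] and items = instD(2)[OF assms(3)] and E = instD(4)[OF assms(3)]
  have "spine L @ [] \<in> ?T" using spine_in_cat[OF items] E by blast
  moreover have "spine L = (?w @ [?l]) @ spine (drop (Suc j) L)"
    using next_spine append_take_drop_id[of "Suc j" L] by (metis map_append)
  ultimately have "?w @ [?l] \<in> ?T" using full_tree_prefix_closed[OF full] by (metis append_Nil2)
  then have w: "?w \<in> ?T" using full_tree_prefix_closed[OF full] by blast
  then have nc: "num_children ?T ?w = \<delta>"
    using full_tree_children[OF full w] \<open>?w @ [?l] \<in> ?T\<close> by (metis gr_implies_not0)
  then obtain \<rho> where \<rho>: "\<rho> permutes {..<\<delta>}" "(?lab ?w, map (\<lambda>c. ?lab (?w @ [\<rho> c])) [0..<\<delta>]) \<in> configs \<P>"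
    using sol[OF inst_instances[OF assms(3)]] w unfolding is_solution_def by blast
  have lw: "?lab ?w \<in> \<Sigma> i" using assms by (intro main_path[OF assms(1) i_items assms(3,4)]) simp
  have lc: "?lab (?w @ [c]) \<in> \<Sigma> i" if "c < \<delta>" for c
  proof (cases "c = ?l")
    case True
    have "?lab (spine (take (Suc j) L)) \<in> \<Sigma> i"
      using assms by (intro main_path[OF assms(1) i_items assms(3)]) simp_all
    then show ?thesis using next_spine True by simp
  next
    case False
    then show ?thesis using off_path[OF assms(1-6) that False assms(7)] by simp
  qed
  have "\<rho> c < \<delta>" if "c < \<delta>" for c using permutes_in_image[OF \<rho>(1), of c] that by simp
  then have sub: "set (map (\<lambda>c. ?lab (?w @ [\<rho> c])) [0..<\<delta>]) \<subseteq> \<Sigma> i" using lc by auto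
  obtain c where c: "c < \<delta>" "\<rho> c = ?l" using permutes_image[OF \<rho>(1)] l by (metis imageE lessThan_iff)
  then have "?lab (?w @ [?l]) \<in> set (map (\<lambda>c. ?lab (?w @ [\<rho> c])) [0..<\<delta>])" by force
  then show ?thesis unfolding next_spine inner_edges_def config_edges_def using \<rho>(2) lw sub by blast
qed

lemma main_walk:
  assumes "claim i" "items_all \<delta> (rich (Suc i)) L" "inst L (comb \<delta> q) ids" "D \<le> j"
    "length L \<le> 10 * D + 1" "i < k" "j + m + D \<le> length L"
  shows "(out (cat \<delta> L (comb \<delta> q)) ids (spine (take j L)),
    out (cat \<delta> L (comb \<delta> q)) ids (spine (take (j + m) L))) \<in> inner_edges \<P> (\<Sigma> i) ^^ m"
  using assms(7)
proof (induction m)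
  case (Suc m)
  have "(out (cat \<delta> L (comb \<delta> q)) ids (spine (take (j + m) L)),
    out (cat \<delta> L (comb \<delta> q)) ids (spine (take (Suc (j + m)) L))) \<in> inner_edges \<P> (\<Sigma> i)"
    using assms Suc.prems by (intro main_edge) auto
  then show ?case using Suc by auto
qed simp

text \<open>All windows are first gathered in one host tree, where their identifiers are distinct
  automatically. Three of them are then moved into a second tree, in which the walks are read
  off.\<close>

lemma claim_Suc:
  assumes claim: "claim i" and i: "i < k"
    and big: "(10 * D + 1 + 2 * D * (k + 3)) * (1 + \<delta> * size_bound \<delta> D k k) + 1 \<le> n"
  shows "claim (Suc i)"
  unfolding claim_def
proof (intro allI impI)
  fix ps1 ps2 :: "item list" and E ids
  assume len2: "length ps2 = 2 * D" and rich2: "items_all \<delta> (rich (Suc i)) ps2" and inst: "inst (ps1 @ ps2) E ids"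
  let ?T = "cat \<delta> (ps1 @ ps2) E" and ?Z = "size_bound \<delta> D k k"
  define a where "a = out ?T ids (spine ps1 @ take D (spine ps2))"
  define X where "X = replicate (2 * D) gitem"
  \<comment> \<open>The given window may carry trees of any size; cut at depth \<open>M\<close> it
    still gives its middle the same label, stays rich, and fits the size bound.\<close>
  define V where "V = ctrunc M ps2"
  define ok where "ok = (\<lambda>X. rich (Suc i) X \<and> card X \<le> ?Z)"
  have lens: "length X = 2 * D" "length V = 2 * D" using len2 by (simp_all add: X_def V_def)
  have spV: "spine V = spine ps2" by (simp add: V_def)
  have ok_g: "items_all \<delta> ok (replicate m gitem)" for m
  proof -
    have "ok (spine_tree \<delta> D k)"
      using rich_antimono[of "Suc i" k, OF _ rich_spine_tree] i size_bound_mono[OF \<delta>_pos, of 0 k D k] by (simp add: ok_def)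
    then show ?thesis unfolding gitem_def using \<delta>_pos by (intro items_all_replicate)
  qed
  have ok_V: "items_all \<delta> ok V" unfolding V_def
  proof (rule items_all_ctrunc[OF rich2])
    fix Y M' assume Y: "rich (Suc i) Y" "M - length ps2 \<le> M'" "M' \<le> M"
    have "Suc i * Suc D \<le> k * Suc D" using i by (intro mult_le_mono1) simp
    then have "rich (Suc i) (trunc M' Y)" using Y len2 by (intro rich_trunc) (auto simp: M_def)
    moreover have "card (trunc M' Y) \<le> card (trunc M Y)"
      using Y(3) finite_full_tree[OF rich_full_tree[OF Y(1)]] by (intro card_mono) (auto simp: trunc_def)
    moreover have "bnd (Suc i) \<le> ?Z" by (intro size_bound_mono \<delta>_pos) simp
    ultimately show "ok (trunc M' Y)" using rich_card[OF Y(1)] by (simp add: ok_def)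
  qed
  have ok_rich: "items_all \<delta> ok L \<Longrightarrow> items_all \<delta> (rich (Suc i)) L" for L
    by (erule items_all_mono) (simp add: ok_def)
  have ok_full: "items_all \<delta> ok L \<Longrightarrow> items_all \<delta> (full_tree \<delta>) L" for L
    using ok_rich items_full by blast
  obtain m where m: "n = 1 + \<delta> * m"
    using inst full_tree_card[OF full_tree_cat[of \<delta> "ps1 @ ps2" E]] by (auto simp: inst_def)
  have pad: "\<exists>q. card (cat \<delta> L (comb \<delta> q)) = n" if "items_all \<delta> ok L" "length L \<le> 10 * D + 1 + 2 * D * (k + 3)" for L
  proof (rule padding_exists[OF ok_full[OF that(1)] _ m \<delta>_pos])
    have "items_all \<delta> (\<lambda>X. finite X \<and> card X \<le> ?Z) L"
      by (rule items_all_mono[OF that(1)]) (use rich_full_tree finite_full_tree in \<open>auto simp: ok_def simp del: rich.simps\<close>)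
    then have "card (cat \<delta> L {[]}) \<le> length L * (1 + \<delta> * ?Z) + 1"
      using card_cat_le[of \<delta> ?Z L "{[]}"] by simp
    also have "\<dots> \<le> (10 * D + 1 + 2 * D * (k + 3)) * (1 + \<delta> * ?Z) + 1"
      using that(2) by (intro add_mono mult_right_mono) auto
    finally show "card (cat \<delta> L {[]}) \<le> n" using big by simp
  qed
  have full_comb: "full_tree \<delta> (comb \<delta> q)" for q using full_tree_comb \<delta>_pos by blast
  have inst_range: "finite (cat \<delta> L F)" "inj_on ids (cat \<delta> L F)" "ids ` cat \<delta> L F \<subseteq> {1..n}"
    if "inst L F ids" for L F ids
    using that full_tree_cat finite_full_tree by (auto simp: inst_def)
  have memV: "z \<in> cat \<delta> V {} \<longleftrightarrow> z \<in> cat \<delta> ps2 {} \<and> length z \<le> M" for z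
  proof -
    have "trunc M (cat \<delta> ps2 {}) = cat \<delta> V (trunc (M - length ps2) {})"
      unfolding V_def using len2 by (intro trunc_cat) (simp add: M_def)
    moreover have "trunc (M - length ps2) {} = {}" by (simp add: trunc_def)
    ultimately have "cat \<delta> V {} = trunc M (cat \<delta> ps2 {})" by simp
    then show ?thesis by (auto simp: trunc_def)
  qed

  \<comment> \<open>\<open>k + 1\<close> consecutive blocks of length \<open>2 * D\<close>, one more
    than there are labels, stacked above the given window.\<close>
  define G where "G = replicate (2 * D * Suc k) gitem"
  define L0 where "L0 = G @ V @ X"
  have ok0: "items_all \<delta> ok L0" using ok_g ok_V by (simp add: L0_def G_def X_def)
  have "length L0 \<le> 10 * D + 1 + 2 * D * (k + 3)" using lens by (simp add: L0_def G_def algebra_simps)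
  then obtain q0 where q0: "card (cat \<delta> L0 (comb \<delta> q0)) = n" using pad[OF ok0] by blast
  let ?U = "cat \<delta> L0 (comb \<delta> q0)"
  have full0: "full_tree \<delta> ?U" using ok_full[OF ok0] full_comb by (intro full_tree_cat)
  obtain ids0 where ids0: "inj_on ids0 ?U" "ids0 ` ?U \<subseteq> {1..n}"
    "\<And>w z. w \<in> {()} \<Longrightarrow> z \<in> cat \<delta> V {} \<Longrightarrow> ids0 (spine G @ z) = ids (spine ps1 @ z)"
  proof (rule transplant_ids[where T = ?T and T' = ?U and ids = ids and n = n and W = "{()}" and Z = "\<lambda>_. cat \<delta> V {}" and q = "\<lambda>_. spine G" and p = "\<lambda>_. spine ps1"])
    fix z assume z: "z \<in> cat \<delta> V {}"
    have "spine G @ z \<in> ?U" unfolding L0_def by (rule window_mem[OF ok0[unfolded L0_def] z])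
    moreover have "spine ps1 @ z \<in> cat \<delta> (ps1 @ ps2 @ []) E"
      using inst memV z by (intro window_mem[of "full_tree \<delta>"]) (auto simp: inst_def)
    ultimately show "spine G @ z \<in> ?U \<and> spine ps1 @ z \<in> ?T" by simp
  qed (use inst_range[OF inst] q0 finite_full_tree[OF full0] in auto)
  have inst0: "inst L0 (comb \<delta> q0) ids0" using ok_full[OF ok0] full_comb q0 ids0 by (simp add: inst_def)
  have a0: "a = out ?U ids0 (spine G @ take D (spine ps2))"
  proof -
    have "out (cat \<delta> (ps1 @ ps2 @ []) E) ids (spine ps1 @ take D (spine ps2)) =
        out (cat \<delta> (G @ V @ X) (comb \<delta> q0)) ids0 (spine G @ take D (spine ps2))"
      by (rule window_label_append) (use inst inst0 len2 spV memV ids0(3) in \<open>auto simp: L0_def\<close>)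
    then show ?thesis by (simp add: a_def L0_def)
  qed

  define pre where "pre = (\<lambda>g::nat. replicate (2 * D * g) gitem)"
  define post where "post = (\<lambda>g. replicate (2 * D * (k - g)) gitem @ V @ X)"
  have L0_split: "L0 = pre g @ X @ post g" if "g \<le> k" for g
  proof -
    have "2 * D * Suc k = 2 * D * g + (2 * D + 2 * D * (k - g))" using that by (rule mult_split)
    then have "G = pre g @ X @ replicate (2 * D * (k - g)) gitem"
      unfolding G_def pre_def X_def by (simp only: replicate_add)
    then show ?thesis by (simp add: L0_def post_def)
  qed
  define lab where "lab = (\<lambda>g. out ?U ids0 (spine (pre g) @ take D (spine X)))"
  have "lab g \<in> labels \<P>" if "g \<le> k" for g
  proof -
    have "inst (pre g @ X) (cat \<delta> (post g) (comb \<delta> q0)) ids0"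
      using inst0 inst_regroup[of "pre g @ X" "post g"] L0_split[OF that] by simp
    moreover have "items_all \<delta> (rich 0) X" unfolding X_def by (rule items_all_gitem) simp
    ultimately have "out (cat \<delta> (pre g @ X) (cat \<delta> (post g) (comb \<delta> q0))) ids0 (spine (pre g) @ take D (spine X)) \<in> \<Sigma> 0"
      using claim_0 lens(1) unfolding claim_def by blast
    then show ?thesis unfolding lab_def L0_split[OF that] by (simp add: cat_append)
  qed
  then have "lab ` {..k} \<subseteq> labels \<P>" by auto
  then have "card (lab ` {..k}) \<le> k" using lcl unfolding k_def is_lcl_def by (intro card_mono) auto
  then have "\<not> inj_on lab {..k}" using card_image[of lab "{..k}"] by auto
  then obtain g1 g2 where g: "g1 < g2" "g2 \<le> k" "lab g1 = lab g2"
    unfolding inj_on_def by (metis atMost_iff linorder_neqE_nat)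
  define x where "x = lab g1"

  have walks: "(x, a) \<in> inner_edges \<P> (\<Sigma> i) ^^ (2 * D + e) \<and> (a, x) \<in> inner_edges \<P> (\<Sigma> i) ^^ (2 * D) \<and> a \<in> \<Sigma> i"
    if e: "e \<le> 1" for e
  proof -
    \<comment> \<open>The optional extra item lengthens the way from the upper window with label
      \<open>x\<close> to the window with label \<open>a\<close>, and leaves the way from there to
      the lower one unchanged.\<close>
    define Y where "Y = replicate e gitem"
    define L where "L = X @ X @ Y @ V @ X @ X"
    have lenL: "length L = 10 * D + e" using lens by (simp add: L_def Y_def)
    have okL: "items_all \<delta> ok L" using ok_g ok_V by (simp add: L_def X_def Y_def)
    have "length L \<le> 10 * D + 1 + 2 * D * (k + 3)" using lenL e by simp
    then obtain q where q: "card (cat \<delta> L (comb \<delta> q)) = n" using pad[OF okL] by blast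
    let ?T' = "cat \<delta> L (comb \<delta> q)"
    have full': "full_tree \<delta> ?T'" using ok_full[OF okL] full_comb by (intro full_tree_cat)
    \<comment> \<open>Window 0 is the upper one with label \<open>x\<close>, window 1 the one with
      label \<open>a\<close>, window 2 the lower one with label \<open>x\<close>. \<open>Q w\<close>
      is the spine above window \<open>w\<close> in the new tree, \<open>S w\<close> the one in the
      host tree.\<close>
    define Q where "Q = (\<lambda>w::nat. if w = 0 then X else if w = 1 then X @ X @ Y else X @ X @ Y @ V)"
    define S where "S = (\<lambda>w::nat. if w = 0 then pre g1 else if w = 1 then G else pre g2)"
    define Z where "Z = (\<lambda>w::nat. if w = 1 then cat \<delta> V {} else cat \<delta> X {})"
    have okX: "items_all \<delta> ok X" using ok_g by (simp add: X_def)
    have in_T': "spine (Q w) @ z \<in> ?T'" if "w \<in> {0, 1, 2}" "z \<in> Z w" for w z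
    proof -
      have 0: "spine X @ z \<in> ?T'" if "z \<in> cat \<delta> X {}"
        using window_mem[of ok X X "Y @ V @ X @ X"] okL that by (simp add: L_def)
      have 1: "spine (X @ X @ Y) @ z \<in> ?T'" if "z \<in> cat \<delta> V {}"
        using window_mem[of ok "X @ X @ Y" V "X @ X"] okL that by (simp add: L_def)
      have 2: "spine (X @ X @ Y @ V) @ z \<in> ?T'" if "z \<in> cat \<delta> X {}"
        using window_mem[of ok "X @ X @ Y @ V" X X] okL that by (simp add: L_def)
      show ?thesis using that 0 1 2 by (auto simp: Q_def Z_def)
    qed
    have in_T0: "spine (S w) @ z \<in> ?U" if "w \<in> {0, 1, 2}" "z \<in> Z w" for w z
    proof -
      have 0: "spine (pre g) @ z \<in> ?U" if "z \<in> cat \<delta> X {}" "g \<le> k" for g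
        using window_mem[of ok "pre g" X "post g"] ok0 that L0_split[OF that(2)] by simp
      have 1: "spine G @ z \<in> ?U" if "z \<in> cat \<delta> V {}"
        using window_mem[of ok G V X] ok0 that by (simp add: L0_def)
      show ?thesis using that 0[of g1] 0[of g2] 1 g by (auto simp: S_def Z_def)
    qed
    \<comment> \<open>The order of the windows differs: in the host tree window 1 is below both
      others, in the new tree it is between them. Disjointness is checked separately for each
      order.\<close>
    have QS: "spine (Q w) @ z \<noteq> spine (Q w') @ z' \<and> spine (S w) @ z \<noteq> spine (S w') @ z'"
      if w: "(w, w') \<in> {(0, 1), (0, 2), (1, 2)}" and z: "z \<in> Z w" "z' \<in> Z w'" for w w' z z'
    proof -
      have Q01: "Q 1 = Q 0 @ X @ Y" and Q02: "Q 2 = Q 0 @ X @ Y @ V" and Q12: "Q 2 = Q 1 @ V @ []"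
        by (simp_all add: Q_def)
      have "2 * D * g2 = 2 * D * g1 + (2 * D + 2 * D * (g2 - g1 - 1))"
        using g(1) by (rule mult_split_less)
      then have S02: "S 2 = S 0 @ X @ replicate (2 * D * (g2 - g1 - 1)) gitem"
        unfolding S_def pre_def X_def by (simp add: replicate_add)
      have "2 * D * Suc k = 2 * D * g + (2 * D + 2 * D * (k - g))" if "g \<le> k" for g
        using that by (rule mult_split)
      then have Gsplit: "G = pre g @ X @ replicate (2 * D * (k - g)) gitem" if "g \<le> k" for g
        using that unfolding G_def pre_def X_def by (simp only: replicate_add)
      have S01: "S 1 = S 0 @ X @ replicate (2 * D * (k - g1)) gitem"
        and S21: "S 1 = S 2 @ X @ replicate (2 * D * (k - g2)) gitem"
        using Gsplit[of g1] Gsplit[of g2] g by (simp_all add: S_def)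
      note dX = window_disjoint[OF okX] and dV = window_disjoint[OF ok_V]
      consider "w = 0" "w' = 1" | "w = 0" "w' = 2" | "w = 1" "w' = 2" using w by auto
      then show ?thesis
      proof cases
        case 1
        have "z \<in> cat \<delta> X {}" using z 1 by (simp add: Z_def)
        then show ?thesis unfolding 1 Q01 S01 using dX by blast
      next
        case 2
        have "z \<in> cat \<delta> X {}" using z 2 by (simp add: Z_def)
        then show ?thesis unfolding 2 Q02 S02 using dX by blast
      next
        case 3
        have "z \<in> cat \<delta> V {}" "z' \<in> cat \<delta> X {}" using z 3 by (simp_all add: Z_def)
        then show ?thesis unfolding 3 Q12 S21 using dV dX by metis
      qed
    qed
    obtain ids' where ids': "inj_on ids' ?T'" "ids' ` ?T' \<subseteq> {1..n}"
      "\<And>w z. w \<in> {0, 1, 2} \<Longrightarrow> z \<in> Z w \<Longrightarrow> ids' (spine (Q w) @ z) = ids0 (spine (S w) @ z)"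
    proof (rule transplant_ids[where T = ?U and T' = ?T' and ids = ids0 and n = n and W = "{0, 1, 2}" and Z = Z and q = "\<lambda>w. spine (Q w)" and p = "\<lambda>w. spine (S w)"])
      fix w w' z z'
      assume w: "w \<in> {0, 1, 2::nat}" "w' \<in> {0, 1, 2::nat}" and z: "z \<in> Z w" "z' \<in> Z w'"
      consider "w = w'" | "(w, w') \<in> {(0, 1), (0, 2), (1, 2)}" | "(w', w) \<in> {(0, 1), (0, 2), (1, 2)}"
        using w by auto
      then show "spine (Q w) @ z = spine (Q w') @ z' \<longleftrightarrow> spine (S w) @ z = spine (S w') @ z'"
      proof cases
        case 1
        then show ?thesis by simp
      next
        case 2
        show ?thesis using QS[OF 2 z] by blast
      next
        case 3
        show ?thesis using QS[OF 3 z(2,1)] by metis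
      qed
    qed (use in_T' in_T0 q finite_full_tree[OF full'] inst_range[OF inst0] in auto)
    have inst': "inst L (comb \<delta> q) ids'" using ok_full[OF okL] full_comb q ids' by (simp add: inst_def)
    let ?lab = "\<lambda>j. out ?T' ids' (spine (take j L))"
    have "out (cat \<delta> (pre g1 @ X @ post g1) (comb \<delta> q0)) ids0 (spine (pre g1) @ take D (spine X)) =
        out (cat \<delta> (X @ X @ (Y @ V @ X @ X)) (comb \<delta> q)) ids' (spine X @ take D (spine X))"
    proof (rule window_label_append)
      show "ids0 (spine (pre g1) @ z) = ids' (spine X @ z)" if "z \<in> cat \<delta> X {}" for z
        using ids'(3)[of 0 z] that by (simp add: Q_def S_def Z_def)
    qed (use inst0 inst' L0_split[of g1] g lens in \<open>auto simp: L_def\<close>)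
    moreover have "spine X @ take D (spine X) = spine (take (3 * D) L)" using lens by (simp add: L_def take_map)
    ultimately have x1: "?lab (3 * D) = x" using L0_split[of g1] g by (simp add: x_def lab_def L_def)
    have "out (cat \<delta> (pre g2 @ X @ post g2) (comb \<delta> q0)) ids0 (spine (pre g2) @ take D (spine X)) =
        out (cat \<delta> ((X @ X @ Y @ V) @ X @ X) (comb \<delta> q)) ids' (spine (X @ X @ Y @ V) @ take D (spine X))"
    proof (rule window_label_append)
      show "ids0 (spine (pre g2) @ z) = ids' (spine (X @ X @ Y @ V) @ z)" if "z \<in> cat \<delta> X {}" for z
        using ids'(3)[of 2 z] that by (simp add: Q_def S_def Z_def)
    qed (use inst0 inst' L0_split[of g2] g lens in \<open>auto simp: L_def\<close>)
    moreover have "spine (X @ X @ Y @ V) @ take D (spine X) = spine (take (7 * D + e) L)"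
      using lens by (simp add: L_def Y_def take_map)
    ultimately have x2: "?lab (7 * D + e) = x" using L0_split[of g2] g by (simp add: x_def lab_def L_def)
    have "out (cat \<delta> (G @ V @ X) (comb \<delta> q0)) ids0 (spine G @ take D (spine V)) =
        out (cat \<delta> ((X @ X @ Y) @ V @ (X @ X)) (comb \<delta> q)) ids' (spine (X @ X @ Y) @ take D (spine V))"
    proof (rule window_label_append)
      show "ids0 (spine G @ z) = ids' (spine (X @ X @ Y) @ z)" if "z \<in> cat \<delta> V {}" for z
        using ids'(3)[of 1 z] that by (simp add: Q_def S_def Z_def)
    qed (use inst0 inst' lens in \<open>auto simp: L_def L0_def\<close>)
    moreover have "spine (X @ X @ Y) @ take D (spine V) = spine (take (5 * D + e) L)"
      using lens by (simp add: L_def Y_def take_map)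
    ultimately have a1: "?lab (5 * D + e) = a" using a0 spV by (simp add: L_def L0_def)
    have walk: "(?lab j, ?lab (j + l)) \<in> inner_edges \<P> (\<Sigma> i) ^^ l" if "D \<le> j" "j + l + D \<le> length L" for j l
      using claim ok_rich[OF okL] inst' i lenL e that by (intro main_walk) auto
    have i_items: "items_all \<delta> (rich i) L" by (rule items_all_mono[OF ok_rich[OF okL]]) (rule rich_Suc)
    have "?lab (5 * D + e) \<in> \<Sigma> i" using lenL by (intro main_path[OF claim i_items inst']) auto
    moreover have "3 * D + (2 * D + e) = 5 * D + e" "5 * D + e + 2 * D = 7 * D + e" by simp_all
    ultimately show ?thesis using walk[of "3 * D" "2 * D + e"] walk[of "5 * D + e" "2 * D"] lenL x1 x2 a1 by auto
  qed
  \<comment> \<open>Down from \<open>a\<close> to the lower \<open>x\<close>, then on from the upper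
    \<open>x\<close> to \<open>a\<close>: closed walks of lengths \<open>4 * D\<close> and
    \<open>4 * D + 1\<close>.\<close>
  have "(a, a) \<in> inner_edges \<P> (\<Sigma> i) ^^ (2 * D + 2 * D)" "(a, a) \<in> inner_edges \<P> (\<Sigma> i) ^^ (2 * D + (2 * D + 1))"
    unfolding relpow_add[of "2 * D"] using walks[of 0] walks[of 1] by (auto intro: relcompI)
  then have "flexible (inner_edges \<P> (\<Sigma> i)) a" unfolding flexible_def by (intro exI[of _ "2 * D + 2 * D"]) simp
  then show "out ?T ids (spine ps1 @ take D (spine ps2)) \<in> \<Sigma> (Suc i)" using walks[of 0] by (simp add: a_def)
qed

text \<open>One padded spine of generic items shows by \<open>claim k\<close> that
  \<open>\<Sigma> k\<close> is nonempty. By then the pruning of labels has stopped, so all its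
  labels are flexible within it, and the configurations over it form a robust set.\<close>

lemma robust_if_fast:
  assumes "(10 * D + 1 + 2 * D * (k + 3)) * (1 + \<delta> * size_bound \<delta> D k k) + 1 \<le> n" "n = 1 + \<delta> * m"
  shows "robust \<P>"
proof -
  have claims: "claim i" if "i \<le> k" for i
    using that by (induction i) (use claim_0 claim_Suc assms(1) in auto)
  let ?X = "replicate (2 * D) gitem"
  have rX: "items_all \<delta> (rich k) ?X" by (rule items_all_gitem) simp
  have "items_all \<delta> (\<lambda>X. finite X \<and> card X \<le> size_bound \<delta> D k k) ?X" unfolding gitem_def
    using full_tree_spine_tree[OF \<delta>_pos] finite_full_tree size_bound_mono[OF \<delta>_pos, of 0 k D k] \<delta>_pos
    by (intro items_all_replicate) auto
  then have "card (cat \<delta> ?X {[]}) \<le> 2 * D * (1 + \<delta> * size_bound \<delta> D k k) + 1"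
    using card_cat_le[of \<delta> "size_bound \<delta> D k k" ?X "{[]}"] by simp
  also have "\<dots> \<le> (10 * D + 1 + 2 * D * (k + 3)) * (1 + \<delta> * size_bound \<delta> D k k) + 1"
    by (intro add_mono mult_right_mono) auto
  finally have "card (cat \<delta> ?X {[]}) \<le> n" using assms(1) by simp
  then obtain q where q: "card (cat \<delta> ?X (comb \<delta> q)) = n"
    using padding_exists[OF items_full[OF rX] _ assms(2) \<delta>_pos] by blast
  have full: "full_tree \<delta> (cat \<delta> ?X (comb \<delta> q))"
    using items_full[OF rX] full_tree_comb \<delta>_pos by (intro full_tree_cat)
  then obtain ids where "bij_betw ids (cat \<delta> ?X (comb \<delta> q)) {1..n}"
    using finite_same_card_bij[of "cat \<delta> ?X (comb \<delta> q)" "{1..n}"] q finite_full_tree by auto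
  then have "inst ([] @ ?X) (comb \<delta> q) ids"
    using items_full[OF rX] q full_tree_comb \<delta>_pos by (auto simp: inst_def bij_betw_def)
  then have ne: "\<Sigma> k \<noteq> {}" using claims[of k] rX unfolding claim_def by (metis empty_iff length_replicate order_refl)
  define f where "f = (\<lambda>S. {a \<in> S. flexible (inner_edges \<P> S) a})"
  have \<Sigma>_f: "\<Sigma> j = (f ^^ j) (labels \<P>)" for j by (induction j) (auto simp: f_def)
  have "f (\<Sigma> k) = \<Sigma> k" unfolding \<Sigma>_f
    by (rule decreasing_funpow_stable) (use lcl in \<open>auto simp: f_def k_def is_lcl_def\<close>)
  then have flex: "flexible (inner_edges \<P> (\<Sigma> k)) a" if "a \<in> \<Sigma> k" for a using that by (auto simp: f_def)
  let ?C = "{(a, bs) \<in> configs \<P>. a \<in> \<Sigma> k \<and> set bs \<subseteq> \<Sigma> k}"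
  obtain a where "a \<in> \<Sigma> k" using ne by blast
  then obtain j where "(a, a) \<in> inner_edges \<P> (\<Sigma> k) ^^ Suc j" using flex unfolding flexible_def by blast
  then obtain b where "(a, b) \<in> inner_edges \<P> (\<Sigma> k)" by (meson relpow_Suc_D2)
  then have "?C \<noteq> {}" by (auto simp: inner_edges_def config_edges_def)
  moreover have "?C \<subseteq> prune ?C"
    using flex unfolding prune_def inner_edges_def by auto
  moreover have "?C \<subseteq> configs \<P>" by auto
  ultimately show ?thesis unfolding robust_def by blast
qed

end

section \<open>From the size condition to a power of \<open>n\<close>\<close>

definition polybounded :: "(nat \<Rightarrow> nat) \<Rightarrow> bool" where
  "polybounded f \<longleftrightarrow> (\<exists>C e. \<forall>x\<ge>1. f x \<le> C * x ^ e)"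

lemma polybounded_const: "polybounded (\<lambda>_. c)"
  unfolding polybounded_def by (intro exI[of _ c] exI[of _ 0]) simp

lemma polybounded_id: "polybounded (\<lambda>x. x)"
  unfolding polybounded_def by (intro exI[of _ 1]) simp

lemma polybounded_add:
  assumes "polybounded f" "polybounded g"
  shows "polybounded (\<lambda>x. f x + g x)"
proof -
  obtain C e C' e' where f: "\<And>x. 1 \<le> x \<Longrightarrow> f x \<le> C * x ^ e" and g: "\<And>x. 1 \<le> x \<Longrightarrow> g x \<le> C' * x ^ e'"
    using assms unfolding polybounded_def by blast
  have "f x + g x \<le> (C + C') * x ^ (e + e')" if "1 \<le> x" for x
  proof -
    have "x ^ e \<le> x ^ (e + e')" "x ^ e' \<le> x ^ (e + e')" using that by (auto intro: power_increasing)
    then have "C * x ^ e + C' * x ^ e' \<le> C * x ^ (e + e') + C' * x ^ (e + e')" by (intro add_mono mult_left_mono) auto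
    then show ?thesis using f[OF that] g[OF that] by (simp add: distrib_right)
  qed
  then show ?thesis unfolding polybounded_def by blast
qed

lemma polybounded_mult:
  assumes "polybounded f" "polybounded g"
  shows "polybounded (\<lambda>x. f x * g x)"
proof -
  obtain C e C' e' where f: "\<And>x. 1 \<le> x \<Longrightarrow> f x \<le> C * x ^ e" and g: "\<And>x. 1 \<le> x \<Longrightarrow> g x \<le> C' * x ^ e'"
    using assms unfolding polybounded_def by blast
  have "f x * g x \<le> (C * C') * x ^ (e + e')" if "1 \<le> x" for x
    using mult_mono[OF f[OF that] g[OF that]] by (simp add: power_add algebra_simps)
  then show ?thesis unfolding polybounded_def by blast
qed

lemma polybounded_mono:
  assumes "polybounded g" "\<And>x. f x \<le> g x"
  shows "polybounded f"
  using assms unfolding polybounded_def by (meson le_trans)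

lemmas polybounded_intros = polybounded_const polybounded_id polybounded_add polybounded_mult

lemma polybounded_card_spine_tree:
  assumes "0 < \<delta>"
  shows "polybounded (\<lambda>D. card (spine_tree \<delta> D i))"
proof (induction i)
  case (Suc i)
  have "card (spine_tree \<delta> D (Suc i)) \<le> D * (1 + \<delta> * card (spine_tree \<delta> D i)) + 1" for D
  proof -
    have "finite (spine_tree \<delta> D i)" using full_tree_spine_tree[OF assms] by (simp add: full_tree_def)
    then have "items_all \<delta> (\<lambda>X. finite X \<and> card X \<le> card (spine_tree \<delta> D i)) (replicate D (0, \<lambda>_. spine_tree \<delta> D i))"
      using assms by (intro items_all_replicate) auto
    then show ?thesis using card_cat_le[of \<delta> "card (spine_tree \<delta> D i)" "replicate D (0, \<lambda>_. spine_tree \<delta> D i)" "{[]}"]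
      by simp
  qed
  moreover have "polybounded (\<lambda>D. D * (1 + \<delta> * card (spine_tree \<delta> D i)) + 1)"
    by (intro polybounded_intros Suc)
  ultimately show ?case by (rule polybounded_mono[rotated])
qed (simp add: polybounded_const)

text \<open>\<open>\<delta>\<close>, \<open>k\<close> and \<open>r\<close> are constants of the
  problem, so this is a recursion of fixed depth and polynomial in \<open>D\<close>, with an
  exponent that depends on the number of levels.\<close>

lemma polybounded_size_bound:
  assumes "0 < \<delta>"
  shows "polybounded (\<lambda>D. size_bound \<delta> D k r)"
proof (induction r)
  case 0
  then show ?case using polybounded_card_spine_tree[OF assms] by simp
next
  case (Suc r)
  have "polybounded (\<lambda>D. (10 * D + 1) * (1 + \<delta> * size_bound \<delta> D k r) + 1 + \<delta> * (k * (D + 1) + 2 * D))"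
    by (intro polybounded_intros Suc)
  then show ?case by simp
qed

lemma instances_mono:
  assumes "1 \<le> c"
  shows "instances 1 \<delta> n \<subseteq> instances c \<delta> n"
proof (cases "n = 0")
  case False
  then have "n ^ 1 \<le> n ^ c" using assms by (intro power_increasing) auto
  then have "{1..n ^ 1} \<subseteq> {1..n ^ c}" by auto
  then show ?thesis unfolding instances_def by (auto simp only: mem_Collect_eq split_def)
qed (use assms in \<open>auto simp: instances_def full_tree_def\<close>)

lemma not_robust_poly_lower:
  assumes lcl: "is_lcl \<P>" and nr: "\<not> robust \<P>" and c: "1 \<le> c"
  shows "complexity_poly_lower c \<P>"
proof -
  let ?\<delta> = "arity \<P>" and ?k = "card (labels \<P>)"
  have \<delta>: "0 < ?\<delta>" using lcl by (simp add: is_lcl_def Suc_le_eq)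
  have "polybounded (\<lambda>D. (10 * D + 1 + 2 * D * (?k + 3)) * (1 + ?\<delta> * size_bound ?\<delta> D ?k ?k) + 1)"
    by (intro polybounded_intros polybounded_size_bound \<delta>)
  then obtain C e where Ce: "\<And>D. 1 \<le> D \<Longrightarrow>
    (10 * D + 1 + 2 * D * (?k + 3)) * (1 + ?\<delta> * size_bound ?\<delta> D ?k ?k) + 1 \<le> C * D ^ e"
    unfolding polybounded_def by blast
  \<comment> \<open>With \<open>y = n powr \<epsilon>\<close> and \<open>t < y\<close>, the required
    size is at most \<open>C * (3 * y) ^ e\<close>. The threshold \<open>N\<close> makes
    \<open>y\<close> at least \<open>C * 3 ^ e\<close>, so this is at most
    \<open>y ^ Suc e = n\<close>.\<close>
  define \<epsilon> where "\<epsilon> = 1 / real (Suc e)"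
  define N where "N = (Suc C * 3 ^ e) ^ Suc e"
  have \<epsilon>: "0 < \<epsilon>" by (simp add: \<epsilon>_def)
  have "ereal (real n powr \<epsilon>) \<le> ereal_of_enat (round_complexity c \<P> n)"
    if n: "N \<le> n" and ex: "\<exists>T. full_tree ?\<delta> T \<and> card T = n" for n
  proof (rule ccontr)
    assume "\<not> ?thesis"
    then have less: "ereal_of_enat (round_complexity c \<P> n) < ereal (real n powr \<epsilon>)" by simp
    then obtain t where t: "round_complexity c \<P> n = enat t" by (cases "round_complexity c \<P> n") auto
    then have ty: "real t < real n powr \<epsilon>" using less by simp
    define y where "y = real n powr \<epsilon>"
    have "1 \<le> N" unfolding N_def by (simp add: Suc_le_eq del: power_Suc mult_Suc)
    then have n1: "1 \<le> n" using n by simp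
    have yn: "y ^ Suc e = real n"
      using n1 by (simp add: y_def \<epsilon>_def powr_realpow[symmetric] powr_powr del: power_Suc)
    have "real (Suc C * 3 ^ e) ^ Suc e \<le> y ^ Suc e" using n unfolding yn N_def by (metis of_nat_le_iff of_nat_power)
    then have y: "real (Suc C * 3 ^ e) \<le> y" by (rule power_le_imp_le_base) (simp add: y_def)
    have "1 \<le> Suc C * 3 ^ e" by (simp add: Suc_le_eq del: mult_Suc)
    then have "1 \<le> real (Suc C * 3 ^ e)" by (metis of_nat_1 of_nat_le_iff)
    then have y1: "1 \<le> y" using y by linarith
    have t3: "real (t + 2) \<le> 3 * y" using ty y1 by (simp add: y_def)
    have "real (C * (t + 2) ^ e) \<le> real C * (3 * y) ^ e"
      using power_mono[OF t3, of e] by (simp add: mult_left_mono)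
    also have "\<dots> = (real C * 3 ^ e) * y ^ e" by (simp add: power_mult_distrib)
    also have "\<dots> \<le> y * y ^ e"
    proof (intro mult_right_mono)
      have "real C * 3 ^ e \<le> real (Suc C * 3 ^ e)" by (simp add: algebra_simps)
      then show "real C * 3 ^ e \<le> y" using y by linarith
    qed (use y1 in simp)
    also have "\<dots> = real n" using yn by simp
    finally have "C * (t + 2) ^ e \<le> n" by (simp only: of_nat_le_iff)
    then have big: "(10 * (t + 2) + 1 + 2 * (t + 2) * (?k + 3)) * (1 + ?\<delta> * size_bound ?\<delta> (t + 2) ?k ?k) + 1 \<le> n"
      using Ce[of "t + 2"] by simp
    obtain m where m: "n = 1 + ?\<delta> * m" using ex full_tree_card by blast
    have "round_complexity c \<P> n < enat (Suc t)" using t by simp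
    then obtain A where A: "solves c A \<P>" "(SUP (T, ids) \<in> instances c ?\<delta> n. running_time A T ids) < enat (Suc t)"
      unfolding round_complexity_def by (auto simp: INF_less_iff)
    have inst: "(T, ids) \<in> instances c ?\<delta> n" if "(T, ids) \<in> instances 1 ?\<delta> n" for T ids
      using that instances_mono[OF c] by blast
    interpret fast_algorithm \<P> A n t
    proof
      fix T ids assume I: "(T, ids) \<in> instances 1 ?\<delta> n"
      then show "is_solution \<P> T (output_label A T ids)" using A(1) inst unfolding solves_def by blast
      fix v assume v: "v \<in> T"
      have "output_time A T ids v \<le> running_time A T ids" unfolding running_time_def using v by (rule SUP_upper)
      also have "\<dots> \<le> (SUP (T, ids) \<in> instances c ?\<delta> n. running_time A T ids)"
        using SUP_upper[OF inst[OF I], of "\<lambda>(T, ids). running_time A T ids"] by simp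
      finally have "output_time A T ids v < enat (Suc t)" using A(2) by (rule le_less_trans)
      then obtain r where "decision_at A T ids v r \<noteq> None" "r < Suc t"
        unfolding output_time_def by (auto simp: INF_less_iff)
      then show "\<exists>r\<le>t. decision_at A T ids v r \<noteq> None" by (intro exI[of _ r]) simp
    qed (rule lcl)
    have "robust \<P>" using robust_if_fast[of m] big m by (simp add: D_def k_def)
    then show False using nr by simp
  qed
  then show ?thesis unfolding complexity_poly_lower_def using \<epsilon> by blast
qed

text \<open>Combs realise every size \<open>1 + arity \<P> * q\<close>, so the lower bound speaks
  about arbitrarily large \<open>n\<close>, where a positive power exceeds any multiple of the
  logarithm. This turns the two implications from robustness into equivalences.\<close>

lemma not_O_log_and_poly_lower:
  assumes "is_lcl \<P>" "complexity_O_log c \<P>" "complexity_poly_lower c \<P>"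
  shows False
proof -
  obtain K N where K: "\<And>n. N \<le> n \<Longrightarrow> ereal_of_enat (round_complexity c \<P> n) \<le> ereal (K * ln (real n))"
    using assms(2) unfolding complexity_O_log_def by blast
  obtain \<epsilon> N' where \<epsilon>: "0 < \<epsilon>" and low: "\<And>n. N' \<le> n \<Longrightarrow> (\<exists>T. full_tree (arity \<P>) T \<and> card T = n) \<Longrightarrow>
     ereal (real n powr \<epsilon>) \<le> ereal_of_enat (round_complexity c \<P> n)"
    using assms(3) unfolding complexity_poly_lower_def by blast
  have "eventually (\<lambda>x. K * ln x < x powr \<epsilon>) at_top" using \<epsilon> by real_asymp
  then obtain B where B: "\<And>x. B \<le> x \<Longrightarrow> K * ln x < x powr \<epsilon>" unfolding eventually_at_top_linorder by blast
  have \<delta>: "0 < arity \<P>" using assms(1) by (simp add: is_lcl_def Suc_le_eq)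
  define q where "q = N + N' + nat \<lceil>B\<rceil>"
  define n where "n = 1 + arity \<P> * q"
  have "q \<le> arity \<P> * q" using \<delta> by simp
  then have n: "N \<le> n" "N' \<le> n" "B \<le> real n" unfolding n_def q_def by linarith+
  have "\<exists>T. full_tree (arity \<P>) T \<and> card T = n"
    using full_tree_comb[OF \<delta>, of q] card_comb[OF \<delta>, of q] by (auto simp: n_def)
  then have "ereal (real n powr \<epsilon>) \<le> ereal (K * ln (real n))" using low[OF n(2)] K[OF n(1)] order_trans by blast
  then show False using B[OF n(3)] by simp
qed

theorem theorem5p3:
  "\<exists>(P :: com) (p :: nat poly). \<forall>(\<P> :: lcl) (d :: data). is_lcl \<P> \<and> describes d \<P> \<longrightarrow>
     (\<exists>t b. answers P d t b \<and> t \<le> poly p (size d) \<and>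
        (\<forall>c\<ge>1. (b \<longleftrightarrow> complexity_O_log c \<P>) \<and> (\<not> b \<longleftrightarrow> complexity_poly_lower c \<P>)))"
proof (intro exI[of _ decide_prog] exI[of _ decide_poly] allI impI, elim conjE)
  fix \<P> d
  assume \<P>: "is_lcl \<P>" "describes d \<P>"
  then obtain t where t: "answers decide_prog d t (robust \<P>)" "t \<le> poly decide_poly (size d)"
    using decide_prog_correct by blast
  have "(robust \<P> \<longleftrightarrow> complexity_O_log c \<P>) \<and> (\<not> robust \<P> \<longleftrightarrow> complexity_poly_lower c \<P>)" if "1 \<le> c" for c
    using robust_O_log[OF \<P>(1) _ that] not_robust_poly_lower[OF \<P>(1) _ that]
      not_O_log_and_poly_lower[OF \<P>(1), of c] by blast
  then show "\<exists>t b. answers decide_prog d t b \<and> t \<le> poly decide_poly (size d) \<and>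
        (\<forall>c\<ge>1. (b \<longleftrightarrow> complexity_O_log c \<P>) \<and> (\<not> b \<longleftrightarrow> complexity_poly_lower c \<P>))"
    using t by blast
qed

end
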